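(* Let $m,d,L>0$ be integers. There exists $A=A(d,L,m)>0$ such that the following holds. Let $k=\mathbb F_q$ be a finite field of characteristic $p$, let $V$ be a finite-dimensional $k$-vector space, and let $X\subset V$ be a complete intersection of degree $d$ and codimension $L$. Let $f:X\to k$ be a function such that the restriction of $f$ to any affine subspace of dimension $\lceil\frac{m+1}{q-q/p}\rceil$ contained in $X$ is a polynomial of degree $m$ (i.e. of degree at most $m$), and the restriction of $f$ to $q^{-A}$-a.e. affine subspace of dimension $l=\lceil\frac{m}{q-q/p}\rceil$ contained in $X$ is a polynomial of degree $<m$. Then the restriction of $f$ to any affine subspace contained in $X$ is a polynomial of degree $<m$.
   Context: $X$ is identified with its set of $k$-points: $X=\{v\in V: P_1(v)=\dots=P_L(v)=0\}$ where $P_1,\dots,P_L:V\to k$ are polynomials over $k$ defining a subvariety of codimension $L$ (a complete intersection). "Degree $d$" refers to the bound $d$ on the degrees of the defining polynomials. A property holds for $\epsilon$-a.e. element of a finite set $S$ if it holds for at least $(1-\epsilon)|S|$ elements of $S$.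
   Formalization: Conclusion only for affine subspaces of dimension j with j ≥ l or j(q−1) < m; as stated it is false (q=4, m=3, X a line in k², f=y³). Fields and spaces have carriers in types fixed before A; taking the natural numbers covers all up to isomorphism. *)

theory Defs
  imports
    "HOL-Library.Extended_Nat"
    "HOL-Algebra.Indexed_Polynomials"
    "HOL-Algebra.Multiplicative_Group"
    "Jordan_Normal_Form.Missing_VectorSpace"
begin

text \<open>
  Fields and vector spaces are carrier-based records, because constants have to be uniform over
  all finite fields and all finite-dimensional vector spaces, which cannot be quantified over as
  types. Every finite field and every finite vector space has an isomorphic copy with carrier in
  the type \<open>nat\<close>, so a statement quantifying over \<open>K :: 'a ring\<close> and
  \<open>V :: ('a, 'v) module\<close> covers all of them at once in its instance with both type
  variables equal to \<open>nat\<close>.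

  A formal polynomial over \<open>K\<close> in variables indexed by \<open>B\<close> is an element of the
  library set \<open>ring.indexed_pset K B (carrier K)\<close>: a function from monomials (multisets of
  variables) to coefficients. Formal polynomials, and not just polynomial functions, are needed
  because over a finite field the codimension of a subvariety is not determined by its points
  over the field. For polynomials on a vector space the index set is a basis \<open>B\<close>, the
  variable of \<open>b\<close> being the \<open>b\<close>-th coordinate.
\<close>

abbreviation mpolys :: "('a, 'b) ring_scheme \<Rightarrow> 'i set \<Rightarrow> ('i multiset \<Rightarrow> 'a) set" where
  "mpolys K B \<equiv> ring.indexed_pset K B (carrier K)"

definition mpoly_degree_le :: "('a, 'b) ring_scheme \<Rightarrow> ('i multiset \<Rightarrow> 'a) \<Rightarrow> nat \<Rightarrow> bool" where
  "mpoly_degree_le K P n \<longleftrightarrow> (\<forall>\<mu>. P \<mu> \<noteq> \<zero>\<^bsub>K\<^esub> \<longrightarrow> size \<mu> \<le> n)"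

definition mpoly_eval :: "('a, 'b) ring_scheme \<Rightarrow> ('i multiset \<Rightarrow> 'a) \<Rightarrow> ('i \<Rightarrow> 'a) \<Rightarrow> 'a" where
  "mpoly_eval K P c =
     (\<Oplus>\<^bsub>K\<^esub>\<mu>\<in>{\<mu>. P \<mu> \<noteq> \<zero>\<^bsub>K\<^esub>}. P \<mu> \<otimes>\<^bsub>K\<^esub> (\<Otimes>\<^bsub>K\<^esub>i\<in>set_mset \<mu>. c i [^]\<^bsub>K\<^esub> count \<mu> i))"

definition mpoly_mult ::
  "('a, 'b) ring_scheme \<Rightarrow> ('i multiset \<Rightarrow> 'a) \<Rightarrow> ('i multiset \<Rightarrow> 'a) \<Rightarrow> ('i multiset \<Rightarrow> 'a)" where
  "mpoly_mult K P Q = (\<lambda>\<mu>. \<Oplus>\<^bsub>K\<^esub>\<nu>\<in>{\<nu>. \<nu> \<subseteq># \<mu>}. P \<nu> \<otimes>\<^bsub>K\<^esub> Q (\<mu> - \<nu>))"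

definition mpoly_ring :: "('a, 'b) ring_scheme \<Rightarrow> 'i set \<Rightarrow> ('i multiset \<Rightarrow> 'a) ring" where
  "mpoly_ring K B =
     \<lparr>carrier = mpolys K B,
      monoid.mult = mpoly_mult K,
      one = ring.indexed_const K \<one>\<^bsub>K\<^esub>,
      zero = ring.indexed_const K \<zero>\<^bsub>K\<^esub>,
      add = ring.indexed_padd K\<rparr>"

lemma finite_submultisets: "finite {\<nu>. \<nu> \<subseteq># (\<mu> :: 'i multiset)}"
proof (induction \<mu>)
  case empty show ?case by simp
next
  case (add x \<mu>)
  have "{\<nu>. \<nu> \<subseteq># add_mset x \<mu>} \<subseteq> {\<nu>. \<nu> \<subseteq># \<mu>} \<union> add_mset x ` {\<nu>. \<nu> \<subseteq># \<mu>}"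
  proof
    fix \<nu> assume "\<nu> \<in> {\<nu>. \<nu> \<subseteq># add_mset x \<mu>}"
    hence h: "\<nu> \<subseteq># add_mset x \<mu>" by simp
    show "\<nu> \<in> {\<nu>. \<nu> \<subseteq># \<mu>} \<union> add_mset x ` {\<nu>. \<nu> \<subseteq># \<mu>}"
    proof (cases "x \<in># \<nu>")
      case True
      then obtain \<rho> where "\<nu> = add_mset x \<rho>" by (meson multi_member_split)
      thus ?thesis using h by auto
    next
      case False
      hence "\<nu> \<subseteq># \<mu>" using h by (metis add_mset_remove_trivial diff_single_trivial subset_eq_diff_conv add_mset_add_single)
      thus ?thesis by simp
    qed
  qed
  thus ?case using add finite_subset by fastforce
qed

context cring begin

lemma carrier_coeff_mpoly_mult:
  assumes "carrier_coeff P" "carrier_coeff Q" shows "carrier_coeff (mpoly_mult R P Q)"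
  using assms unfolding carrier_coeff_def mpoly_mult_def by (auto intro!: finsum_closed)

lemma mpoly_mult_const:
  assumes "k \<in> carrier R" "carrier_coeff Q"
  shows "mpoly_mult R (indexed_const k) Q = (\<lambda>\<mu>. k \<otimes> Q \<mu>)"
proof
  fix \<mu>
  have "mpoly_mult R (indexed_const k) Q \<mu> = (\<Oplus>\<nu>\<in>{\<nu>. \<nu> \<subseteq># \<mu>}. if \<nu> = {#} then k \<otimes> Q \<mu> else \<zero>)"
    unfolding mpoly_mult_def using assms
    by (intro finsum_cong') (auto simp: carrier_coeff_def indexed_const_def)
  also have "\<dots> = (\<Oplus>\<nu>\<in>{\<nu>. \<nu> \<subseteq># \<mu>}. if {#} = \<nu> then k \<otimes> Q \<mu> else \<zero>)"
    by (intro finsum_cong') (use assms in \<open>auto simp: carrier_coeff_def\<close>)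
  also have "\<dots> = k \<otimes> Q \<mu>"
    using finsum_singleton[of "{#}" "{\<nu>. \<nu> \<subseteq># \<mu>}" "\<lambda>_. k \<otimes> Q \<mu>"] finite_submultisets[of \<mu>] assms
    by (auto simp: carrier_coeff_def)
  finally show "mpoly_mult R (indexed_const k) Q \<mu> = k \<otimes> Q \<mu>" .
qed

lemma mpoly_mult_padd:
  assumes "carrier_coeff P1" "carrier_coeff P2" "carrier_coeff Q"
  shows "mpoly_mult R (indexed_padd P1 P2) Q = indexed_padd (mpoly_mult R P1 Q) (mpoly_mult R P2 Q)"
proof
  fix \<mu>
  show "mpoly_mult R (indexed_padd P1 P2) Q \<mu> = indexed_padd (mpoly_mult R P1 Q) (mpoly_mult R P2 Q) \<mu>"
    unfolding mpoly_mult_def indexed_padd_def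
    using assms by (subst finsum_addf[symmetric])
      (auto simp: carrier_coeff_def l_distr intro!: finsum_cong')
qed

lemma mpoly_mult_pmult:
  assumes "carrier_coeff P" "carrier_coeff Q"
  shows "mpoly_mult R (indexed_pmult P i) Q = indexed_pmult (mpoly_mult R P Q) i"
proof
  fix \<mu>
  have P: "P \<nu> \<in> carrier R" and Q: "Q \<nu> \<in> carrier R" for \<nu> using assms by (auto simp: carrier_coeff_def)
  let ?S = "{\<nu>. \<nu> \<subseteq># \<mu> \<and> i \<in># \<nu>}"
  have fS: "finite ?S" using finite_submultisets[of \<mu>] by (rule rev_finite_subset) auto
  have "mpoly_mult R (indexed_pmult P i) Q \<mu> = (\<Oplus>\<nu>\<in>?S. P (\<nu> - {#i#}) \<otimes> Q (\<mu> - \<nu>))"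
    unfolding mpoly_mult_def indexed_pmult_def
    by (rule add.finprod_mono_neutral_cong) (auto simp: P Q finite_submultisets)
  also have "\<dots> = indexed_pmult (mpoly_mult R P Q) i \<mu>"
  proof (cases "i \<in># \<mu>")
    case False
    hence "?S = {}" by (auto dest: mset_subset_eqD)
    thus ?thesis unfolding \<open>?S = {}\<close> using False by (simp add: indexed_pmult_def)
  next
    case True
    then obtain \<rho> where r: "\<mu> = add_mset i \<rho>" by (meson multi_member_split)
    have S: "?S = add_mset i ` {\<nu>. \<nu> \<subseteq># \<rho>}"
      unfolding r by (auto elim!: multi_member_split[THEN exE] simp: image_iff dest!: multi_member_split)
    have "(\<Oplus>\<nu>\<in>?S. P (\<nu> - {#i#}) \<otimes> Q (\<mu> - \<nu>)) = (\<Oplus>\<nu>\<in>{\<nu>. \<nu> \<subseteq># \<rho>}. P (add_mset i \<nu> - {#i#}) \<otimes> Q (\<mu> - add_mset i \<nu>))"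
      unfolding S by (rule finsum_reindex) (auto simp: P Q inj_on_def)
    thus ?thesis using True by (simp add: indexed_pmult_def mpoly_mult_def r)
  qed
  finally show "mpoly_mult R (indexed_pmult P i) Q \<mu> = indexed_pmult (mpoly_mult R P Q) i \<mu>" .
qed

lemma mpoly_mult_comm:
  fixes P Q :: "'i multiset \<Rightarrow> 'a"
  assumes "carrier_coeff P" "carrier_coeff Q"
  shows "mpoly_mult R P Q = mpoly_mult R Q P"
proof
  fix \<mu> :: "'i multiset"
  have P: "P \<nu> \<in> carrier R" and Q: "Q \<nu> \<in> carrier R" for \<nu> using assms by (auto simp: carrier_coeff_def)
  let ?S = "{\<nu>. \<nu> \<subseteq># \<mu>}"
  have S: "?S = (\<lambda>\<nu>. \<mu> - \<nu>) ` ?S"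
  proof (rule Set.set_eqI, rule iffI)
    fix \<nu> assume "\<nu> \<in> (\<lambda>\<nu>. \<mu> - \<nu>) ` ?S" thus "\<nu> \<in> ?S" by auto
  next
    fix \<nu> assume "\<nu> \<in> ?S" thus "\<nu> \<in> (\<lambda>\<nu>. \<mu> - \<nu>) ` ?S"
      by (intro image_eqI[of _ _ "\<mu> - \<nu>"]) (auto simp: multiset_eq_iff subseteq_mset_def)
  qed
  have inj: "inj_on (\<lambda>\<nu>. \<mu> - \<nu>) ?S"
    by (rule inj_on_inverseI[where g="\<lambda>\<nu>. \<mu> - \<nu>"]) (auto simp: multiset_eq_iff subseteq_mset_def)
  have "mpoly_mult R P Q \<mu> = (\<Oplus>\<nu>\<in>(\<lambda>\<nu>. \<mu> - \<nu>) ` ?S. P \<nu> \<otimes> Q (\<mu> - \<nu>))"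
    unfolding mpoly_mult_def using S by simp
  also have "\<dots> = (\<Oplus>\<nu>\<in>?S. P (\<mu> - \<nu>) \<otimes> Q (\<mu> - (\<mu> - \<nu>)))"
    by (rule finsum_reindex[OF _ inj]) (auto simp: P Q)
  also have "\<dots> = mpoly_mult R Q P \<mu>"
    unfolding mpoly_mult_def
  proof (rule finsum_cong')
    fix \<nu> assume "\<nu> \<in> ?S"
    hence "\<mu> - (\<mu> - \<nu>) = \<nu>" by (auto simp: multiset_eq_iff subseteq_mset_def)
    thus "P (\<mu> - \<nu>) \<otimes> Q (\<mu> - (\<mu> - \<nu>)) = Q \<nu> \<otimes> P (\<mu> - \<nu>)" by (simp add: m_comm P Q)
  qed (auto simp: P Q)
  finally show "mpoly_mult R P Q \<mu> = mpoly_mult R Q P \<mu>" .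
qed

lemma carrier_coeff_mpolys: "P \<in> mpolys R B \<Longrightarrow> carrier_coeff P"
  using indexed_pset_in_carrier by blast

lemma mpoly_smult_closed:
  fixes Q :: "'i multiset \<Rightarrow> 'a"
  assumes "Q \<in> mpolys R B" "k \<in> carrier R" shows "(\<lambda>\<mu>. k \<otimes> Q \<mu>) \<in> mpolys R B"
  using assms
proof (induction rule: indexed_pset.induct)
  case (indexed_const c)
  have "(\<lambda>\<mu>. k \<otimes> indexed_const c (\<mu> :: 'i multiset)) = indexed_const (k \<otimes> c)"
    using indexed_const by (auto simp: indexed_const_def)
  thus ?case using indexed_const indexed_pset.indexed_const[of "k \<otimes> c" "carrier R" B] by simp
next
  case (indexed_padd P Q)
  have "(\<lambda>\<mu>. k \<otimes> (indexed_padd P Q) \<mu>) = indexed_padd (\<lambda>\<mu>. k \<otimes> P \<mu>) (\<lambda>\<mu>. k \<otimes> Q \<mu>)"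
    using indexed_padd carrier_coeff_mpolys[of P B] carrier_coeff_mpolys[of Q B] by (auto simp: indexed_padd_def carrier_coeff_def r_distr)
  thus ?case using indexed_padd by (auto intro: indexed_pset.intros)
next
  case (indexed_pmult P i)
  have "(\<lambda>\<mu>. k \<otimes> (indexed_pmult P i) \<mu>) = indexed_pmult (\<lambda>\<mu>. k \<otimes> P \<mu>) i"
    using indexed_pmult by (auto simp: indexed_pmult_def)
  thus ?case using indexed_pmult by (auto intro: indexed_pset.intros)
qed

lemma mpoly_mult_closed:
  assumes "P \<in> mpolys R B" "Q \<in> mpolys R B" shows "mpoly_mult R P Q \<in> mpolys R B"
  using assms
proof (induction rule: indexed_pset.induct)
  case (indexed_const c) thus ?case by (simp add: mpoly_mult_const carrier_coeff_mpolys mpoly_smult_closed)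
next
  case (indexed_padd P Q) thus ?case by (simp add: mpoly_mult_padd carrier_coeff_mpolys indexed_pset.intros)
next
  case (indexed_pmult P i) thus ?case by (simp add: mpoly_mult_pmult carrier_coeff_mpolys indexed_pset.intros)
qed

lemma mpoly_mult_assoc:
  assumes "P \<in> mpolys R B" "carrier_coeff Q" "carrier_coeff S"
  shows "mpoly_mult R (mpoly_mult R P Q) S = mpoly_mult R P (mpoly_mult R Q S)"
  using assms
proof (induction rule: indexed_pset.induct)
  case (indexed_const c)
  have "mpoly_mult R (\<lambda>\<mu>. c \<otimes> Q \<mu>) S = (\<lambda>\<mu>. c \<otimes> mpoly_mult R Q S \<mu>)"
    using indexed_const unfolding mpoly_mult_def
    by (auto simp: finsum_rdistr finite_submultisets carrier_coeff_def m_assoc intro!: ext finsum_cong')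
  thus ?case using indexed_const by (simp add: mpoly_mult_const carrier_coeff_mpoly_mult)
next
  case (indexed_padd P Q) thus ?case by (simp add: mpoly_mult_padd carrier_coeff_mpolys carrier_coeff_mpoly_mult)
next
  case (indexed_pmult P i) thus ?case by (simp add: mpoly_mult_pmult carrier_coeff_mpolys carrier_coeff_mpoly_mult)
qed

lemma mpoly_ring_cring: "cring (mpoly_ring R B)"
proof (rule cringI)
  show "abelian_group (mpoly_ring R B)"
  proof (rule abelian_groupI)
    fix P assume "P \<in> carrier (mpoly_ring R B)"
    hence P: "P \<in> mpolys R B" by (simp add: mpoly_ring_def)
    have "(\<lambda>\<mu>. (\<ominus> \<one>) \<otimes> P \<mu>) \<in> mpolys R B" by (rule mpoly_smult_closed[OF P]) simp
    moreover have "indexed_padd (\<lambda>\<mu>. (\<ominus> \<one>) \<otimes> P \<mu>) P = indexed_const \<zero>"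
      using carrier_coeff_mpolys[OF P] by (auto simp: indexed_padd_def indexed_const_def carrier_coeff_def l_minus l_neg)
    ultimately show "\<exists>y\<in>carrier (mpoly_ring R B). y \<oplus>\<^bsub>mpoly_ring R B\<^esub> P = \<zero>\<^bsub>mpoly_ring R B\<^esub>"
      unfolding mpoly_ring_def by auto
  qed (auto simp: mpoly_ring_def indexed_padd_zero carrier_coeff_mpolys indexed_pset.intros,
       (auto dest!: carrier_coeff_mpolys simp: indexed_padd_def carrier_coeff_def a_ac fun_eq_iff)[2])
  show "comm_monoid (mpoly_ring R B)"
  proof (rule comm_monoidI)
    fix P Q assume "P \<in> carrier (mpoly_ring R B)" "Q \<in> carrier (mpoly_ring R B)"
    thus "P \<otimes>\<^bsub>mpoly_ring R B\<^esub> Q = Q \<otimes>\<^bsub>mpoly_ring R B\<^esub> P"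
      by (simp add: mpoly_ring_def mpoly_mult_comm carrier_coeff_mpolys)
  next
    fix P assume "P \<in> carrier (mpoly_ring R B)"
    thus "\<one>\<^bsub>mpoly_ring R B\<^esub> \<otimes>\<^bsub>mpoly_ring R B\<^esub> P = P"
      using carrier_coeff_mpolys[of P B] by (auto simp: mpoly_ring_def mpoly_mult_const carrier_coeff_def)
  qed (auto simp: mpoly_ring_def mpoly_mult_closed mpoly_mult_assoc carrier_coeff_mpolys indexed_pset.intros)
qed (auto simp: mpoly_ring_def mpoly_mult_padd carrier_coeff_mpolys)

end

text \<open>
  The height of a prime \<open>P\<close> is the codimension of the irreducible closed subset \<open>V(P)\<close> of
  \<open>Spec R\<close>; the codimension of the zero locus of \<open>S\<close> is the least codimension of an irreducible
  closed subset contained in it (and is \<open>\<infinity>\<close> if \<open>S\<close> generates the unit ideal).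
\<close>

definition prime_height :: "('a, 'b) ring_scheme \<Rightarrow> 'a set \<Rightarrow> enat" where
  "prime_height R P =
     (SUP n\<in>{n. \<exists>C :: nat \<Rightarrow> 'a set. C n = P \<and> (\<forall>i\<le>n. primeideal (C i) R) \<and>
                       (\<forall>i<n. C i \<subset> C (Suc i))}. enat n)"

definition zero_locus_codim :: "('a, 'b) ring_scheme \<Rightarrow> 'a set \<Rightarrow> enat" where
  "zero_locus_codim R S = (INF P\<in>{P. primeideal P R \<and> S \<subseteq> P}. prime_height R P)"

definition complete_intersection ::
  "('a, 'b) ring_scheme \<Rightarrow> ('a, 'v, 'c) module_scheme \<Rightarrow> nat \<Rightarrow> nat \<Rightarrow> 'v set \<Rightarrow> bool" where
  "complete_intersection K V d L Xk \<longleftrightarrow>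
     (\<exists>B (P :: nat \<Rightarrow> 'v multiset \<Rightarrow> 'a).
        vectorspace.basis K V B \<and>
        (\<forall>i<L. P i \<in> mpolys K B \<and> mpoly_degree_le K (P i) d) \<and>
        zero_locus_codim (mpoly_ring K B) (P ` {..<L}) = enat L \<and>
        Xk = {module.lincomb V c B | c.
               c \<in> B \<rightarrow> carrier K \<and> (\<forall>i<L. mpoly_eval K (P i) c = \<zero>\<^bsub>K\<^esub>)})"

definition affine_subspace ::
  "('a, 'b) ring_scheme \<Rightarrow> ('a, 'v, 'c) module_scheme \<Rightarrow> nat \<Rightarrow> 'v set \<Rightarrow> bool" where
  "affine_subspace K V j W \<longleftrightarrow>
     (\<exists>a\<in>carrier V. \<exists>U. VectorSpace.subspace K U V \<and> vectorspace.dim K (V\<lparr>carrier := U\<rparr>) = j \<and>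
        W = {a \<oplus>\<^bsub>V\<^esub> u | u. u \<in> U})"

text \<open>The restriction of \<open>f\<close> to the affine subspace \<open>W\<close> is a polynomial of degree at most
  \<open>n\<close> in affine coordinates on \<open>W\<close>.\<close>

definition polynomial_on ::
  "('a, 'b) ring_scheme \<Rightarrow> ('a, 'v, 'c) module_scheme \<Rightarrow> nat \<Rightarrow> 'v set \<Rightarrow> ('v \<Rightarrow> 'a) \<Rightarrow> bool" where
  "polynomial_on K V n W f \<longleftrightarrow>
     (\<exists>a\<in>carrier V. \<exists>U B. VectorSpace.subspace K U V \<and> W = {a \<oplus>\<^bsub>V\<^esub> u | u. u \<in> U} \<and>
        vectorspace.basis K (V\<lparr>carrier := U\<rparr>) B \<and>
        (\<exists>Q\<in>mpolys K B. mpoly_degree_le K Q n \<and>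
           (\<forall>c\<in>B \<rightarrow> carrier K. f (a \<oplus>\<^bsub>V\<^esub> module.lincomb V c B) = mpoly_eval K Q c)))"

definition for_ae :: "real \<Rightarrow> 's set \<Rightarrow> ('s \<Rightarrow> bool) \<Rightarrow> bool" where
  "for_ae \<epsilon> S Q \<longleftrightarrow> real (card {s \<in> S. Q s}) \<ge> (1 - \<epsilon>) * real (card S)"

definition ring_characteristic :: "('a, 'b) ring_scheme \<Rightarrow> nat" where
  "ring_characteristic K = group.ord (add_monoid K) \<one>\<^bsub>K\<^esub>"

text \<open>
  \<open>testing_dim p q n\<close> is \<open>\<lceil>n / (q - q/p)\<rceil>\<close>. Affine subspaces of dimension
  \<open>l = testing_dim p q m\<close> only control the subspaces of dimension at least \<open>l\<close>. A function on
  a \<open>j\<close>-dimensional space over a field with \<open>q\<close> elements is automatically a polynomial of degree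
  at most \<open>j * (q - 1)\<close>, which is less than \<open>m\<close> for all \<open>j < l\<close> if \<open>q\<close> is prime or
  \<open>l = 1\<close>, but not in general: for \<open>q = 4\<close>, \<open>m = 3\<close> (so \<open>l = 2\<close>), the line \<open>x = 0\<close> in the plane
  contains no affine planes, yet \<open>y\<^sup>3\<close> is not a polynomial of degree less than \<open>3\<close> on it.
  Statements about all affine subspaces contained in a set therefore have to leave out the
  dimensions \<open>j < l\<close> with \<open>m \<le> j * (q - 1)\<close>.
\<close>

definition testing_dim :: "nat \<Rightarrow> nat \<Rightarrow> nat \<Rightarrow> nat" where
  "testing_dim p q n = nat \<lceil>real n / (real q - real q / real p)\<rceil>"

end

theory Submission
  imports Defs "HOL-Algebra.Sylow" "HOL-Computational_Algebra.Primes"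
begin

text \<open>
  Let the field \<open>K\<close> have \<open>q = p * Q\<close> elements, with \<open>p\<close> the characteristic, and call a subspace bad if the function \<open>f\<close> is
  not a polynomial of degree less than \<open>m\<close> on it. A single bad subspace of dimension
  \<open>l = testing_dim p q m\<close> in \<open>X\<close> forces a positive proportion of all \<open>l\<close>-dimensional subspaces
  in \<open>X\<close> to be bad, and the proportion is bounded below by a power \<open>q\<^bsup>-C\<^esup>\<close> whose exponent depends
  on \<open>m\<close>, \<open>d\<close> and \<open>L\<close> only. If \<open>A > C\<close>, a function satisfying the hypothesis has therefore no bad
  \<open>l\<close>-dimensional subspaces, and the larger dimensions follow.

  \<^bold>\<open>Moments.\<close> The sum of \<open>x\<^sup>j\<close> over the field vanishes for \<open>j < q - 1\<close>. It follows
  that a function on \<open>K\<^sup>I\<close> is a polynomial of degree less than \<open>n\<close> if and only if its sums against all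
  monomials of degree at most \<open>|I| (q - 1) - n\<close> vanish (\<open>moment_plt_zero\<close>, \<open>plt_of_moments\<close>). This
  turns a bound on the degree into linear equations; in particular it is no condition at all if
  \<open>|I| (q - 1) < n\<close>, which settles the subspaces of dimension \<open>j\<close> with \<open>j (q - 1) < m\<close>.

  \<^bold>\<open>Passing to larger subspaces.\<close> If \<open>n \<le> T (q - Q)\<close> and a function on an affine space of dimension at
  least \<open>T\<close> has degree less than \<open>n\<close> on all \<open>T\<close>-dimensional affine subspaces, it has degree less than
  \<open>n\<close> (\<open>plt_of_subspace_restrictions\<close>, a theorem of Kaufman and Ron). By induction it is enough
  to pass from hyperplanes to the whole space (\<open>hyperplane_step\<close>). Since \<open>1 - g\<^bsup>q - 1\<^esup>\<close> is the
  indicator function of the hyperplane \<open>g = 0\<close>, the function is orthogonal to \<open>h g\<^bsup>q - 1\<^esup>\<close> for all affine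
  \<open>g\<close> and all \<open>h\<close> of small degree; replacing \<open>g\<close> by \<open>c u + g\<close> and comparing coefficients of powers of \<open>c\<close>
  yields all monomials that are needed, because the relevant binomial coefficients are prime to \<open>p\<close>.
  The theorem is used twice: with \<open>n = m\<close> and \<open>T = l\<close> to conclude, and with \<open>n = m + 1\<close> to see that \<open>f\<close>
  has degree at most \<open>m\<close> on all subspaces in \<open>X\<close> of dimension greater than \<open>l\<close>.

  \<^bold>\<open>Many bad subspaces from one.\<close> Parametrise a bad \<open>l\<close>-dimensional \<open>W0\<close> by an affine frame, that is, a
  base point and \<open>l\<close> directions. Add \<open>(m + 1) (l + 1)\<close> further directions \<open>x\<^bsub>r,u\<^esub>\<close>, with \<open>r \<le> m\<close> and
  \<open>u\<close> running through the \<open>l + 1\<close> vectors of the frame. By the Chevalley--Warning argument, a proportion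
  of at least \<open>q\<^bsup>-N\<^esup>\<close> of all choices of \<open>x\<close> keeps the spanned affine subspace inside \<open>X\<close>
  (\<open>many_extensions\<close>). Unless all the new directions stay within \<open>W0\<close>,
  this subspace is larger than \<open>W0\<close> and \<open>f\<close> has degree at most \<open>m\<close> on it. For
  \<open>\<sigma> \<in> K\<^bsup>m + 1\<^esup>\<close> add \<open>\<Sum>\<^sub>r \<sigma>\<^sub>r x\<^bsub>r,u\<^esub>\<close> to each vector \<open>u\<close> of the frame. The moment that shows \<open>W0\<close> to be bad
  is then a polynomial in \<open>\<sigma>\<close> of degree at most \<open>m < (m + 1) (q - 1)\<close> that does not vanish at \<open>0\<close>. Its
  sum over all \<open>\<sigma>\<close> vanishes, so it is non-zero for some \<open>\<sigma> \<noteq> 0\<close>, and the perturbed frame is bad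
  as well (\<open>bad_perturbation\<close>). For fixed \<open>\<sigma> \<noteq> 0\<close> the sums \<open>\<Sum>\<^sub>r \<sigma>\<^sub>r x\<^sub>r\<close> are equidistributed
  (\<open>count_by_combinations\<close>), so that a proportion of about \<open>q\<^bsup>-N-m-1\<^esup>\<close> of all frames is bad; after
  discarding the frames that are not injective, this gives the bound on bad subspaces
  (\<open>bad_fraction\<close>).
\<close>

section \<open>Power sums over a finite field\<close>

locale galois_field = field K for K (structure) +
  assumes finite_carrier: "finite (carrier K)"
begin

abbreviation q where "q \<equiv> card (carrier K)"

abbreviation pts :: "'i set \<Rightarrow> ('i \<Rightarrow> 'a) set" where "pts I \<equiv> I \<rightarrow>\<^sub>E carrier K"

lemma finite_pts: "finite I \<Longrightarrow> finite (pts I)"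
  by (simp add: finite_PiE finite_carrier)

lemma pts_mem: "x \<in> pts I \<Longrightarrow> i \<in> I \<Longrightarrow> x i \<in> carrier K"
  by (rule PiE_mem)

lemma finsum_Times:
  assumes "finite A" "finite B" "\<And>x y. x \<in> A \<Longrightarrow> y \<in> B \<Longrightarrow> f x y \<in> carrier K"
  shows "(\<Oplus>z\<in>A \<times> B. f (fst z) (snd z)) = (\<Oplus>x\<in>A. \<Oplus>y\<in>B. f x y)"
  using assms(1,3)
proof (induction A rule: finite_induct)
  case (insert x A)
  have e: "insert x A \<times> B = Pair x ` B \<union> A \<times> B" by auto
  have "(\<Oplus>z\<in>insert x A \<times> B. f (fst z) (snd z)) =
      (\<Oplus>z\<in>Pair x ` B. f (fst z) (snd z)) \<oplus> (\<Oplus>z\<in>A \<times> B. f (fst z) (snd z))"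
    unfolding e by (rule finsum_Un_disjoint) (use insert assms(2) in auto)
  also have "(\<Oplus>z\<in>Pair x ` B. f (fst z) (snd z)) = (\<Oplus>y\<in>B. f x y)"
    using insert by (subst finsum_reindex) (auto simp: inj_on_def)
  finally show ?case using insert by (simp add: Pi_def finsum_closed)
qed simp

lemma finsum_swap:
  assumes "finite A" "finite B" "\<And>x y. x \<in> A \<Longrightarrow> y \<in> B \<Longrightarrow> f x y \<in> carrier K"
  shows "(\<Oplus>x\<in>A. \<Oplus>y\<in>B. f x y) = (\<Oplus>y\<in>B. \<Oplus>x\<in>A. f x y)"
  using assms(1,3)
proof (induction A rule: finite_induct)
  case (insert x A)
  have "(\<Oplus>y\<in>B. \<Oplus>x\<in>insert x A. f x y) = (\<Oplus>y\<in>B. f x y \<oplus> (\<Oplus>x\<in>A. f x y))"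
    by (rule finsum_cong') (use insert in \<open>auto simp: finsum_closed Pi_def\<close>)
  also have "\<dots> = (\<Oplus>y\<in>B. f x y) \<oplus> (\<Oplus>y\<in>B. \<Oplus>x\<in>A. f x y)"
    by (rule finsum_addf) (use insert in \<open>auto simp: finsum_closed Pi_def\<close>)
  finally show ?case using insert by (simp add: Pi_def finsum_closed)
qed simp

lemma sum_pts_insert:
  assumes "finite I" "i \<notin> I" "\<And>x. x \<in> pts (insert i I) \<Longrightarrow> F x \<in> carrier K"
  shows "(\<Oplus>x\<in>pts (insert i I). F x) = (\<Oplus>c\<in>carrier K. \<Oplus>y\<in>pts I. F (y(i := c)))"
proof -
  have F: "F (y(i := c)) \<in> carrier K" if "c \<in> carrier K" "y \<in> pts I" for c y
    using that assms(3) by (auto simp: PiE_insert_eq)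
  have e: "pts (insert i I) = (\<lambda>z. (snd z)(i := fst z)) ` (carrier K \<times> pts I)"
    unfolding PiE_insert_eq by (auto simp: case_prod_beta)
  have inj: "inj_on (\<lambda>z. (snd z)(i := fst z)) (carrier K \<times> pts I)"
    using inj_combinator[OF assms(2), of "\<lambda>_. carrier K"] by (simp add: case_prod_beta inj_on_def)
  have "(\<Oplus>x\<in>pts (insert i I). F x) = (\<Oplus>z\<in>carrier K \<times> pts I. F ((snd z)(i := fst z)))"
    unfolding e by (rule finsum_reindex[OF _ inj]) (auto simp: F)
  also have "\<dots> = (\<Oplus>c\<in>carrier K. \<Oplus>y\<in>pts I. F (y(i := c)))"
    by (rule finsum_Times) (auto simp: F finite_carrier finite_pts assms(1))
  finally show ?thesis .
qed

lemma q_ge_2: "q \<ge> 2"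
proof -
  have "card {\<zero>, \<one>} \<le> q" by (rule card_mono[OF finite_carrier]) auto
  thus ?thesis by simp
qed

lemma finsum_const_card:
  assumes "c \<in> carrier K" shows "(\<Oplus>x\<in>carrier K. c) = \<zero>"
proof -
  interpret A: group "add_monoid K" by (rule add.is_group)
  have "(\<Oplus>x\<in>carrier K. c) = [q] \<cdot> c" using assms by (rule add.finprod_const)
  also have "\<dots> = \<zero>" using add.pow_order_eq_1[of c] assms by (simp add: order_def)
  finally show ?thesis .
qed

lemma pow_q_minus_1: "x \<in> carrier K \<Longrightarrow> x \<noteq> \<zero> \<Longrightarrow> x [^] (q - 1) = \<one>"
proof -
  assume x: "x \<in> carrier K" "x \<noteq> \<zero>"
  interpret M: group "Multiplicative_Group.mult_of K" by (rule field_mult_group)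
  have "x [^]\<^bsub>Multiplicative_Group.mult_of K\<^esub> order (Multiplicative_Group.mult_of K) = \<one>\<^bsub>Multiplicative_Group.mult_of K\<^esub>"
    by (rule M.pow_order_eq_1) (use x in auto)
  thus ?thesis by (simp add: order_def Multiplicative_Group.nat_pow_mult_of card_Diff_singleton)
qed

lemma pow_q: "x \<in> carrier K \<Longrightarrow> x [^] q = x"
proof -
  assume x: "x \<in> carrier K"
  have "q = Suc (q - 1)" using q_ge_2 by simp
  hence "x [^] q = x [^] (q - 1) \<otimes> x" using x by (metis nat_pow_Suc)
  thus ?thesis using x pow_q_minus_1[of x] by (cases "x = \<zero>") auto
qed

text \<open>
  Multiplying the summation variable by a generator \<open>a\<close> of the multiplicative group
  multiplies the sum by \<open>a\<^sup>j\<close>, which is not \<open>1\<close> for \<open>0 < j < q - 1\<close>.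
\<close>

lemma sum_pow_small:
  assumes "j < q - 1" shows "(\<Oplus>x\<in>carrier K. x [^] j) = \<zero>"
proof (cases "j = 0")
  case True thus ?thesis by (simp add: finsum_const_card)
next
  case False
  obtain a where a: "a \<in> carrier (Multiplicative_Group.mult_of K)" and gen: "carrier (Multiplicative_Group.mult_of K) = {a[^]i | i::nat . i \<in> UNIV}"
    using finite_field_mult_group_has_gen[OF finite_carrier] by blast
  have aK: "a \<in> carrier K" "a \<noteq> \<zero>" using a by auto
  have ne: "a [^] j \<noteq> \<one>"
  proof
    assume e: "a [^] j = \<one>"
    have "carrier (Multiplicative_Group.mult_of K) \<subseteq> (\<lambda>i. a [^] i) ` {..<j}"
    proof
      fix x assume "x \<in> carrier (Multiplicative_Group.mult_of K)"
      then obtain i :: nat where i: "x = a [^] i" using gen by blast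
      have "a [^] i = a [^] (j * (i div j) + i mod j)" by simp
      also have "\<dots> = (a [^] j) [^] (i div j) \<otimes> a [^] (i mod j)"
        using aK by (simp only: nat_pow_mult[symmetric] nat_pow_pow)
      also have "\<dots> = a [^] (i mod j)" using e aK by simp
      finally show "x \<in> (\<lambda>i. a [^] i) ` {..<j}" using i False by auto
    qed
    hence "card (carrier (Multiplicative_Group.mult_of K)) \<le> card ((\<lambda>i. a [^] i) ` {..<j})" by (rule card_mono[rotated]) simp
    also have "\<dots> \<le> j" using card_image_le[of "{..<j}" "\<lambda>i. a [^] i"] by simp
    finally show False using assms by (simp add: card_Diff_singleton)
  qed
  let ?S = "\<Oplus>x\<in>carrier K. x [^] j"
  have S: "?S \<in> carrier K" by (auto intro: finsum_closed)
  have inj: "inj_on (\<lambda>x. a \<otimes> x) (carrier K)"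
    using aK m_lcancel by (intro inj_onI) blast
  have im: "carrier K = (\<lambda>x. a \<otimes> x) ` carrier K"
  proof -
    note inj
    moreover have "(\<lambda>x. a \<otimes> x) ` carrier K \<subseteq> carrier K" using aK by auto
    ultimately show ?thesis using endo_inj_surj[OF finite_carrier] by metis
  qed
  have "?S = (\<Oplus>x\<in>(\<lambda>x. a \<otimes> x) ` carrier K. x [^] j)" using im by simp
  also have "\<dots> = (\<Oplus>x\<in>carrier K. (a \<otimes> x) [^] j)"
    using aK by (intro finsum_reindex inj) auto
  also have "\<dots> = (\<Oplus>x\<in>carrier K. a [^] j \<otimes> x [^] j)"
    using aK by (intro finsum_cong') (auto simp: nat_pow_distrib)
  also have "\<dots> = a [^] j \<otimes> ?S" using aK by (intro finsum_rdistr[symmetric]) (auto simp: finite_carrier)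
  finally have "(a [^] j \<ominus> \<one>) \<otimes> ?S = \<zero>"
    using S aK by (simp add: minus_eq l_distr l_minus r_neg)
  moreover have "a [^] j \<ominus> \<one> \<noteq> \<zero>" using ne aK by simp
  ultimately show ?thesis using integral[of "a [^] j \<ominus> \<one>" ?S] aK S by auto
qed

lemma sum_pow_q_minus_1: "(\<Oplus>x\<in>carrier K. x [^] (q - 1)) = \<ominus> \<one>"
proof -
  have e: "carrier K = insert \<zero> (carrier K - {\<zero>})" by auto
  let ?S = "\<Oplus>x\<in>carrier K. x [^] (q - 1)"
  let ?T = "\<Oplus>x\<in>carrier K - {\<zero>}. x [^] (q - 1)"
  have fin: "finite (carrier K - {\<zero>})" using finite_carrier by simp
  have T: "?T = (\<Oplus>x\<in>carrier K - {\<zero>}. \<one>)"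
    by (rule finsum_cong') (use pow_q_minus_1 in auto)
  have "?S = \<zero> [^] (q - 1) \<oplus> ?T" by (subst e, subst finsum_insert[OF fin]) auto
  also have "\<zero> [^] (q - 1) = \<zero>" using q_ge_2 by (intro nat_pow_zero) simp
  finally have S: "?S = ?T" by (simp add: T finsum_closed)
  have "\<zero> = (\<Oplus>x\<in>carrier K. \<one>)" by (simp add: finsum_const_card)
  also have "\<dots> = \<one> \<oplus> ?T" unfolding T by (subst e, subst finsum_insert[OF fin]) auto
  finally have "\<one> \<oplus> ?T = \<zero>" by simp
  hence "?T = \<ominus> \<one>" using T by (metis add.inv_closed finsum_closed Pi_I one_closed minus_equality a_comm)
  thus ?thesis using S by simp
qed

section \<open>Polynomial functions and their moments\<close>

definition mono :: "'i set \<Rightarrow> ('i \<Rightarrow> nat) \<Rightarrow> ('i \<Rightarrow> 'a) \<Rightarrow> 'a" where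
  "mono I b x = (\<Otimes>i\<in>I. x i [^] b i)"

definition moment :: "'i set \<Rightarrow> ('i \<Rightarrow> nat) \<Rightarrow> (('i \<Rightarrow> 'a) \<Rightarrow> 'a) \<Rightarrow> 'a" where
  "moment I b f = (\<Oplus>x\<in>pts I. f x \<otimes> mono I b x)"

text \<open>
  \<open>plt I n f\<close> says that \<open>f\<close> agrees on \<open>K\<^sup>I\<close> with a polynomial of degree less than \<open>n\<close>. The bound
  is strict so that the zero function is the only one of degree less than \<open>0\<close>. The inductive
  form reduces closure properties to rule induction on the way \<open>f\<close> is built up; formal polynomials enter
  only when the definitions for vector spaces are unfolded.
\<close>

inductive plt :: "'i set \<Rightarrow> nat \<Rightarrow> (('i \<Rightarrow> 'a) \<Rightarrow> 'a) \<Rightarrow> bool" for I :: "'i set" where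
  plt_zero: "(\<And>x. x \<in> pts I \<Longrightarrow> f x = \<zero>) \<Longrightarrow> plt I n f"
| plt_const: "c \<in> carrier K \<Longrightarrow> (\<And>x. x \<in> pts I \<Longrightarrow> f x = c) \<Longrightarrow> plt I (Suc n) f"
| plt_add: "plt I n f \<Longrightarrow> plt I n g \<Longrightarrow> (\<And>x. x \<in> pts I \<Longrightarrow> h x = f x \<oplus> g x) \<Longrightarrow> plt I n h"
| plt_var_mult: "plt I n f \<Longrightarrow> i \<in> I \<Longrightarrow> (\<And>x. x \<in> pts I \<Longrightarrow> h x = x i \<otimes> f x) \<Longrightarrow> plt I (Suc n) h"

lemma plt_closed: "plt I n f \<Longrightarrow> x \<in> pts I \<Longrightarrow> f x \<in> carrier K"
  by (induction rule: plt.induct) (auto simp: PiE_mem)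

lemma plt_cong:
  assumes "plt I n f" "\<And>x. x \<in> pts I \<Longrightarrow> g x = f x" shows "plt I n g"
  using assms
proof (induction arbitrary: g rule: plt.induct)
  case (plt_zero f n) thus ?case by (auto intro: plt.plt_zero)
next
  case (plt_const c f n) thus ?case by (auto intro: plt.plt_const)
next
  case (plt_add n f g' h) thus ?case by (metis plt.plt_add)
next
  case (plt_var_mult n f i h) thus ?case by (metis plt.plt_var_mult)
qed

lemma plt_mono: "plt I n f \<Longrightarrow> n \<le> n' \<Longrightarrow> plt I n' f"
proof (induction arbitrary: n' rule: plt.induct)
  case (plt_zero f n) thus ?case by (auto intro: plt.plt_zero)
next
  case (plt_const c f n) thus ?case by (cases n') (auto intro: plt.plt_const)
next
  case (plt_add n f g h) thus ?case by (metis plt.plt_add)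
next
  case (plt_var_mult n f i h)
  then obtain k where k: "n' = Suc k" "n \<le> k" by (cases n') auto
  show ?case unfolding k(1)
    by (rule plt.plt_var_mult[OF plt_var_mult.IH[OF k(2)]]) (use plt_var_mult in auto)
qed

lemma plt_0D: "plt I 0 f \<Longrightarrow> x \<in> pts I \<Longrightarrow> f x = \<zero>"
  by (induction "0 :: nat" f rule: plt.induct) auto

lemma plt_smult:
  assumes "plt I n f" "c \<in> carrier K" shows "plt I n (\<lambda>x. c \<otimes> f x)"
  using assms
proof (induction rule: plt.induct)
  case (plt_zero f n) thus ?case by (auto intro: plt.plt_zero)
next
  case (plt_const d f n) thus ?case by (auto intro: plt.plt_const[of "c \<otimes> d"])
next
  case (plt_add n f g h)
  thus ?case by (auto intro!: plt.plt_add[OF plt_add.IH] simp: r_distr plt_closed)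
next
  case (plt_var_mult n f i h)
  have fc: "f x \<in> carrier K" "x i \<in> carrier K" if "x \<in> pts I" for x
    using plt_closed[OF plt_var_mult.hyps(1) that] pts_mem[OF that plt_var_mult.hyps(2)] .
  show ?case
    by (rule plt.plt_var_mult[OF plt_var_mult.IH, of i])
       (use plt_var_mult fc in \<open>auto simp: m_lcomm\<close>)
qed

lemma plt_mult:
  assumes "plt I m g" "plt I n f" shows "plt I (n + (m - 1)) (\<lambda>x. f x \<otimes> g x)"
  using assms
proof (induction rule: plt.induct)
  case (plt_zero g m) thus ?case by (auto intro!: plt.plt_zero simp: plt_closed)
next
  case (plt_const d g m)
  show ?case
    by (rule plt_mono, rule plt_cong[OF plt_smult[OF plt_const.prems plt_const.hyps(1)]])
       (use plt_const in \<open>auto simp: m_comm plt_closed\<close>)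
next
  case (plt_add m g g' h)
  have c: "f x \<in> carrier K" "g x \<in> carrier K" "g' x \<in> carrier K" if "x \<in> pts I" for x
    using plt_closed[OF plt_add.prems that] plt_closed[OF plt_add.hyps(1) that]
      plt_closed[OF plt_add.hyps(2) that] .
  show ?case
    by (rule plt.plt_add[OF plt_add.IH]) (use plt_add c in \<open>auto simp: r_distr\<close>)
next
  case (plt_var_mult m g i h)
  have c: "f x \<in> carrier K" "g x \<in> carrier K" "x i \<in> carrier K" if "x \<in> pts I" for x
    using plt_closed[OF plt_var_mult.prems that] plt_closed[OF plt_var_mult.hyps(1) that]
      pts_mem[OF that plt_var_mult.hyps(2)] .
  show ?case
  proof (cases m)
    case 0
    hence "g x = \<zero>" if "x \<in> pts I" for x using plt_0D[of I g x] plt_var_mult.hyps(1) that by simp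
    thus ?thesis using plt_var_mult.hyps c by (auto intro!: plt.plt_zero)
  next
    case (Suc m')
    have "plt I (Suc (n + (m - 1))) (\<lambda>x. f x \<otimes> h x)"
      by (rule plt.plt_var_mult[OF plt_var_mult.IH[OF plt_var_mult.prems] plt_var_mult.hyps(2)])
         (use plt_var_mult c in \<open>auto simp: m_lcomm\<close>)
    thus ?thesis using Suc by simp
  qed
qed

lemma plt_prod2:
  assumes "plt I (Suc n) f" "plt I (Suc m) g" shows "plt I (Suc (n + m)) (\<lambda>x. f x \<otimes> g x)"
  using plt_mult[OF assms(2,1)] by simp

lemma plt_sum:
  assumes "finite A" "\<And>a. a \<in> A \<Longrightarrow> plt I n (f a)" shows "plt I n (\<lambda>x. \<Oplus>a\<in>A. f a x)"
  using assms
proof (induction A rule: finite_induct)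
  case empty show ?case by (rule plt_zero) simp
next
  case (insert a A)
  have "plt I n (f a)" "plt I n (\<lambda>x. \<Oplus>a\<in>A. f a x)" using insert by auto
  thus ?case
    by (rule plt.plt_add, subst finsum_insert) (use insert in \<open>auto dest: plt_closed\<close>)
qed

lemma plt_pow:
  assumes "plt I (Suc n) f" shows "plt I (Suc (k * n)) (\<lambda>x. f x [^] k)"
proof (induction k)
  case 0 show ?case by (rule plt_const[of \<one>]) auto
next
  case (Suc k)
  show ?case using plt_prod2[OF Suc assms] by (simp add: add.commute)
qed

lemma plt_prod:
  assumes "finite A" "\<And>a. a \<in> A \<Longrightarrow> plt I (Suc (n a)) (f a)"
  shows "plt I (Suc (\<Sum>a\<in>A. n a)) (\<lambda>x. \<Otimes>a\<in>A. f a x)"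
  using assms
proof (induction A rule: finite_induct)
  case empty show ?case by (rule plt_const[of \<one>]) auto
next
  case (insert a A)
  have a: "plt I (Suc (n a)) (f a)" and A: "plt I (Suc (\<Sum>a\<in>A. n a)) (\<lambda>x. \<Otimes>a\<in>A. f a x)"
    using insert by auto
  have s: "(\<Sum>a\<in>insert a A. n a) = n a + (\<Sum>a\<in>A. n a)" using insert by simp
  show ?case unfolding s
  proof (rule plt_cong[OF plt_prod2[OF a A]])
    fix x assume "x \<in> pts I"
    thus "(\<Otimes>a\<in>insert a A. f a x) = f a x \<otimes> (\<Otimes>a\<in>A. f a x)"
      using insert by (intro finprod_insert) (auto dest: plt_closed)
  qed
qed

lemma plt_var: "i \<in> I \<Longrightarrow> plt I 2 (\<lambda>x. x i)"
  unfolding numeral_2_eq_2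
  by (rule plt_var_mult[OF plt_const[of \<one> I "\<lambda>_. \<one>" 0]]) (auto dest: pts_mem)

lemma plt_comp:
  assumes "plt I n f" "\<And>x. x \<in> pts J \<Longrightarrow> \<phi> x \<in> pts I" "\<And>i. i \<in> I \<Longrightarrow> plt J 2 (\<lambda>x. \<phi> x i)"
  shows "plt J n (\<lambda>x. f (\<phi> x))"
  using assms(1)
proof (induction rule: plt.induct)
  case (plt_zero f n) thus ?case using assms(2) by (auto intro!: plt.plt_zero)
next
  case (plt_const c f n) thus ?case using assms(2) by (auto intro!: plt.plt_const[of c])
next
  case (plt_add n f g h) thus ?case using assms(2) by (auto intro: plt.plt_add[OF plt_add.IH])
next
  case (plt_var_mult n f i h)
  show ?case
  proof (cases n)
    case 0
    hence "f (\<phi> x) = \<zero>" if "x \<in> pts J" for x using plt_0D[of I f "\<phi> x"] plt_var_mult.hyps(1) assms(2)[OF that] by simp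
    moreover have "\<phi> x i \<in> carrier K" if "x \<in> pts J" for x
      using pts_mem[OF assms(2)[OF that] plt_var_mult.hyps(2)] .
    ultimately show ?thesis using plt_var_mult.hyps(3) assms(2) by (auto intro!: plt.plt_zero)
  next
    case (Suc n')
    show ?thesis
      using plt_mult[OF plt_var_mult.IH assms(3)[OF plt_var_mult.hyps(2)]] Suc
      by (auto intro: plt_cong simp: plt_var_mult.hyps(3) assms(2))
  qed
qed

lemma mono_closed: "x \<in> pts I \<Longrightarrow> mono I b x \<in> carrier K"
  unfolding mono_def by (auto intro!: finprod_closed simp: PiE_mem)

lemma mono_upd:
  assumes "finite I" "i \<notin> I" "y \<in> pts I" "c \<in> carrier K"
  shows "mono (insert i I) b (y(i := c)) = c [^] b i \<otimes> mono I b y"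
proof -
  have y: "y j \<in> carrier K" if "j \<in> I" for j using pts_mem[OF assms(3) that] .
  have "(\<Otimes>j\<in>I. (y(i := c)) j [^] b j) = (\<Otimes>j\<in>I. y j [^] b j)"
    by (rule finprod_cong') (use assms y in auto)
  thus ?thesis unfolding mono_def using assms y
    by (subst finprod_insert) auto
qed

lemma mono_Suc:
  assumes "finite I" "i \<in> I" "x \<in> pts I"
  shows "mono I (b(i := Suc (b i))) x = x i \<otimes> mono I b x"
proof -
  have e: "I = insert i (I - {i})" using assms by auto
  have x: "x j \<in> carrier K" if "j \<in> I" for j using pts_mem[OF assms(3) that] .
  have "(\<Otimes>j\<in>I-{i}. x j [^] (b(i := Suc (b i))) j) = (\<Otimes>j\<in>I-{i}. x j [^] b j)"
    by (rule finprod_cong') (use x in auto)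
  moreover have "mono I b' x = x i [^] b' i \<otimes> (\<Otimes>j\<in>I-{i}. x j [^] b' j)" for b'
    unfolding mono_def by (subst e, subst finprod_insert) (use assms x in auto)
  moreover have "(\<Otimes>j\<in>I-{i}. x j [^] b j) \<in> carrier K"
    by (rule finprod_closed) (use assms x in auto)
  ultimately show ?thesis using assms pts_mem[OF assms(3,2)] by (simp add: m_ac)
qed

lemma plt_mono_fun: "finite I \<Longrightarrow> plt I (Suc (sum b I)) (mono I b)"
  unfolding mono_def
  by (rule plt_prod) (use plt_pow[OF plt_var[unfolded numeral_2_eq_2]] in auto)

lemma sum_mono_zero:
  assumes "finite I" "sum b I < card I * (q - 1)"
  shows "(\<Oplus>x\<in>pts I. mono I b x) = \<zero>"
proof -
  obtain i where i: "i \<in> I" "b i < q - 1"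
  proof -
    have nall: "\<not> (\<forall>i\<in>I. q - 1 \<le> b i)"
    proof
      assume "\<forall>i\<in>I. q - 1 \<le> b i"
      hence "card I * (q - 1) \<le> sum b I" using sum_bounded_below[of I "q - 1" b] by auto
      thus False using assms by simp
    qed
    then obtain i where "i \<in> I" "\<not> q - 1 \<le> b i" by blast
    thus ?thesis using that[of i] by simp
  qed
  have e: "I = insert i (I - {i})" using i by auto
  have "(\<Oplus>x\<in>pts I. mono I b x) = (\<Oplus>x\<in>pts (insert i (I - {i})). mono (insert i (I - {i})) b x)"
    using e by simp
  also have "\<dots> = (\<Oplus>c\<in>carrier K. \<Oplus>y\<in>pts (I - {i}). mono (insert i (I - {i})) b (y(i := c)))"
    by (rule sum_pts_insert) (use assms in \<open>auto intro: mono_closed simp del: insert_Diff_single\<close>)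
  also have "\<dots> = (\<Oplus>c\<in>carrier K. \<Oplus>y\<in>pts (I - {i}). c [^] b i \<otimes> mono (I - {i}) b y)"
    by (intro finsum_cong' mono_upd) (use assms in \<open>auto intro!: finsum_closed mono_closed simp: mono_upd simp del: insert_Diff_single\<close>)
  also have "\<dots> = (\<Oplus>c\<in>carrier K. c [^] b i \<otimes> (\<Oplus>y\<in>pts (I - {i}). mono (I - {i}) b y))"
    by (intro finsum_cong' finsum_rdistr[symmetric])
       (use assms in \<open>auto intro!: finsum_closed mono_closed finite_pts\<close>)
  also have "\<dots> = (\<Oplus>c\<in>carrier K. c [^] b i) \<otimes> (\<Oplus>y\<in>pts (I - {i}). mono (I - {i}) b y)"
    by (rule finsum_ldistr[symmetric]) (auto intro!: finsum_closed mono_closed simp: finite_carrier)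
  also have "\<dots> = \<zero>" using sum_pow_small[OF i(2)] by (simp add: l_null finsum_closed mono_closed)
  finally show ?thesis .
qed

text \<open>
  Multiplication by a variable moves one unit of degree from \<open>f\<close> to the exponent \<open>b\<close>, so everything reduces to
  sums of monomials of degree less than \<open>|I| (q - 1)\<close>; these have an exponent below
  \<open>q - 1\<close> in some variable.
\<close>

lemma moment_plt_zero:
  assumes "finite I" "plt I n f" "sum b I + n \<le> card I * (q - 1)"
  shows "moment I b f = \<zero>"
  using assms(2,3)
proof (induction arbitrary: b rule: plt.induct)
  case (plt_zero f n)
  have "moment I b f = (\<Oplus>x\<in>pts I. \<zero>)" unfolding moment_def
    by (rule finsum_cong') (auto simp: plt_zero mono_closed)
  thus ?case by simp
next
  case (plt_const c f n)
  have "moment I b f = (\<Oplus>x\<in>pts I. c \<otimes> mono I b x)" unfolding moment_def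
    by (rule finsum_cong') (auto simp: plt_const mono_closed)
  also have "\<dots> = c \<otimes> (\<Oplus>x\<in>pts I. mono I b x)"
    by (rule finsum_rdistr[symmetric]) (auto simp: plt_const mono_closed finite_pts assms(1))
  finally show ?case using sum_mono_zero[OF assms(1), of b] plt_const by simp
next
  case (plt_add n f g h)
  have "moment I b h = (\<Oplus>x\<in>pts I. f x \<otimes> mono I b x \<oplus> g x \<otimes> mono I b x)" unfolding moment_def
    by (rule finsum_cong') (use plt_add.hyps in \<open>auto simp: l_distr mono_closed plt_closed\<close>)
  also have "\<dots> = moment I b f \<oplus> moment I b g" unfolding moment_def
    by (rule finsum_addf) (use plt_add.hyps in \<open>auto simp: mono_closed plt_closed\<close>)
  finally show ?case using plt_add by simp
next
  case (plt_var_mult n f i h)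
  have c: "f x \<in> carrier K" "x i \<in> carrier K" "mono I b x \<in> carrier K" if "x \<in> pts I" for x
    using plt_closed[OF plt_var_mult.hyps(1) that] pts_mem[OF that plt_var_mult.hyps(2)] mono_closed[OF that] .
  have "moment I b h = moment I (b(i := Suc (b i))) f" unfolding moment_def
    by (rule finsum_cong')
      (use plt_var_mult.hyps assms(1) c in \<open>auto simp: mono_Suc m_ac\<close>)
  also have "sum (b(i := Suc (b i))) I = Suc (sum b I)"
  proof -
    have e: "I = insert i (I - {i})" using plt_var_mult by auto
    show ?thesis by (subst (1 2) e) (use assms(1) in \<open>simp add: sum.insert_remove\<close>)
  qed
  hence "moment I (b(i := Suc (b i))) f = \<zero>" using plt_var_mult by (intro plt_var_mult.IH) auto
  finally show ?case .
qed

lemma geometric_sum: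
  fixes n :: nat assumes "x \<in> carrier K" "c \<in> carrier K"
  shows "(x \<ominus> c) \<otimes> (\<Oplus>j\<in>{..<n}. x [^] j \<otimes> c [^] (n - 1 - j)) = x [^] n \<ominus> c [^] n"
proof (induction n)
  case 0 show ?case using assms by (simp add: minus_eq r_neg)
next
  case (Suc n)
  let ?S = "\<lambda>n::nat. \<Oplus>j\<in>{..<n}. x [^] j \<otimes> c [^] (n - 1 - j)"
  have cl: "?S n \<in> carrier K" for n using assms by (auto intro!: finsum_closed)
  have "?S (Suc n) = x [^] n \<oplus> (\<Oplus>j\<in>{..<n}. x [^] j \<otimes> c [^] (n - j))"
    using assms by (simp add: lessThan_Suc finsum_insert Pi_def)
  also have "(\<Oplus>j\<in>{..<n}. x [^] j \<otimes> c [^] (n - j)) = (\<Oplus>j\<in>{..<n}. c \<otimes> (x [^] j \<otimes> c [^] (n - 1 - j)))"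
  proof (rule finsum_cong')
    fix j assume j: "j \<in> {..<n}"
    have "c [^] (n - j) = c [^] Suc (n - 1 - j)" using j by (simp add: Suc_diff_Suc)
    thus "x [^] j \<otimes> c [^] (n - j) = c \<otimes> (x [^] j \<otimes> c [^] (n - 1 - j))"
      using assms by (simp add: m_ac)
  qed (use assms in auto)
  also have "\<dots> = c \<otimes> ?S n" by (rule finsum_rdistr[symmetric]) (use assms in auto)
  finally have S: "?S (Suc n) = x [^] n \<oplus> c \<otimes> ?S n" .
  have "(x \<ominus> c) \<otimes> ?S (Suc n) = (x \<ominus> c) \<otimes> x [^] n \<oplus> c \<otimes> ((x \<ominus> c) \<otimes> ?S n)"
    unfolding S using assms cl by (simp add: r_distr m_ac)
  also have "\<dots> = (x \<ominus> c) \<otimes> x [^] n \<oplus> c \<otimes> (x [^] n \<ominus> c [^] n)" using Suc by simp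
  also have "\<dots> = x [^] Suc n \<ominus> c [^] Suc n"
  proof -
    define a b where "a = x [^] n" and "b = c [^] n"
    have ab: "a \<in> carrier K" "b \<in> carrier K" using assms by (auto simp: a_def b_def)
    have "(x \<ominus> c) \<otimes> a \<oplus> c \<otimes> (a \<ominus> b) = a \<otimes> x \<ominus> b \<otimes> c" using assms ab by algebra
    thus ?thesis by (simp add: a_def b_def)
  qed
  finally show ?case .
qed

text \<open>
  The coefficient of \<open>x\<^sup>j\<close> in \<open>1 - (x - c)\<^bsup>q - 1\<^esup>\<close>, the polynomial which is \<open>1\<close> at \<open>x = c\<close> and \<open>0\<close> at all
  other elements of the field.
\<close>

definition delta_coeff :: "nat \<Rightarrow> 'a \<Rightarrow> 'a" where
  "delta_coeff j c = (if j = 0 then \<one> \<ominus> c [^] (q - 1) else \<ominus> (c [^] (q - 1 - j)))"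

lemma delta_coeff_closed: "c \<in> carrier K \<Longrightarrow> delta_coeff j c \<in> carrier K" by (simp add: delta_coeff_def)

text \<open>
  For \<open>x \<noteq> c\<close>, the product of \<open>x - c\<close> and \<open>\<Sum>\<^sub>j x\<^sup>j c\<^bsup>q - 1 - j\<^esup>\<close> is \<open>x\<^sup>q - c\<^sup>q = x - c\<close>, so that the sum is \<open>1\<close>; for
  \<open>x = c\<close> all \<open>q\<close> terms are equal and the sum is \<open>0\<close>.
\<close>

lemma sum_delta_coeff:
  assumes x: "x \<in> carrier K" and c: "c \<in> carrier K"
  shows "(\<Oplus>j\<in>{..<q}. x [^] j \<otimes> delta_coeff j c) = (if x = c then \<one> else \<zero>)"
proof -
  let ?S = "\<Oplus>j\<in>{..<q}. x [^] j \<otimes> c [^] (q - 1 - j)"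
  have S: "?S \<in> carrier K" using assms by (auto intro!: finsum_closed)
  have q: "{..<q} = insert 0 {1..<q}" using q_ge_2 by auto
  have "(\<Oplus>j\<in>{..<q}. x [^] j \<otimes> delta_coeff j c) = \<one> \<ominus> ?S"
  proof -
    have a: "(\<Oplus>j\<in>{1..<q}. x [^] j \<otimes> delta_coeff j c) = (\<Oplus>j\<in>{1..<q}. (\<ominus> \<one>) \<otimes> (x [^] j \<otimes> c [^] (q - 1 - j)))"
      by (rule finsum_cong') (use assms in \<open>auto simp: delta_coeff_def l_minus r_minus\<close>)
    also have "\<dots> = (\<ominus> \<one>) \<otimes> (\<Oplus>j\<in>{1..<q}. x [^] j \<otimes> c [^] (q - 1 - j))"
      by (rule finsum_rdistr[symmetric]) (use assms in auto)
    finally have 1: "(\<Oplus>j\<in>{1..<q}. x [^] j \<otimes> delta_coeff j c) = (\<ominus> \<one>) \<otimes> (\<Oplus>j\<in>{1..<q}. x [^] j \<otimes> c [^] (q - 1 - j))" .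
    define T where "T = (\<Oplus>j\<in>{1..<q}. x [^] j \<otimes> c [^] (q - 1 - j))"
    define d where "d = c [^] (q - 1)"
    have T: "T \<in> carrier K" unfolding T_def using assms by (auto intro!: finsum_closed)
    have d: "d \<in> carrier K" unfolding d_def using assms by auto
    have "(\<Oplus>j\<in>{..<q}. x [^] j \<otimes> delta_coeff j c) = delta_coeff 0 c \<oplus> (\<ominus> \<one>) \<otimes> T"
      unfolding q T_def using 1 assms by (subst finsum_insert) (auto simp: delta_coeff_closed)
    moreover have "?S = d \<oplus> T"
      unfolding q T_def d_def using assms by (subst finsum_insert) auto
    moreover have "delta_coeff 0 c = \<one> \<ominus> d" by (simp add: delta_coeff_def d_def)
    moreover have "(\<one> \<ominus> d) \<oplus> (\<ominus> \<one>) \<otimes> T = \<one> \<ominus> (d \<oplus> T)" using T d by algebra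
    ultimately show ?thesis by simp
  qed
  also have "\<dots> = (if x = c then \<one> else \<zero>)"
  proof (cases "x = c")
    case True
    have "?S = (\<Oplus>j\<in>{..<q}. c [^] (q - 1))"
      by (rule finsum_cong') (use assms True in \<open>auto simp: nat_pow_mult\<close>)
    also have "\<dots> = [q] \<cdot> (c [^] (q - 1))" using assms by (subst add.finprod_const) auto
    also have "\<dots> = (\<Oplus>x\<in>carrier K. c [^] (q - 1))" using assms by (subst add.finprod_const) (auto simp: finite_carrier)
    also have "\<dots> = \<zero>" using assms by (simp add: finsum_const_card)
    finally show ?thesis using True by (simp add: minus_eq)
  next
    case False
    have "(x \<ominus> c) \<otimes> ?S = x \<ominus> c" using geometric_sum[OF x c, of q] by (simp add: pow_q x c)
    hence "(x \<ominus> c) \<otimes> (\<one> \<ominus> ?S) = \<zero>" using x c S by (simp add: minus_eq r_distr r_minus r_neg)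
    moreover have "x \<ominus> c \<noteq> \<zero>" using False x c by simp
    ultimately have "\<one> \<ominus> ?S = \<zero>" using integral[of "x \<ominus> c" "\<one> \<ominus> ?S"] x c S by auto
    thus ?thesis using False by simp
  qed
  finally show ?thesis .
qed

lemma univariate_expansion:
  assumes "\<And>c. c \<in> carrier K \<Longrightarrow> h c \<in> carrier K" "x \<in> carrier K"
  shows "h x = (\<Oplus>j\<in>{..<q}. x [^] j \<otimes> (\<Oplus>c\<in>carrier K. delta_coeff j c \<otimes> h c))"
proof -
  have "(\<Oplus>j\<in>{..<q}. x [^] j \<otimes> (\<Oplus>c\<in>carrier K. delta_coeff j c \<otimes> h c))
      = (\<Oplus>j\<in>{..<q}. \<Oplus>c\<in>carrier K. x [^] j \<otimes> (delta_coeff j c \<otimes> h c))"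
    by (intro finsum_cong' finsum_rdistr) (use assms in \<open>auto intro!: finsum_closed simp: delta_coeff_closed finite_carrier\<close>)
  also have "\<dots> = (\<Oplus>c\<in>carrier K. \<Oplus>j\<in>{..<q}. x [^] j \<otimes> (delta_coeff j c \<otimes> h c))"
    by (rule finsum_swap) (use assms in \<open>auto simp: delta_coeff_closed finite_carrier\<close>)
  also have "\<dots> = (\<Oplus>c\<in>carrier K. if x = c then h c else \<zero>)"
  proof (rule finsum_cong')
    fix c assume c: "c \<in> carrier K"
    have "(\<Oplus>j\<in>{..<q}. x [^] j \<otimes> (delta_coeff j c \<otimes> h c)) = (\<Oplus>j\<in>{..<q}. (x [^] j \<otimes> delta_coeff j c) \<otimes> h c)"
      by (rule finsum_cong') (use assms c in \<open>auto simp: delta_coeff_closed m_assoc\<close>)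
    also have "\<dots> = (\<Oplus>j\<in>{..<q}. x [^] j \<otimes> delta_coeff j c) \<otimes> h c"
      by (rule finsum_ldistr[symmetric]) (use assms c in \<open>auto simp: delta_coeff_closed\<close>)
    also have "\<dots> = (if x = c then h c else \<zero>)" using assms c by (simp add: sum_delta_coeff)
    finally show "(\<Oplus>j\<in>{..<q}. x [^] j \<otimes> (delta_coeff j c \<otimes> h c)) = (if x = c then h c else \<zero>)" .
  qed (use assms in auto)
  also have "\<dots> = h x" using finsum_singleton[of x "carrier K" h] assms finite_carrier by (auto simp: Pi_def)
  finally show ?thesis by simp
qed

lemma moment_closed:
  assumes "\<And>x. x \<in> pts I \<Longrightarrow> f x \<in> carrier K" shows "moment I b f \<in> carrier K"
  unfolding moment_def using assms by (auto intro!: finsum_closed mono_closed)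

lemma moment_insert:
  assumes "finite I" "i \<notin> I" "\<And>x. x \<in> pts (insert i I) \<Longrightarrow> f x \<in> carrier K"
  shows "moment (insert i I) b f = (\<Oplus>c\<in>carrier K. c [^] b i \<otimes> moment I b (\<lambda>y. f (y(i := c))))"
proof -
  have f: "f (y(i := c)) \<in> carrier K" if "c \<in> carrier K" "y \<in> pts I" for c y
    using that assms(3) by (auto simp: PiE_insert_eq)
  have "moment (insert i I) b f = (\<Oplus>c\<in>carrier K. \<Oplus>y\<in>pts I. f (y(i := c)) \<otimes> mono (insert i I) b (y(i := c)))"
    unfolding moment_def by (rule sum_pts_insert) (use assms in \<open>auto intro: m_closed mono_closed\<close>)
  also have "\<dots> = (\<Oplus>c\<in>carrier K. c [^] b i \<otimes> moment I b (\<lambda>y. f (y(i := c))))"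
  proof (rule finsum_cong')
    fix c assume c: "c \<in> carrier K"
    have "(\<Oplus>y\<in>pts I. f (y(i := c)) \<otimes> mono (insert i I) b (y(i := c)))
        = (\<Oplus>y\<in>pts I. c [^] b i \<otimes> (f (y(i := c)) \<otimes> mono I b y))"
      by (rule finsum_cong') (use c f assms in \<open>auto simp: mono_upd m_lcomm mono_closed\<close>)
    also have "\<dots> = c [^] b i \<otimes> moment I b (\<lambda>y. f (y(i := c)))"
      unfolding moment_def
      by (rule finsum_rdistr[symmetric]) (use c f assms finite_pts in \<open>auto simp: mono_closed\<close>)
    finally show "(\<Oplus>y\<in>pts I. f (y(i := c)) \<otimes> mono (insert i I) b (y(i := c)))
        = c [^] b i \<otimes> moment I b (\<lambda>y. f (y(i := c)))" .
  qed (use f in \<open>auto intro!: m_closed moment_closed\<close>)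
  finally show ?thesis .
qed

lemma moment_cong:
  assumes "\<And>x. x \<in> pts I \<Longrightarrow> f x \<in> carrier K" "\<And>i. i \<in> I \<Longrightarrow> b i = b' i"
  shows "moment I b f = moment I b' f"
proof -
  have "mono I b x = mono I b' x" if "x \<in> pts I" for x
    unfolding mono_def by (rule finprod_cong') (use assms(2) pts_mem[OF that] in auto)
  thus ?thesis unfolding moment_def
    by (intro finsum_cong') (use assms in \<open>auto intro: mono_closed\<close>)
qed

text \<open>
  The converse of \<open>moment_plt_zero\<close>, by induction on the number of variables. Expanding \<open>f\<close> as a
  polynomial \<open>\<Sum>\<^sub>j x\<^sub>i\<^sup>j F\<^sub>j\<close> of degree less than \<open>q\<close> in one variable \<open>x\<^sub>i\<close>, the moments of \<open>F\<^sub>j\<close> are moments of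
  \<open>f\<close> with exponent \<open>q - 1 - j\<close> at \<open>x\<^sub>i\<close> (and, for \<open>j = 0\<close>, also \<open>0\<close>). Hence \<open>F\<^sub>j\<close> satisfies the hypothesis
  with \<open>n - j\<close> in place of \<open>n\<close>.
\<close>

lemma plt_of_moments:
  assumes "finite I" "\<And>x. x \<in> pts I \<Longrightarrow> f x \<in> carrier K"
    and "\<And>b. sum b I + n \<le> card I * (q - 1) \<Longrightarrow> moment I b f = \<zero>"
  shows "plt I n f"
  using assms
proof (induction I arbitrary: n f rule: finite_induct)
  case empty
  have pts: "x \<in> pts ({} :: 'b set) \<longleftrightarrow> x = (\<lambda>_. undefined)" for x by auto
  show ?case
  proof (cases n)
    case 0
    have "moment {} (\<lambda>_. 0) f = \<zero>" using empty.prems(2) 0 by simp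
    hence "f (\<lambda>_. undefined) = \<zero>" using empty.prems(1)[of "\<lambda>_. undefined"]
      by (simp add: moment_def mono_def)
    thus ?thesis by (intro plt_zero) (simp add: pts)
  next
    case (Suc n')
    thus ?thesis using empty.prems(1) by (auto intro!: plt_const[of "f (\<lambda>_. undefined)"])
  qed
next
  case (insert i I)
  have f: "f (y(i := c)) \<in> carrier K" if "c \<in> carrier K" "y \<in> pts I" for c y
    using that insert.prems(1) by (auto simp: PiE_insert_eq)
  define F where "F j y = (\<Oplus>c\<in>carrier K. delta_coeff j c \<otimes> f (y(i := c)))" for j y
  have Fcl: "F j y \<in> carrier K" if "y \<in> pts I" for j y
    unfolding F_def using f that by (auto intro!: finsum_closed simp: delta_coeff_closed)
  define S where "S b = moment (insert i I) b f" for b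
  have S: "S b = (\<Oplus>c\<in>carrier K. c [^] b i \<otimes> moment I b (\<lambda>y. f (y(i := c))))" for b
    unfolding S_def by (rule moment_insert) (use insert in auto)
  have mcl: "moment I b (\<lambda>y. f (y(i := c))) \<in> carrier K" if "c \<in> carrier K" for b c
    using f that by (intro moment_closed)
  have upd: "moment I (b(i := k)) (\<lambda>y. f (y(i := c))) = moment I b (\<lambda>y. f (y(i := c)))"
    if "c \<in> carrier K" for b k c
    by (rule moment_cong) (use f that insert in auto)
  have S': "S (b(i := k)) = (\<Oplus>c\<in>carrier K. c [^] k \<otimes> moment I b (\<lambda>y. f (y(i := c))))" for b k
    unfolding S by (rule finsum_cong') (use upd mcl in \<open>auto simp del: fun_upd_apply simp add: fun_upd_same\<close>)
  have Scl: "S b \<in> carrier K" for b unfolding S using mcl by (auto intro!: finsum_closed)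
  have sumI: "sum (b(i := k)) (insert i I) = k + sum b I" for b k
  proof -
    have "sum (b(i := k)) I = sum b I" by (rule sum.cong) (use insert.hyps in auto)
    thus ?thesis using insert.hyps by simp
  qed
  have momF: "moment I b (F j) = (\<Oplus>c\<in>carrier K. delta_coeff j c \<otimes> moment I b (\<lambda>y. f (y(i := c))))" for b j
  proof -
    have "moment I b (F j) = (\<Oplus>y\<in>pts I. \<Oplus>c\<in>carrier K. delta_coeff j c \<otimes> (f (y(i := c)) \<otimes> mono I b y))"
      unfolding moment_def
    proof (rule finsum_cong')
      fix y assume y: "y \<in> pts I"
      have "F j y \<otimes> mono I b y = (\<Oplus>c\<in>carrier K. (delta_coeff j c \<otimes> f (y(i := c))) \<otimes> mono I b y)"
        unfolding F_def by (rule finsum_ldistr) (use f y in \<open>auto simp: finite_carrier delta_coeff_closed mono_closed\<close>)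
      also have "\<dots> = (\<Oplus>c\<in>carrier K. delta_coeff j c \<otimes> (f (y(i := c)) \<otimes> mono I b y))"
        by (rule finsum_cong') (use f y in \<open>auto simp: delta_coeff_closed mono_closed m_assoc\<close>)
      finally show "F j y \<otimes> mono I b y = (\<Oplus>c\<in>carrier K. delta_coeff j c \<otimes> (f (y(i := c)) \<otimes> mono I b y))" .
    qed (use f in \<open>auto intro!: finsum_closed simp: delta_coeff_closed mono_closed\<close>)
    also have "\<dots> = (\<Oplus>c\<in>carrier K. \<Oplus>y\<in>pts I. delta_coeff j c \<otimes> (f (y(i := c)) \<otimes> mono I b y))"
      by (rule finsum_swap) (use f insert.hyps finite_pts in \<open>auto simp: delta_coeff_closed mono_closed finite_carrier\<close>)
    also have "\<dots> = (\<Oplus>c\<in>carrier K. delta_coeff j c \<otimes> moment I b (\<lambda>y. f (y(i := c))))"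
      unfolding moment_def
      by (intro finsum_cong' finsum_rdistr[symmetric])
         (use f insert.hyps finite_pts in \<open>auto intro!: finsum_closed simp: delta_coeff_closed mono_closed\<close>)
    finally show ?thesis .
  qed
  have momF0: "moment I b (F 0) = S (b(i := 0)) \<ominus> S (b(i := q - 1))" for b
  proof -
    have "moment I b (F 0) \<oplus> S (b(i := q - 1)) = (\<Oplus>c\<in>carrier K. delta_coeff 0 c \<otimes> moment I b (\<lambda>y. f (y(i := c)))
        \<oplus> c [^] (q - 1) \<otimes> moment I b (\<lambda>y. f (y(i := c))))"
      unfolding momF S' by (rule finsum_addf[symmetric]) (use mcl in \<open>auto simp: delta_coeff_closed\<close>)
    also have "\<dots> = S (b(i := 0))" unfolding S'
    proof (rule finsum_cong')
      fix c assume c: "c \<in> carrier K"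
      have "(\<one> \<ominus> u) \<otimes> v \<oplus> u \<otimes> v = v" if "u \<in> carrier K" "v \<in> carrier K" for u v
        using that by algebra
      thus "delta_coeff 0 c \<otimes> moment I b (\<lambda>y. f (y(i := c))) \<oplus> c [^] (q - 1) \<otimes> moment I b (\<lambda>y. f (y(i := c)))
          = c [^] (0::nat) \<otimes> moment I b (\<lambda>y. f (y(i := c)))"
        using mcl c by (simp add: delta_coeff_def)
    qed (use mcl in auto)
    finally have e: "moment I b (F 0) \<oplus> S (b(i := q - 1)) = S (b(i := 0))" .
    have "moment I b (F 0) \<in> carrier K" using Fcl by (intro moment_closed)
    thus ?thesis unfolding e[symmetric] using Scl by (simp add: minus_eq a_assoc r_neg)
  qed
  have momFj: "moment I b (F j) = \<ominus> S (b(i := q - 1 - j))" if "j \<noteq> 0" for b j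
  proof -
    have "moment I b (F j) = (\<Oplus>c\<in>carrier K. (\<ominus> \<one>) \<otimes> (c [^] (q - 1 - j) \<otimes> moment I b (\<lambda>y. f (y(i := c)))))"
      unfolding momF by (rule finsum_cong') (use mcl that in \<open>auto simp: delta_coeff_def l_minus\<close>)
    also have "\<dots> = (\<ominus> \<one>) \<otimes> S (b(i := q - 1 - j))"
      unfolding S' by (rule finsum_rdistr[symmetric]) (use mcl finite_carrier in auto)
    finally show ?thesis using Scl by (simp add: l_minus)
  qed
  have cardI: "card (insert i I) * (q - 1) = card I * (q - 1) + (q - 1)" using insert.hyps by simp
  have Szero: "S (b(i := k)) = \<zero>" if "k + sum b I + n \<le> card I * (q - 1) + (q - 1)" for b k
    unfolding S_def by (rule insert.prems(2)) (use that in \<open>simp only: sumI cardI\<close>)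
  have pF: "plt I (n - j) (F j)" if "j < q" for j
  proof (rule insert.IH)
    fix b assume b: "sum b I + (n - j) \<le> card I * (q - 1)"
    have *: "S (b(i := q - 1 - j)) = \<zero>" by (rule Szero) (use b that in linarith)
    show "moment I b (F j) = \<zero>"
    proof (cases "j = 0")
      case True
      have "S (b(i := 0)) = \<zero>" by (rule Szero) (use b True in linarith)
      thus ?thesis using * True momF0 by (simp add: minus_eq)
    next
      case False thus ?thesis using * momFj by simp
    qed
  qed (rule Fcl)
  define G where "G j x = F j (restrict x I)" for j x
  have res: "restrict x I \<in> pts I" if "x \<in> pts (insert i I)" for x using that by auto
  have pG: "plt (insert i I) (n - j) (G j)" if "j < q" for j
    unfolding G_def by (rule plt_comp[OF pF[OF that]]) (auto simp: plt_var)
  have summand: "plt (insert i I) n (\<lambda>x. x i [^] j \<otimes> G j x)" if "j < q" for j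
  proof (cases "j < n")
    case True
    have "plt (insert i I) (Suc j) (\<lambda>x. x i [^] j)"
      using plt_pow[OF plt_var[of i "insert i I", unfolded numeral_2_eq_2], of j] by simp
    from plt_mult[OF pG[OF that] this] True show ?thesis by (auto intro: plt_mono)
  next
    case False
    have "F j (restrict x I) = \<zero>" if "x \<in> pts (insert i I)" for x
      using plt_0D[of I "F j"] pF[OF \<open>j < q\<close>] False res[OF that] by simp
    thus ?thesis by (intro plt_zero) (auto simp: G_def intro!: r_null nat_pow_closed)
  qed
  show ?case
  proof (rule plt_cong[OF plt_sum[of "{..<q}", OF _ summand]])
    fix x assume x: "x \<in> pts (insert i I)"
    have xi: "x i \<in> carrier K" using x by auto
    have "(restrict x I)(i := x i) = x" using x insert.hyps by (auto simp: fun_eq_iff PiE_def extensional_def)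
    hence "f x = f ((restrict x I)(i := x i))" by simp
    also have "\<dots> = (\<Oplus>j\<in>{..<q}. x i [^] j \<otimes> (\<Oplus>c\<in>carrier K. delta_coeff j c \<otimes> f ((restrict x I)(i := c))))"
      by (rule univariate_expansion[OF f xi]) (use res[OF x] in auto)
    finally show "f x = (\<Oplus>j\<in>{..<q}. x i [^] j \<otimes> G j x)" unfolding G_def F_def .
  qed auto
qed

end

section \<open>Binomial coefficients and the characteristic\<close>

lemma prime_power_dvd_choose:
  assumes "Factorial_Ring.prime (p :: nat)" "0 < i" "\<not> p ^ e dvd i"
  shows "p dvd (a * p ^ e) choose i"
proof (rule ccontr)
  assume "\<not> p dvd (a * p ^ e) choose i"
  hence c: "coprime (p ^ e) ((a * p ^ e) choose i)" using assms(1) by (simp add: prime_imp_coprime)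
  obtain j where j: "i = Suc j" using assms(2) by (cases i) auto
  show False
  proof (cases "a * p ^ e = 0")
    case True thus ?thesis using c assms by (cases "a = 0") (auto simp: j)
  next
    case False
    then obtain N where N: "a * p ^ e = Suc N" by (cases "a * p ^ e") auto
    have "i * ((a * p ^ e) choose i) = a * p ^ e * (N choose j)"
      unfolding N j using Suc_times_binomial_eq[of N j] by (simp only: mult.commute)
    hence "p ^ e dvd i * ((a * p ^ e) choose i)" by simp
    hence "p ^ e dvd i" using c by (simp add: coprime_dvd_mult_left_iff)
    thus False using assms by simp
  qed
qed

lemma not_dvd_choose_pred_prime_power:
  assumes "Factorial_Ring.prime (p :: nat)" "r < p ^ e"
  shows "\<not> p dvd (p ^ e - 1) choose r"
  using assms(2)
proof (induction r)
  case 0 show ?case using assms(1) by (simp add: prime_nat_iff)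
next
  case (Suc r)
  have "p dvd (1 * p ^ e) choose (Suc r)"
    by (rule prime_power_dvd_choose) (use assms Suc in \<open>auto dest: dvd_imp_le\<close>)
  moreover have "p ^ e choose Suc r = ((p ^ e - 1) choose r) + ((p ^ e - 1) choose Suc r)"
    using assms(1) by (cases "p ^ e") (auto simp: prime_nat_iff)
  ultimately have "p dvd ((p ^ e - 1) choose r) + ((p ^ e - 1) choose Suc r)" by simp
  thus ?case using Suc by (metis Suc_lessD dvd_add_left_iff)
qed

lemma choose_prime_power_cong:
  assumes "Factorial_Ring.prime (p :: nat)"
  shows "((a * p ^ e + m) choose p ^ e) mod p = (((a * p ^ e) choose p ^ e) + (m choose p ^ e)) mod p"
proof -
  let ?Q = "p ^ e"
  have Q: "?Q > 0" using assms by (simp add: prime_gt_0_nat)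
  have "((a * ?Q + m) choose ?Q) = (\<Sum>k\<le>?Q. ((a * ?Q) choose k) * (m choose (?Q - k)))"
    by (rule vandermonde[symmetric])
  also have "{..?Q} = insert 0 (insert ?Q {0<..<?Q})" using Q by auto
  also have "(\<Sum>k\<in>\<dots>. ((a * ?Q) choose k) * (m choose (?Q - k))) =
     ((a * ?Q) choose ?Q) + (m choose ?Q) + (\<Sum>k\<in>{0<..<?Q}. ((a * ?Q) choose k) * (m choose (?Q - k)))"
    using Q by simp
  finally have e: "((a * ?Q + m) choose ?Q) = ((a * ?Q) choose ?Q) + (m choose ?Q)
    + (\<Sum>k\<in>{0<..<?Q}. ((a * ?Q) choose k) * (m choose (?Q - k)))" .
  have "p dvd (\<Sum>k\<in>{0<..<?Q}. ((a * ?Q) choose k) * (m choose (?Q - k)))"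
    by (intro dvd_sum dvd_mult2 prime_power_dvd_choose assms) (auto dest: dvd_imp_le)
  thus ?thesis unfolding e by (auto elim!: dvdE)
qed

text \<open>
  With \<open>P = p\<^sup>e\<close>, the polynomials \<open>(1 + y)\<^bsup>a P\<^esup>\<close> and \<open>(1 + y\<^sup>P)\<^sup>a\<close> agree modulo \<open>p\<close>; the coefficient
  of \<open>y\<^sup>P\<close> in the second one is \<open>a\<close>.
\<close>

lemma choose_multiple_prime_power:
  assumes "Factorial_Ring.prime (p :: nat)" shows "((a * p ^ e) choose p ^ e) mod p = a mod p"
proof (induction a)
  case 0 show ?case using assms by (simp add: prime_gt_0_nat binomial_eq_0)
next
  case (Suc a)
  have "(Suc a * p ^ e choose p ^ e) mod p = ((a * p ^ e choose p ^ e) + 1) mod p"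
    using choose_prime_power_cong[OF assms, of a e "p ^ e"] by (simp add: add.commute)
  also have "\<dots> = Suc a mod p" using Suc by (metis mod_add_left_eq Suc_eq_plus1)
  finally show ?case .
qed

lemma not_dvd_choose_prime_power:
  assumes "Factorial_Ring.prime (p :: nat)" "0 < a" "a < p"
  shows "\<not> p dvd (a * p ^ e + (p ^ e - 1)) choose p ^ e"
proof -
  have "p ^ e > 0" using assms by simp
  hence "(p ^ e - 1) choose p ^ e = 0" by (simp add: binomial_eq_0)
  hence "((a * p ^ e + (p ^ e - 1)) choose p ^ e) mod p = a mod p"
    using choose_prime_power_cong[OF assms(1), of a e "p ^ e - 1"] choose_multiple_prime_power[OF assms(1), of a e]
    by (simp only: add_0_right)
  thus ?thesis using assms by (simp add: dvd_eq_mod_eq_0)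
qed

context galois_field begin

abbreviation p where "p \<equiv> ring_characteristic K"

lemma finite_add_group: "group (add_monoid K)" "finite (carrier (add_monoid K))"
  using add.is_group finite_carrier by auto

lemma add_pow_one_eq_0_iff: "[(k::nat)] \<cdot> \<one> = \<zero> \<longleftrightarrow> p dvd k"
  using group.pow_eq_id[OF finite_add_group(1), of \<one> k] by (simp add: ring_characteristic_def add_pow_def)

lemma add_pow_mult_one: "[(k::nat)] \<cdot> x = ([k] \<cdot> \<one>) \<otimes> x" if "x \<in> carrier K"
  using that add_pow_ldistr[of \<one> x k] by simp

lemma add_pow_eq_0D: "[(k::nat)] \<cdot> x = \<zero> \<Longrightarrow> \<not> p dvd k \<Longrightarrow> x \<in> carrier K \<Longrightarrow> x = \<zero>"
  using add_pow_mult_one[of x k] integral[of "[k] \<cdot> \<one>" x] by (auto simp: add_pow_one_eq_0_iff)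

lemma p_pos: "p > 0"
  using group.ord_ge_1[OF finite_add_group, of \<one>] by (simp add: ring_characteristic_def)

lemma prime_p: "Factorial_Ring.prime p"
proof (rule prime_natI)
  have "p \<noteq> 1" using add_pow_one_eq_0_iff[of 1] by auto
  thus "2 \<le> p" using p_pos by simp
next
  fix a b assume "p dvd a * b"
  hence "[(a * b)] \<cdot> \<one> = \<zero>" by (simp add: add_pow_one_eq_0_iff)
  moreover have "[(a * b)] \<cdot> \<one> = ([a] \<cdot> \<one>) \<otimes> ([b] \<cdot> \<one>)"
    using add_pow_mult_one[of "[b] \<cdot> \<one>" a] add.nat_pow_pow[of \<one> a b] by (simp add: mult.commute)
  ultimately have "[a] \<cdot> \<one> = \<zero> \<or> [b] \<cdot> \<one> = \<zero>" using integral by auto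
  thus "p dvd a \<or> p dvd b" by (simp add: add_pow_one_eq_0_iff)
qed

text \<open>
  Cauchy's theorem for the additive group: a subgroup of order \<open>r\<close> contains a non-zero \<open>x\<close> with \<open>r x = 0\<close>.
\<close>

lemma prime_dvd_q: assumes "Factorial_Ring.prime r" "r dvd q" shows "r = p"
proof -
  obtain m where m: "q = r ^ 1 * m" using assms by (auto elim: dvdE)
  obtain H where H: "subgroup H (add_monoid K)" "card H = r ^ 1"
    using sylow_thm[OF assms(1) finite_add_group(1) _ finite_add_group(2), of 1 m] m by (auto simp: order_def)
  have fH: "finite H" using H assms by (metis card_ge_0_finite power_one_right prime_gt_0_nat)
  have "\<not> H \<subseteq> {\<zero>}"
  proof
    assume "H \<subseteq> {\<zero>}"
    hence "card H \<le> card {\<zero>}" by (intro card_mono) auto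
    thus False using H assms prime_ge_2_nat[of r] by simp
  qed
  then obtain x where x: "x \<in> H" "x \<noteq> \<zero>" by auto
  have xK: "x \<in> carrier K" using subgroup.mem_carrier[OF H(1) x(1)] by simp
  interpret HG: group "add_monoid K\<lparr>carrier := H\<rparr>" by (rule subgroup.subgroup_is_group[OF H(1) finite_add_group(1)])
  have "x [^]\<^bsub>add_monoid K\<lparr>carrier := H\<rparr>\<^esub> r = \<one>\<^bsub>add_monoid K\<lparr>carrier := H\<rparr>\<^esub>"
    using HG.pow_order_eq_1[of x] x H fH by (simp add: order_def)
  moreover have "x [^]\<^bsub>add_monoid K\<lparr>carrier := H\<rparr>\<^esub> r = x [^]\<^bsub>add_monoid K\<^esub> r"
    by (simp add: nat_pow_def)
  ultimately have "[r] \<cdot> x = \<zero>" by (simp add: add_pow_def)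
  hence "p dvd r" using add_pow_eq_0D[of r x] x xK by auto
  thus ?thesis using assms prime_p by (metis primes_dvd_imp_eq)
qed

lemma q_prime_power: "\<exists>e. q = p ^ Suc e"
proof -
  obtain m where m: "q = p ^ multiplicity p q * m" "\<not> p dvd m"
    using multiplicity_decompose'[of q p] q_ge_2 prime_p by (metis not_numeral_le_zero not_prime_unit)
  have "m = 1"
  proof (rule ccontr)
    assume "m \<noteq> 1"
    then obtain r where "Factorial_Ring.prime r" "r dvd m" using prime_factor_nat by blast
    thus False using prime_dvd_q[of r] m by (metis dvd_mult)
  qed
  hence "q = p ^ multiplicity p q" using m by simp
  thus ?thesis using q_ge_2 by (cases "multiplicity p q") auto
qed

abbreviation Q where "Q \<equiv> q div p"

lemma Q_prime_power: "\<exists>e. Q = p ^ e"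
  using q_prime_power p_pos by (metis nonzero_mult_div_cancel_left power_Suc not_gr0)

lemma q_eq: "q = p * Q"
  using q_prime_power by (metis dvd_mult_div_cancel dvd_triv_left power_Suc)

lemma Q_pos: "Q > 0" using q_eq q_ge_2 by (cases "Q = 0") auto

lemma binomial_ring:
  fixes n :: nat
  assumes "x \<in> carrier K" "y \<in> carrier K"
  shows "(x \<oplus> y) [^] n = (\<Oplus>k\<in>{..n}. [(n choose k)] \<cdot> (x [^] k \<otimes> y [^] (n - k)))"
proof (induction n)
  case 0 show ?case using assms by simp
next
  case (Suc n)
  define A where "A k = [(n choose k)] \<cdot> (x [^] k \<otimes> y [^] (Suc n - k))" for k
  define B where "B k = (if k = 0 then \<zero> else [(n choose (k - 1))] \<cdot> (x [^] k \<otimes> y [^] (Suc n - k)))" for k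
  have cl: "A k \<in> carrier K" "B k \<in> carrier K" for k using assms by (auto simp: A_def B_def)
  let ?S = "\<Oplus>k\<in>{..n}. [(n choose k)] \<cdot> (x [^] k \<otimes> y [^] (n - k))"
  have "(x \<oplus> y) [^] Suc n = ?S \<otimes> x \<oplus> ?S \<otimes> y"
    using Suc assms by (simp add: r_distr finsum_closed)
  also have "?S \<otimes> x = (\<Oplus>k\<in>{..n}. B (Suc k))"
  proof -
    have "?S \<otimes> x = (\<Oplus>k\<in>{..n}. [(n choose k)] \<cdot> (x [^] k \<otimes> y [^] (n - k)) \<otimes> x)"
      by (rule finsum_ldistr) (use assms in auto)
    also have "\<dots> = (\<Oplus>k\<in>{..n}. B (Suc k))"
      by (rule finsum_cong') (use assms in \<open>auto simp: B_def add_pow_ldistr add_pow_rdistr m_ac\<close>)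
    finally show ?thesis .
  qed
  also have "(\<Oplus>k\<in>{..n}. B (Suc k)) = (\<Oplus>k\<in>{..Suc n}. B k)"
  proof -
    have "B 0 = \<zero>" by (simp add: B_def)
    moreover have "(\<Oplus>k\<in>{..Suc n}. B k) = (\<Oplus>k\<in>{..n}. B (Suc k)) \<oplus> B 0"
      by (rule finsum_Suc2) (use cl in auto)
    moreover have "(\<Oplus>k\<in>{..n}. B (Suc k)) \<in> carrier K" by (rule finsum_closed) (use cl in auto)
    ultimately show ?thesis by (metis r_zero)
  qed
  also have "?S \<otimes> y = (\<Oplus>k\<in>{..n}. A k)"
  proof -
    have "?S \<otimes> y = (\<Oplus>k\<in>{..n}. [(n choose k)] \<cdot> (x [^] k \<otimes> y [^] (n - k)) \<otimes> y)"
      by (rule finsum_ldistr) (use assms in auto)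
    also have "\<dots> = (\<Oplus>k\<in>{..n}. A k)"
      by (rule finsum_cong') (use assms in \<open>auto simp: A_def add_pow_ldistr m_assoc Suc_diff_le\<close>)
    finally show ?thesis .
  qed
  also have "(\<Oplus>k\<in>{..n}. A k) = (\<Oplus>k\<in>{..Suc n}. A k)"
  proof -
    have "A (Suc n) = \<zero>" by (simp add: A_def binomial_eq_0)
    moreover have "(\<Oplus>k\<in>{..Suc n}. A k) = A (Suc n) \<oplus> (\<Oplus>k\<in>{..n}. A k)"
      by (rule finsum_Suc) (use cl in auto)
    moreover have "(\<Oplus>k\<in>{..n}. A k) \<in> carrier K" by (rule finsum_closed) (use cl in auto)
    ultimately show ?thesis by (metis l_zero)
  qed
  also have "(\<Oplus>k\<in>{..Suc n}. B k) \<oplus> (\<Oplus>k\<in>{..Suc n}. A k) = (\<Oplus>k\<in>{..Suc n}. B k \<oplus> A k)"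
    by (rule finsum_addf[symmetric]) (use cl in auto)
  also have "\<dots> = (\<Oplus>k\<in>{..Suc n}. [(Suc n choose k)] \<cdot> (x [^] k \<otimes> y [^] (Suc n - k)))"
  proof (rule finsum_cong')
    fix k
    show "B k \<oplus> A k = [(Suc n choose k)] \<cdot> (x [^] k \<otimes> y [^] (Suc n - k))"
      using assms by (cases k) (auto simp: A_def B_def add.nat_pow_mult)
  qed (use assms in auto)
  finally show ?case .
qed

text \<open>
  A polynomial of degree less than \<open>q\<close> that vanishes on the whole field is zero. The coefficient of
  \<open>c\<^sup>i\<close> is recovered by summing against \<open>c\<^bsup>q - 1 - i\<^esup>\<close>.
\<close>

lemma coeff_zero:
  assumes "\<And>j. j < q \<Longrightarrow> B j \<in> carrier K"
    and "\<And>c. c \<in> carrier K \<Longrightarrow> (\<Oplus>j\<in>{..<q}. B j \<otimes> c [^] j) = \<zero>" and i: "i < q"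
  shows "B i = \<zero>"
proof -
  have q: "{..<q} = insert 0 {1..<q}" using q_ge_2 by auto
  have B0: "B 0 = \<zero>"
  proof -
    have 1: "(\<Oplus>j\<in>{1..<q}. B j \<otimes> \<zero> [^] j) = (\<Oplus>j\<in>{1..<q}. \<zero>)"
      by (rule finsum_cong') (use assms(1) in \<open>auto simp: nat_pow_zero\<close>)
    have "\<zero> = (\<Oplus>j\<in>{..<q}. B j \<otimes> \<zero> [^] j)" using assms(2)[of \<zero>] by simp
    also have "\<dots> = B 0 \<oplus> (\<Oplus>j\<in>{1..<q}. B j \<otimes> \<zero> [^] j)"
      unfolding q using assms(1) q_ge_2 by (subst finsum_insert) auto
    finally show ?thesis using 1 assms(1)[of 0] q_ge_2 by simp
  qed
  show ?thesis
  proof (cases "i = 0")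
    case False
    have pw: "(\<Oplus>c\<in>carrier K. c [^] (q - 1 - i + j)) = (if i = j then \<ominus> \<one> else \<zero>)" if "j \<in> {1..<q}" for j
    proof -
      consider "j < i" | "j = i" | "j > i" by linarith
      thus ?thesis
      proof cases
        case 1 thus ?thesis using sum_pow_small[of "q - 1 - i + j"] i by auto
      next
        case 2 thus ?thesis using sum_pow_q_minus_1 i by simp
      next
        case 3
        have "(\<Oplus>c\<in>carrier K. c [^] (q - 1 - i + j)) = (\<Oplus>c\<in>carrier K. c [^] (j - i))"
        proof (rule finsum_cong')
          fix c assume c: "c \<in> carrier K"
          have "q - 1 - i + j = q + (j - i - 1)" "j - i = 1 + (j - i - 1)" using 3 i that by auto
          thus "c [^] (q - 1 - i + j) = c [^] (j - i)"
            using c pow_q[OF c] by (metis nat_pow_mult nat_pow_eone)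
        qed auto
        also have "\<dots> = \<zero>" by (rule sum_pow_small) (use 3 that False in auto)
        finally show ?thesis using 3 by simp
      qed
    qed
    have "\<zero> = (\<Oplus>c\<in>carrier K. (\<Oplus>j\<in>{..<q}. B j \<otimes> c [^] j) \<otimes> c [^] (q - 1 - i))"
    proof -
      have "(\<Oplus>c\<in>carrier K. (\<Oplus>j\<in>{..<q}. B j \<otimes> c [^] j) \<otimes> c [^] (q - 1 - i)) = (\<Oplus>c\<in>carrier K. \<zero>)"
        by (rule finsum_cong') (use assms(2) in auto)
      thus ?thesis by simp
    qed
    also have "\<dots> = (\<Oplus>c\<in>carrier K. \<Oplus>j\<in>{1..<q}. B j \<otimes> c [^] (q - 1 - i + j))"
    proof (rule finsum_cong')
      fix c assume c: "c \<in> carrier K"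
      have "(\<Oplus>j\<in>{..<q}. B j \<otimes> c [^] j) = (\<Oplus>j\<in>{1..<q}. B j \<otimes> c [^] j)"
        unfolding q using assms(1) c B0 by (subst finsum_insert) auto
      hence "(\<Oplus>j\<in>{..<q}. B j \<otimes> c [^] j) \<otimes> c [^] (q - 1 - i)
          = (\<Oplus>j\<in>{1..<q}. B j \<otimes> c [^] j \<otimes> c [^] (q - 1 - i))"
        using assms(1) c by (simp only:, intro finsum_ldistr) auto
      also have "\<dots> = (\<Oplus>j\<in>{1..<q}. B j \<otimes> c [^] (q - 1 - i + j))"
        by (rule finsum_cong') (use assms(1) c in \<open>auto simp: m_assoc nat_pow_mult add.commute\<close>)
      finally show "(\<Oplus>j\<in>{..<q}. B j \<otimes> c [^] j) \<otimes> c [^] (q - 1 - i)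
          = (\<Oplus>j\<in>{1..<q}. B j \<otimes> c [^] (q - 1 - i + j))" .
    qed (use assms(1) in \<open>auto intro!: finsum_closed\<close>)
    also have "\<dots> = (\<Oplus>j\<in>{1..<q}. \<Oplus>c\<in>carrier K. B j \<otimes> c [^] (q - 1 - i + j))"
      by (rule finsum_swap) (use assms(1) finite_carrier in auto)
    also have "\<dots> = (\<Oplus>j\<in>{1..<q}. B j \<otimes> (\<Oplus>c\<in>carrier K. c [^] (q - 1 - i + j)))"
      by (intro finsum_cong' finsum_rdistr[symmetric]) (use assms(1) finite_carrier in \<open>auto intro!: finsum_closed\<close>)
    also have "\<dots> = (\<Oplus>j\<in>{1..<q}. if i = j then \<ominus> B j else \<zero>)"
    proof (rule finsum_cong')
      fix j assume j: "j \<in> {1..<q}"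
      show "B j \<otimes> (\<Oplus>c\<in>carrier K. c [^] (q - 1 - i + j)) = (if i = j then \<ominus> B j else \<zero>)"
        unfolding pw[OF j] using assms(1) j by (auto simp: r_minus)
    qed (use assms(1) in auto)
    also have "\<dots> = \<ominus> B i"
      using finsum_singleton[of i "{1..<q}" "\<lambda>j. \<ominus> B j"] assms(1) i False by auto
    finally show ?thesis using assms(1)[OF i] by (metis minus_minus minus_zero)
  qed (simp add: B0)
qed

section \<open>From hyperplanes to the whole space\<close>

lemma plt_1D: "plt I n f \<Longrightarrow> n \<le> 1 \<Longrightarrow> \<exists>c\<in>carrier K. \<forall>x\<in>pts I. f x = c"
proof (induction rule: plt.induct)
  case (plt_zero f n) thus ?case by (intro bexI[of _ \<zero>]) auto
next
  case (plt_const c f n) thus ?case by blast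
next
  case (plt_add n f g h)
  then obtain c d where "c \<in> carrier K" "d \<in> carrier K" "\<forall>x\<in>pts I. f x = c" "\<forall>x\<in>pts I. g x = d" by blast
  thus ?case using plt_add.hyps(3) by (intro bexI[of _ "c \<oplus> d"]) auto
next
  case (plt_var_mult n f i h)
  hence "h x = \<zero>" if "x \<in> pts I" for x
    using plt_0D[of I f x] that pts_mem[OF that plt_var_mult.hyps(2)] by simp
  thus ?case by blast
qed

lemma plt_2D:
  assumes "finite I" "plt I n f" "n \<le> 2"
  shows "\<exists>c0\<in>carrier K. \<exists>c\<in>I \<rightarrow> carrier K. \<forall>x\<in>pts I. f x = c0 \<oplus> (\<Oplus>i\<in>I. c i \<otimes> x i)"
  using assms(2,3)
proof (induction rule: plt.induct)
  case (plt_zero f n)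
  have "(\<Oplus>i\<in>I. \<zero> \<otimes> x i) = (\<Oplus>i\<in>I. \<zero>)" if "x \<in> pts I" for x
    by (rule finsum_cong') (use pts_mem[OF that] in auto)
  thus ?case using plt_zero by (intro bexI[of _ \<zero>] bexI[of _ "\<lambda>_. \<zero>"]) auto
next
  case (plt_const c f n)
  have "(\<Oplus>i\<in>I. \<zero> \<otimes> x i) = (\<Oplus>i\<in>I. \<zero>)" if "x \<in> pts I" for x
    by (rule finsum_cong') (use pts_mem[OF that] in auto)
  thus ?case using plt_const by (intro bexI[of _ c] bexI[of _ "\<lambda>_. \<zero>"]) auto
next
  case (plt_add n f g h)
  obtain c0 c where c: "c0 \<in> carrier K" "c \<in> I \<rightarrow> carrier K" "\<forall>x\<in>pts I. f x = c0 \<oplus> (\<Oplus>i\<in>I. c i \<otimes> x i)"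
    using plt_add by blast
  obtain d0 d where d: "d0 \<in> carrier K" "d \<in> I \<rightarrow> carrier K" "\<forall>x\<in>pts I. g x = d0 \<oplus> (\<Oplus>i\<in>I. d i \<otimes> x i)"
    using plt_add by blast
  have "h x = (c0 \<oplus> d0) \<oplus> (\<Oplus>i\<in>I. (c i \<oplus> d i) \<otimes> x i)" if x: "x \<in> pts I" for x
  proof -
    have xi: "x i \<in> carrier K" "c i \<in> carrier K" "d i \<in> carrier K" if "i \<in> I" for i
      using pts_mem[OF x that] c(2) d(2) that by auto
    have "(\<Oplus>i\<in>I. (c i \<oplus> d i) \<otimes> x i) = (\<Oplus>i\<in>I. c i \<otimes> x i \<oplus> d i \<otimes> x i)"
      by (rule finsum_cong') (use xi in \<open>auto simp: l_distr\<close>)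
    also have "\<dots> = (\<Oplus>i\<in>I. c i \<otimes> x i) \<oplus> (\<Oplus>i\<in>I. d i \<otimes> x i)"
      by (rule finsum_addf) (use xi in auto)
    finally have e: "(\<Oplus>i\<in>I. (c i \<oplus> d i) \<otimes> x i) = (\<Oplus>i\<in>I. c i \<otimes> x i) \<oplus> (\<Oplus>i\<in>I. d i \<otimes> x i)" .
    have "(\<Oplus>i\<in>I. c i \<otimes> x i) \<in> carrier K" "(\<Oplus>i\<in>I. d i \<otimes> x i) \<in> carrier K"
      using xi by (auto intro!: finsum_closed)
    thus ?thesis unfolding e using plt_add.hyps(3)[OF x] c d x by (simp add: a_ac)
  qed
  thus ?case using c d by (intro bexI[of _ "c0 \<oplus> d0"] bexI[of _ "\<lambda>i. c i \<oplus> d i"]) auto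
next
  case (plt_var_mult n f i h)
  obtain c where c: "c \<in> carrier K" "\<forall>x\<in>pts I. f x = c" using plt_1D[OF plt_var_mult.hyps(1)] plt_var_mult.prems by auto
  have "h x = \<zero> \<oplus> (\<Oplus>j\<in>I. (if j = i then c else \<zero>) \<otimes> x j)" if x: "x \<in> pts I" for x
  proof -
    have "(\<Oplus>j\<in>I. (if j = i then c else \<zero>) \<otimes> x j) = (\<Oplus>j\<in>I. if i = j then c \<otimes> x j else \<zero>)"
      by (rule finsum_cong') (use pts_mem[OF x] c in auto)
    also have "\<dots> = c \<otimes> x i"
      using finsum_singleton[of i I "\<lambda>j. c \<otimes> x j"] plt_var_mult.hyps assms(1) pts_mem[OF x] c by auto
    finally show ?thesis using plt_var_mult.hyps c x pts_mem[OF x plt_var_mult.hyps(2)] by (simp add: m_comm)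
  qed
  thus ?case using c by (intro bexI[of _ \<zero>] bexI[of _ "\<lambda>j. if j = i then c else \<zero>"]) auto
qed

lemma plt_affine:
  assumes "finite J" "c0 \<in> carrier K" "\<And>j. j \<in> J \<Longrightarrow> c j \<in> carrier K" "\<And>j. j \<in> J \<Longrightarrow> plt I 2 (g j)"
  shows "plt I 2 (\<lambda>x. c0 \<oplus> (\<Oplus>j\<in>J. c j \<otimes> g j x))"
proof -
  have "plt I 2 (\<lambda>x. c0)" using assms plt_const[of c0 I "\<lambda>_. c0" 1] by (simp add: numeral_2_eq_2)
  moreover have "plt I 2 (\<lambda>x. \<Oplus>j\<in>J. c j \<otimes> g j x)"
    by (rule plt_sum) (auto intro!: plt_smult assms)
  ultimately show ?thesis by (rule plt_add) simp
qed

definition pairing :: "'i set \<Rightarrow> (('i \<Rightarrow> 'a) \<Rightarrow> 'a) \<Rightarrow> (('i \<Rightarrow> 'a) \<Rightarrow> 'a) \<Rightarrow> 'a" where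
  "pairing I f h = (\<Oplus>x\<in>pts I. f x \<otimes> h x)"

lemma pairing_closed:
  "(\<And>x. x \<in> pts I \<Longrightarrow> f x \<in> carrier K) \<Longrightarrow> (\<And>x. x \<in> pts I \<Longrightarrow> h x \<in> carrier K) \<Longrightarrow> pairing I f h \<in> carrier K"
  unfolding pairing_def by (auto intro!: finsum_closed)

lemma pairing_cong:
  assumes "\<And>x. x \<in> pts I \<Longrightarrow> f x \<in> carrier K" "\<And>x. x \<in> pts I \<Longrightarrow> h' x \<in> carrier K"
    "\<And>x. x \<in> pts I \<Longrightarrow> h x = h' x"
  shows "pairing I f h = pairing I f h'"
  unfolding pairing_def by (rule finsum_cong') (use assms in auto)

text \<open>
  The expansion of \<open>(c u + g)\<^sup>N\<close> in powers of \<open>c\<close> is a polynomial of degree \<open>N < q\<close> in \<open>c\<close>. If the pairing with \<open>f\<close>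
  vanishes for all \<open>c\<close>, so does every coefficient, and the binomial coefficient can be cancelled if it is prime
  to \<open>p\<close>.
\<close>

lemma pairing_extract:
  assumes "finite I" and f: "\<And>x. x \<in> pts I \<Longrightarrow> f x \<in> carrier K" and h: "\<And>x. x \<in> pts I \<Longrightarrow> h x \<in> carrier K"
    and l: "\<And>x. x \<in> pts I \<Longrightarrow> l x \<in> carrier K" and g: "\<And>x. x \<in> pts I \<Longrightarrow> g x \<in> carrier K"
    and 0: "\<And>c. c \<in> carrier K \<Longrightarrow> pairing I f (\<lambda>x. h x \<otimes> (c \<otimes> l x \<oplus> g x) [^] N) = \<zero>"
    and N: "N < q" "j \<le> N" "\<not> p dvd (N choose j)"
  shows "pairing I f (\<lambda>x. h x \<otimes> (l x [^] j \<otimes> g x [^] (N - j))) = \<zero>"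
proof -
  define A where "A j = pairing I f (\<lambda>x. h x \<otimes> (l x [^] j \<otimes> g x [^] (N - j)))" for j
  define B where "B j = [(N choose j)] \<cdot> A j" for j
  have A: "A j \<in> carrier K" for j unfolding A_def using f h l g by (intro pairing_closed) auto
  have "B j = \<zero>"
  proof (rule coeff_zero[of B])
    fix c assume c: "c \<in> carrier K"
    have "(\<Oplus>j\<in>{..<q}. B j \<otimes> c [^] j) = (\<Oplus>j\<in>{..N}. B j \<otimes> c [^] j)"
    proof (rule add.finprod_mono_neutral_cong_right)
      show "B i \<otimes> c [^] i = \<zero>" if "i \<in> {..<q} - {..N}" for i
        using c A that by (auto simp: B_def binomial_eq_0)
    qed (use N A c in \<open>auto simp: B_def\<close>)
    also have "\<dots> = (\<Oplus>j\<in>{..N}. \<Oplus>x\<in>pts I. f x \<otimes> (h x \<otimes> [(N choose j)] \<cdot> ((c \<otimes> l x) [^] j \<otimes> g x [^] (N - j))))"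
    proof (rule finsum_cong')
      fix j
      have "B j \<otimes> c [^] j = [(N choose j)] \<cdot> \<one> \<otimes> c [^] j \<otimes> A j"
        using c A unfolding B_def by (subst add_pow_mult_one) (auto simp: m_ac)
      also have "\<dots> = (\<Oplus>x\<in>pts I. [(N choose j)] \<cdot> \<one> \<otimes> c [^] j \<otimes> (f x \<otimes> (h x \<otimes> (l x [^] j \<otimes> g x [^] (N - j)))))"
        unfolding A_def pairing_def
        by (rule finsum_rdistr) (use c f h l g finite_pts assms(1) in auto)
      also have "\<dots> = (\<Oplus>x\<in>pts I. f x \<otimes> (h x \<otimes> [(N choose j)] \<cdot> ((c \<otimes> l x) [^] j \<otimes> g x [^] (N - j))))"
      proof (rule finsum_cong')
        fix x assume x: "x \<in> pts I"
        have "[(N choose j)] \<cdot> ((c \<otimes> l x) [^] j \<otimes> g x [^] (N - j))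
          = ([(N choose j)] \<cdot> \<one>) \<otimes> ((c \<otimes> l x) [^] j \<otimes> g x [^] (N - j))"
          by (rule add_pow_mult_one) (use x c l g in auto)
        thus "[(N choose j)] \<cdot> \<one> \<otimes> c [^] j \<otimes> (f x \<otimes> (h x \<otimes> (l x [^] j \<otimes> g x [^] (N - j))))
          = f x \<otimes> (h x \<otimes> [(N choose j)] \<cdot> ((c \<otimes> l x) [^] j \<otimes> g x [^] (N - j)))"
          using x c f h l g by (simp add: nat_pow_distrib m_ac)
      qed (use f h l g c in auto)
      finally show "B j \<otimes> c [^] j = (\<Oplus>x\<in>pts I. f x \<otimes> (h x \<otimes> [(N choose j)] \<cdot> ((c \<otimes> l x) [^] j \<otimes> g x [^] (N - j))))" .
    qed (use f h l g c in \<open>auto intro!: finsum_closed\<close>)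
    also have "\<dots> = (\<Oplus>x\<in>pts I. \<Oplus>j\<in>{..N}. f x \<otimes> (h x \<otimes> [(N choose j)] \<cdot> ((c \<otimes> l x) [^] j \<otimes> g x [^] (N - j))))"
      by (rule finsum_swap) (use f h l g c finite_pts assms(1) in auto)
    also have "\<dots> = pairing I f (\<lambda>x. h x \<otimes> (c \<otimes> l x \<oplus> g x) [^] N)"
      unfolding pairing_def
    proof (rule finsum_cong')
      fix x assume x: "x \<in> pts I"
      have "(\<Oplus>j\<in>{..N}. f x \<otimes> (h x \<otimes> [(N choose j)] \<cdot> ((c \<otimes> l x) [^] j \<otimes> g x [^] (N - j))))
         = (\<Oplus>j\<in>{..N}. (f x \<otimes> h x) \<otimes> [(N choose j)] \<cdot> ((c \<otimes> l x) [^] j \<otimes> g x [^] (N - j)))"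
        by (rule finsum_cong') (use f h l g c x in \<open>auto simp: m_assoc\<close>)
      also have "\<dots> = (f x \<otimes> h x) \<otimes> (\<Oplus>j\<in>{..N}. [(N choose j)] \<cdot> ((c \<otimes> l x) [^] j \<otimes> g x [^] (N - j)))"
        by (rule finsum_rdistr[symmetric]) (use f h l g c x in auto)
      also have "\<dots> = f x \<otimes> (h x \<otimes> (c \<otimes> l x \<oplus> g x) [^] N)"
        using f h l g c x by (subst binomial_ring) (auto simp: m_assoc intro!: finsum_closed)
      finally show "(\<Oplus>j\<in>{..N}. f x \<otimes> (h x \<otimes> [(N choose j)] \<cdot> ((c \<otimes> l x) [^] j \<otimes> g x [^] (N - j))))
        = f x \<otimes> (h x \<otimes> (c \<otimes> l x \<oplus> g x) [^] N)" .
    qed (use f h l g c in auto)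
    finally show "(\<Oplus>j\<in>{..<q}. B j \<otimes> c [^] j) = \<zero>" using 0[OF c] by simp
  qed (use A N in \<open>auto simp: B_def\<close>)
  hence "A j = \<zero>" unfolding B_def using add_pow_eq_0D N A by blast
  thus ?thesis by (simp add: A_def)
qed

end

lemma exists_bounded_with_sum:
  fixes B :: "'i \<Rightarrow> nat"
  assumes "finite I" "s \<le> sum B I"
  shows "\<exists>a. (\<forall>i\<in>I. a i \<le> B i) \<and> sum a I = s"
  using assms(2)
proof (induction s)
  case 0 show ?case by (rule exI[of _ "\<lambda>_. 0"]) auto
next
  case (Suc s)
  then obtain a where a: "\<forall>i\<in>I. a i \<le> B i" "sum a I = s" by auto
  have "\<not> (\<forall>i\<in>I. B i \<le> a i)" using sum_mono[of I B a] a Suc.prems by auto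
  then obtain i where i: "i \<in> I" "a i < B i" by auto
  have e: "I = insert i (I - {i})" using i by auto
  have "sum (a(i := Suc (a i))) I = Suc (sum a I)"
    by (subst (1 2) e) (use assms(1) in \<open>simp add: sum.insert_remove\<close>)
  thus ?case using a i by (intro exI[of _ "a(i := Suc (a i))"]) auto
qed

context galois_field begin

lemma q_minus_1_eq: "(p - 1) * Q + (Q - 1) = q - 1"
proof -
  have "(a - 1) * b + (b - 1) = c - 1" if "c = a * b" "a > 0" "b > 0" for a b c :: nat
    using that by (cases a) auto
  from this[OF q_eq p_pos Q_pos] show ?thesis .
qed

lemma sum_plt_zero:
  assumes "finite I" "plt I n f" "n \<le> card I * (q - 1)" shows "(\<Oplus>x\<in>pts I. f x) = \<zero>"
proof -
  have "moment I (\<lambda>_. 0) f = (\<Oplus>x\<in>pts I. f x)"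
    unfolding moment_def by (rule finsum_cong') (use plt_closed[OF assms(2)] in \<open>auto simp: mono_def\<close>)
  thus ?thesis using moment_plt_zero[OF assms(1,2), of "\<lambda>_. 0"] assms(3) by simp
qed

lemma plt_fun_upd:
  assumes "plt I n f" "i \<in> I" "plt (I - {i}) 2 l"
  shows "plt (I - {i}) n (\<lambda>y. f (y(i := l y)))"
proof (rule plt_comp[OF assms(1)])
  fix x assume x: "x \<in> pts (I - {i})"
  show "x(i := l x) \<in> pts I" using x plt_closed[OF assms(3) x] assms(2)
    by (auto simp: PiE_def extensional_def Pi_def)
next
  fix j assume "j \<in> I"
  thus "plt (I - {i}) 2 (\<lambda>x. (x(i := l x)) j)"
    using assms(3) plt_var[of j "I - {i}"] by (cases "j = i") auto
qed

lemma one_minus_pow: "x \<in> carrier K \<Longrightarrow> \<one> \<ominus> x [^] (q - 1) = (if x = \<zero> then \<one> else \<zero>)"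
proof -
  assume x: "x \<in> carrier K"
  have "\<zero> [^] (q - 1) = \<zero>" using q_ge_2 by (intro nat_pow_zero) simp
  thus ?thesis using x pow_q_minus_1[OF x] by (auto simp: minus_eq r_neg)
qed

lemma pairing_graph_zero:
  assumes "finite I" "i \<in> I" "plt I (Suc r) h" "r + n \<le> (card I - 1) * (q - 1)" "plt (I - {i}) 2 l"
    and "plt (I - {i}) n (\<lambda>y. f (y(i := l y)))"
  shows "(\<Oplus>y\<in>pts (I - {i}). f (y(i := l y)) \<otimes> h (y(i := l y))) = \<zero>"
proof (rule sum_plt_zero)
  show "plt (I - {i}) (n + (Suc r - 1)) (\<lambda>y. f (y(i := l y)) \<otimes> h (y(i := l y)))"
    by (rule plt_mult[OF plt_fun_upd[OF assms(3,2,5)] assms(6)])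
  show "finite (I - {i})" using assms(1) by simp
  show "n + (Suc r - 1) \<le> card (I - {i}) * (q - 1)"
    using assms(1,2,4) by (simp add: add.commute)
qed

text \<open>
  \<open>1 - g\<^bsup>q - 1\<^esup>\<close> is the indicator function of \<open>g = 0\<close>. If \<open>g\<close> depends on a variable \<open>x\<^sub>i\<close>, the set \<open>g = 0\<close> is
  a graph over the other variables, on which \<open>f\<close> has degree less than \<open>n\<close>; there its product with \<open>h\<close> has
  too small a degree for a non-zero sum. The total sum of \<open>f h\<close> vanishes for the same reason, by slicing along
  \<open>x\<^sub>i = c\<close>.
\<close>

lemma pairing_hyperplane_power:
  assumes I: "finite I" "I \<noteq> {}" and f: "\<And>x. x \<in> pts I \<Longrightarrow> f x \<in> carrier K"
    and HP: "\<And>i l. i \<in> I \<Longrightarrow> plt (I - {i}) 2 l \<Longrightarrow> plt (I - {i}) n (\<lambda>y. f (y(i := l y)))"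
    and h: "plt I (Suc r) h" and r: "r + n \<le> (card I - 1) * (q - 1)" and g: "plt I 2 g"
  shows "pairing I f (\<lambda>x. h x \<otimes> g x [^] (q - 1)) = \<zero>"
proof -
  have hc: "h x \<in> carrier K" if "x \<in> pts I" for x using plt_closed[OF h that] .
  have gc: "g x \<in> carrier K" if "x \<in> pts I" for x using plt_closed[OF g that] .
  have up: "y(i := c) \<in> pts I" if "y \<in> pts (I - {i})" "c \<in> carrier K" "i \<in> I" for y i c
    using that by (auto simp: PiE_def extensional_def Pi_def)
  have split: "pairing I f u = (\<Oplus>c\<in>carrier K. \<Oplus>y\<in>pts (I - {i}). f (y(i := c)) \<otimes> u (y(i := c)))"
    if "i \<in> I" "\<And>x. x \<in> pts I \<Longrightarrow> u x \<in> carrier K" for i u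
  proof -
    have e: "insert i (I - {i}) = I" using that by auto
    show ?thesis unfolding pairing_def
      by (rule sum_pts_insert[of "I - {i}" i "\<lambda>x. f x \<otimes> u x", unfolded e]) (use I in \<open>auto intro: m_closed f that\<close>)
  qed
  obtain i0 where i0: "i0 \<in> I" using I by auto
  have H0: "pairing I f h = \<zero>"
  proof -
    have "pairing I f h = (\<Oplus>c\<in>carrier K. \<Oplus>y\<in>pts (I - {i0}). f (y(i0 := c)) \<otimes> h (y(i0 := c)))"
      by (rule split[OF i0 hc])
    also have "\<dots> = (\<Oplus>c\<in>carrier K. \<zero>)"
    proof (rule finsum_cong')
      fix c assume c: "c \<in> carrier K"
      have l: "plt (I - {i0}) 2 (\<lambda>_. c)" using plt_const[of c "I - {i0}" "\<lambda>_. c" 1] c by (simp add: numeral_2_eq_2)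
      show "(\<Oplus>y\<in>pts (I - {i0}). f (y(i0 := c)) \<otimes> h (y(i0 := c))) = \<zero>"
        by (rule pairing_graph_zero[OF I(1) i0 h r l HP[OF i0 l]])
    qed auto
    finally show ?thesis by simp
  qed
  obtain c0 c where c: "c0 \<in> carrier K" "c \<in> I \<rightarrow> carrier K" "\<And>x. x \<in> pts I \<Longrightarrow> g x = c0 \<oplus> (\<Oplus>i\<in>I. c i \<otimes> x i)"
    using plt_2D[OF I(1) g] by blast
  \<comment> \<open>The sum over the hyperplane \<open>g = 0\<close>, which may also be empty or everything if \<open>g\<close> is constant.\<close>
  have H1: "pairing I f (\<lambda>x. h x \<otimes> (\<one> \<ominus> g x [^] (q - 1))) = \<zero>"
  proof (cases "\<forall>i\<in>I. c i = \<zero>")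
    case True
    have gx: "g x = c0" if "x \<in> pts I" for x
    proof -
      have "(\<Oplus>i\<in>I. c i \<otimes> x i) = (\<Oplus>i\<in>I. \<zero>)"
        by (rule finsum_cong') (use True pts_mem[OF that] in auto)
      thus ?thesis using c that by simp
    qed
    show ?thesis
    proof (cases "c0 = \<zero>")
      case True
      have "pairing I f (\<lambda>x. h x \<otimes> (\<one> \<ominus> g x [^] (q - 1))) = pairing I f h"
      proof (rule pairing_cong[OF f hc])
        fix x assume "x \<in> pts I"
        thus "h x \<otimes> (\<one> \<ominus> g x [^] (q - 1)) = h x"
          by (simp only: gx trans[OF one_minus_pow[OF c(1)] if_P[OF True]] hc r_one)
      qed
      thus ?thesis using H0 by simp
    next
      case False
      have "pairing I f (\<lambda>x. h x \<otimes> (\<one> \<ominus> g x [^] (q - 1))) = pairing I f (\<lambda>x. \<zero>)"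
      proof (rule pairing_cong[OF f])
        fix x assume "x \<in> pts I"
        thus "h x \<otimes> (\<one> \<ominus> g x [^] (q - 1)) = \<zero>"
          by (simp only: gx trans[OF one_minus_pow[OF c(1)] if_not_P[OF False]] hc r_null)
      qed auto
      also have "\<dots> = (\<Oplus>x\<in>pts I. \<zero>)" unfolding pairing_def by (rule finsum_cong') (use f in auto)
      finally show ?thesis by simp
    qed
  next
    case False
    then obtain i where i: "i \<in> I" "c i \<noteq> \<zero>" by auto
    have ci: "c i \<in> carrier K" "inv (c i) \<in> carrier K" "c i \<otimes> inv (c i) = \<one>"
    proof -
      have "c i \<in> Units K" using i c by (auto simp: field_Units)
      thus "c i \<in> carrier K" "inv (c i) \<in> carrier K" "c i \<otimes> inv (c i) = \<one>" by auto
    qed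
    define w where "w y = c0 \<oplus> (\<Oplus>j\<in>I - {i}. c j \<otimes> y j)" for y
    define l where "l y = (\<ominus> (inv (c i))) \<otimes> w y" for y
    have pw: "plt (I - {i}) 2 w" unfolding w_def
    proof (rule plt_affine)
      fix j assume j: "j \<in> I - {i}"
      show "plt (I - {i}) 2 (\<lambda>x. x j)" by (rule plt_var[OF j])
      show "c j \<in> carrier K" using j c(2) by auto
    qed (use I c(1) in auto)
    have pl: "plt (I - {i}) 2 l" unfolding l_def by (rule plt_smult[OF pw]) (use ci in auto)
    have wc: "w y \<in> carrier K" "l y \<in> carrier K" if "y \<in> pts (I - {i})" for y
      using plt_closed[OF pw that] plt_closed[OF pl that] .
    have gi: "g (y(i := b)) = c i \<otimes> b \<oplus> w y" if y: "y \<in> pts (I - {i})" and b: "b \<in> carrier K" for y b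
    proof -
      have e: "insert i (I - {i}) = I" using i by auto
      have yj: "c j \<otimes> y j \<in> carrier K" if "j \<in> I - {i}" for j using pts_mem[OF y that] c(2) that by auto
      have "(\<Oplus>j\<in>insert i (I - {i}). c j \<otimes> (y(i := b)) j)
          = c i \<otimes> (y(i := b)) i \<oplus> (\<Oplus>j\<in>I - {i}. c j \<otimes> (y(i := b)) j)"
      proof (rule finsum_insert)
        show "(\<lambda>j. c j \<otimes> (y(i := b)) j) \<in> I - {i} \<rightarrow> carrier K" using yj by auto
        show "c i \<otimes> (y(i := b)) i \<in> carrier K" using ci(1) b by simp
      qed (use I(1) in auto)
      hence "(\<Oplus>j\<in>I. c j \<otimes> (y(i := b)) j) = c i \<otimes> b \<oplus> (\<Oplus>j\<in>I - {i}. c j \<otimes> (y(i := b)) j)"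
        unfolding e by (simp only: fun_upd_same)
      also have "(\<Oplus>j\<in>I - {i}. c j \<otimes> (y(i := b)) j) = (\<Oplus>j\<in>I - {i}. c j \<otimes> y j)"
        by (rule finsum_cong') (use yj in auto)
      finally have s: "(\<Oplus>j\<in>I. c j \<otimes> (y(i := b)) j) = c i \<otimes> b \<oplus> (\<Oplus>j\<in>I - {i}. c j \<otimes> y j)" .
      have "(\<Oplus>j\<in>I - {i}. c j \<otimes> y j) \<in> carrier K" using yj by (intro finsum_closed) auto
      thus ?thesis unfolding w_def c(3)[OF up[OF y b i(1)]] s using c(1) ci(1) b
        by (intro a_lcomm) auto
    qed
    have g0: "g (y(i := b)) = \<zero> \<longleftrightarrow> b = l y" if y: "y \<in> pts (I - {i})" and b: "b \<in> carrier K" for y b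
    proof
      assume "g (y(i := b)) = \<zero>"
      hence z: "c i \<otimes> b \<oplus> w y = \<zero>" using gi[OF that] by simp
      have "inv (c i) \<otimes> c i = \<one>" using ci m_comm[of "c i" "inv (c i)"] by simp
      hence "b = inv (c i) \<otimes> (c i \<otimes> b)" using ci b by (simp add: m_assoc[symmetric])
      also have "c i \<otimes> b = \<ominus> w y" by (rule minus_equality[OF z, symmetric]) (use wc[OF y] ci b in auto)
      finally show "b = l y" unfolding l_def using ci wc[OF y] by (simp add: l_minus r_minus)
    next
      assume b: "b = l y"
      have "c i \<otimes> (\<ominus> (inv (c i)) \<otimes> w y) = \<ominus> w y"
        using ci wc[OF y] by (simp add: l_minus r_minus m_assoc[symmetric])
      thus "g (y(i := b)) = \<zero>" using gi[OF that] b wc[OF y] ci unfolding l_def by (simp add: l_neg)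
    qed
    let ?u = "\<lambda>x. h x \<otimes> (\<one> \<ominus> g x [^] (q - 1))"
    have "pairing I f ?u = (\<Oplus>b\<in>carrier K. \<Oplus>y\<in>pts (I - {i}). f (y(i := b)) \<otimes> ?u (y(i := b)))"
      by (rule split[OF i(1)]) (intro m_closed minus_closed nat_pow_closed hc gc one_closed)
    also have "\<dots> = (\<Oplus>y\<in>pts (I - {i}). \<Oplus>b\<in>carrier K. f (y(i := b)) \<otimes> ?u (y(i := b)))"
    proof (rule finsum_swap)
      fix b y assume "b \<in> carrier K" "y \<in> pts (I - {i})"
      hence "y(i := b) \<in> pts I" using up i(1) by blast
      thus "f (y(i := b)) \<otimes> ?u (y(i := b)) \<in> carrier K" by (intro m_closed minus_closed nat_pow_closed f hc gc one_closed)
    qed (use finite_carrier finite_pts I in auto)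
    also have "\<dots> = (\<Oplus>y\<in>pts (I - {i}). f (y(i := l y)) \<otimes> h (y(i := l y)))"
    proof (rule finsum_cong')
      fix y assume y: "y \<in> pts (I - {i})"
      have fu: "f (y(i := b)) \<in> carrier K" "h (y(i := b)) \<in> carrier K" "g (y(i := b)) \<in> carrier K"
        if "b \<in> carrier K" for b using f[OF up[OF y that i(1)]] hc[OF up[OF y that i(1)]] gc[OF up[OF y that i(1)]] .
      have "(\<Oplus>b\<in>carrier K. f (y(i := b)) \<otimes> ?u (y(i := b)))
         = (\<Oplus>b\<in>carrier K. if l y = b then f (y(i := b)) \<otimes> h (y(i := b)) else \<zero>)"
      proof (rule finsum_cong')
        fix b assume b: "b \<in> carrier K"
        show "f (y(i := b)) \<otimes> ?u (y(i := b)) = (if l y = b then f (y(i := b)) \<otimes> h (y(i := b)) else \<zero>)"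
          unfolding one_minus_pow[OF fu(3)[OF b]] g0[OF y b] using fu[OF b] by auto
      qed (use fu in auto)
      also have "\<dots> = f (y(i := l y)) \<otimes> h (y(i := l y))"
        using finsum_singleton[of "l y" "carrier K" "\<lambda>b. f (y(i := b)) \<otimes> h (y(i := b))"]
          wc[OF y] finite_carrier fu by auto
      finally show "(\<Oplus>b\<in>carrier K. f (y(i := b)) \<otimes> ?u (y(i := b))) = f (y(i := l y)) \<otimes> h (y(i := l y))" .
    next
      show "(\<lambda>y. f (y(i := l y)) \<otimes> h (y(i := l y))) \<in> pts (I - {i}) \<rightarrow> carrier K"
      proof
        fix y assume y: "y \<in> pts (I - {i})"
        show "f (y(i := l y)) \<otimes> h (y(i := l y)) \<in> carrier K"
          using up[OF y wc(2)[OF y] i(1)] by (intro m_closed f hc)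
      qed
    qed simp
    also have "\<dots> = \<zero>" by (rule pairing_graph_zero[OF I(1) i(1) h r pl HP[OF i(1) pl]])
    finally show ?thesis .
  qed
  have "pairing I f h = pairing I f (\<lambda>x. h x \<otimes> (\<one> \<ominus> g x [^] (q - 1))) \<oplus> pairing I f (\<lambda>x. h x \<otimes> g x [^] (q - 1))"
  proof -
    have "pairing I f h = (\<Oplus>x\<in>pts I. f x \<otimes> (h x \<otimes> (\<one> \<ominus> g x [^] (q - 1))) \<oplus> f x \<otimes> (h x \<otimes> g x [^] (q - 1)))"
      unfolding pairing_def
    proof (rule finsum_cong')
      fix x assume x: "x \<in> pts I"
      have split1: "a \<otimes> b = a \<otimes> (b \<otimes> (\<one> \<ominus> v)) \<oplus> a \<otimes> (b \<otimes> v)" if "a \<in> carrier K" "b \<in> carrier K" "v \<in> carrier K" for a b v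
        using that by algebra
      show "f x \<otimes> h x = f x \<otimes> (h x \<otimes> (\<one> \<ominus> g x [^] (q - 1))) \<oplus> f x \<otimes> (h x \<otimes> g x [^] (q - 1))"
        by (rule split1[OF f[OF x] hc[OF x] nat_pow_closed[OF gc[OF x]]])
    qed (use f hc gc in auto)
    also have "\<dots> = pairing I f (\<lambda>x. h x \<otimes> (\<one> \<ominus> g x [^] (q - 1))) \<oplus> pairing I f (\<lambda>x. h x \<otimes> g x [^] (q - 1))"
      unfolding pairing_def by (rule finsum_addf) (use f hc gc in auto)
    finally show ?thesis .
  qed
  moreover have "pairing I f (\<lambda>x. h x \<otimes> g x [^] (q - 1)) \<in> carrier K"
    by (rule pairing_closed) (use f hc gc in auto)
  ultimately show ?thesis unfolding H0 H1 by (metis l_zero)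
qed

text \<open>
  Each of the \<open>s\<close> steps takes a factor \<open>u\<^sup>Q\<close>, with \<open>u\<close> a variable or the constant \<open>1\<close>, out of the power of \<open>g\<close>. The
  exponent of \<open>g\<close> has the form \<open>a Q + (Q - 1)\<close> with \<open>0 < a < p\<close>, and the binomial coefficient
  \<open>a Q + (Q - 1)\<close> over \<open>Q\<close> is congruent to \<open>a\<close> modulo \<open>p\<close>.
\<close>

lemma pairing_mono_power:
  assumes I: "finite I" and f: "\<And>x. x \<in> pts I \<Longrightarrow> f x \<in> carrier K" and h: "\<And>x. x \<in> pts I \<Longrightarrow> h x \<in> carrier K"
    and base: "\<And>g. plt I 2 g \<Longrightarrow> pairing I f (\<lambda>x. h x \<otimes> g x [^] (q - 1)) = \<zero>"
  shows "s \<le> p - 1 \<Longrightarrow> sum a I \<le> s \<Longrightarrow> plt I 2 g \<Longrightarrow>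
    pairing I f (\<lambda>x. h x \<otimes> (mono I (\<lambda>i. Q * a i) x \<otimes> g x [^] ((p - 1 - s) * Q + (Q - 1)))) = \<zero>"
proof (induction s arbitrary: a g)
  case 0
  have gc: "g x \<in> carrier K" if "x \<in> pts I" for x using plt_closed[OF 0(3) that] .
  have m: "mono I (\<lambda>i. Q * a i) x = \<one>" if "x \<in> pts I" for x
  proof -
    have "(\<Otimes>i\<in>I. x i [^] (Q * a i)) = (\<Otimes>i\<in>I. \<one>)"
      by (rule finprod_cong') (use 0(2) I in auto)
    thus ?thesis by (simp add: mono_def)
  qed
  have e: "(p - 1 - 0) * Q + (Q - 1) = q - 1"
    using q_minus_1_eq by (simp only: diff_zero)
  have "pairing I f (\<lambda>x. h x \<otimes> (mono I (\<lambda>i. Q * a i) x \<otimes> g x [^] ((p - 1 - 0) * Q + (Q - 1))))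
      = pairing I f (\<lambda>x. h x \<otimes> g x [^] (q - 1))"
    unfolding e by (rule pairing_cong) (use f h gc m in auto)
  thus ?case using base[OF 0(3)] by simp
next
  case (Suc s)
  have gc: "g x \<in> carrier K" if "x \<in> pts I" for x using plt_closed[OF Suc.prems(3) that] .
  define A where "A = p - 1 - s"
  define N where "N = A * Q + (Q - 1)"
  have A: "0 < A" "A < p" "p - 1 - Suc s = A - 1" using Suc.prems p_pos by (auto simp: A_def)
  have NQ: "N - Q = (p - 1 - Suc s) * Q + (Q - 1)" "Q \<le> N"
    using A unfolding N_def A(3) by (cases A; simp)+
  have "N < (A + 1) * Q" using Q_pos by (simp add: N_def)
  also have "(A + 1) * Q \<le> p * Q" by (rule mult_right_mono) (use A in auto)
  finally have Nq: "N < q" using q_eq by simp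
  obtain e where e: "Q = p ^ e" using Q_prime_power by blast
  have nd: "\<not> p dvd (N choose Q)"
    unfolding N_def e by (rule not_dvd_choose_prime_power) (use A prime_p in auto)
  obtain a' l where al: "sum a' I \<le> s" "plt I 2 l"
    "\<And>x. x \<in> pts I \<Longrightarrow> mono I (\<lambda>i. Q * a i) x = mono I (\<lambda>i. Q * a' i) x \<otimes> l x [^] Q"
  proof (cases "sum a I \<le> s")
    case True
    have "plt I 2 (\<lambda>_. \<one>)" using plt_const[of \<one> I "\<lambda>_. \<one>" 1] by (simp add: numeral_2_eq_2)
    thus ?thesis using that[of a "\<lambda>_. \<one>"] True by (simp add: mono_closed)
  next
    case False
    hence "sum a I \<noteq> 0" by simp
    then obtain i where i: "i \<in> I" "a i \<noteq> 0" using I by auto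
    have e: "insert i (I - {i}) = I" using i by auto
    define a' where "a' = a(i := a i - 1)"
    have "sum a' I = a' i + sum a' (I - {i})" using I i by (simp add: sum.remove)
    also have "sum a' (I - {i}) = sum a (I - {i})" by (rule sum.cong) (auto simp: a'_def)
    finally have "sum a' I + 1 = a i + sum a (I - {i})" using i by (simp add: a'_def)
    also have "\<dots> = sum a I" using I i by (simp add: sum.remove)
    finally have s: "sum a' I \<le> s" using Suc.prems by simp
    have m: "mono I (\<lambda>i. Q * a i) x = mono I (\<lambda>i. Q * a' i) x \<otimes> x i [^] Q" if x: "x \<in> pts I" for x
    proof -
      have xj: "x j \<in> carrier K" if "j \<in> I" for j using pts_mem[OF x that] .
      have sp: "mono I b x = x i [^] b i \<otimes> (\<Otimes>j\<in>I-{i}. x j [^] b j)" for b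
        unfolding mono_def using finprod_insert[of "I - {i}" i "\<lambda>j. x j [^] b j"] I xj i
        unfolding e by auto
      have "(\<Otimes>j\<in>I-{i}. x j [^] (Q * a j)) = (\<Otimes>j\<in>I-{i}. x j [^] (Q * a' j))"
        by (rule finprod_cong') (use xj in \<open>auto simp: a'_def\<close>)
      moreover have "Q * a i = Q * a' i + Q" using i by (cases "a i") (auto simp: a'_def)
      moreover have "(\<Otimes>j\<in>I-{i}. x j [^] (Q * a' j)) \<in> carrier K" using xj by (intro finprod_closed) auto
      ultimately show ?thesis unfolding sp using xj[OF i(1)] by (simp add: nat_pow_mult[symmetric] m_ac)
    qed
    show ?thesis using that[OF s plt_var[OF i(1)] m] .
  qed
  have lc: "l x \<in> carrier K" if "x \<in> pts I" for x using plt_closed[OF al(2) that] .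
  let ?h = "\<lambda>x. h x \<otimes> mono I (\<lambda>i. Q * a' i) x"
  have "pairing I f (\<lambda>x. ?h x \<otimes> (l x [^] Q \<otimes> g x [^] (N - Q))) = \<zero>"
  proof (rule pairing_extract)
    fix c assume c: "c \<in> carrier K"
    have pl: "plt I 2 (\<lambda>x. c \<otimes> l x \<oplus> g x)"
      by (rule plt_add[OF plt_smult[OF al(2) c] Suc.prems(3)]) simp
    have "pairing I f (\<lambda>x. ?h x \<otimes> (c \<otimes> l x \<oplus> g x) [^] N)
      = pairing I f (\<lambda>x. h x \<otimes> (mono I (\<lambda>i. Q * a' i) x \<otimes> (c \<otimes> l x \<oplus> g x) [^] N))"
      by (rule pairing_cong) (use f h lc gc c in \<open>auto simp: mono_closed m_assoc\<close>)
    also have "\<dots> = \<zero>" using Suc.IH[OF _ al(1) pl] Suc.prems unfolding N_def A_def by simp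
    finally show "pairing I f (\<lambda>x. ?h x \<otimes> (c \<otimes> l x \<oplus> g x) [^] N) = \<zero>" .
  qed (use I f h lc gc Nq NQ nd in \<open>auto intro!: m_closed mono_closed\<close>)
  moreover have "pairing I f (\<lambda>x. h x \<otimes> (mono I (\<lambda>i. Q * a i) x \<otimes> g x [^] ((p - 1 - Suc s) * Q + (Q - 1))))
     = pairing I f (\<lambda>x. ?h x \<otimes> (l x [^] Q \<otimes> g x [^] (N - Q)))"
    unfolding NQ(1) by (rule pairing_cong) (use f h lc gc in \<open>auto simp: al(3) mono_closed m_assoc\<close>)
  ultimately show ?case by simp
qed

text \<open>
  All moments of \<open>f\<close> of degree at most \<open>|I| (q - 1) - n\<close> have to vanish. A monomial is dealt
  with by writing it as a product of a monomial \<open>b'\<close> of degree at most \<open>(|I| - 1) (q - 1) - n\<close>, at most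
  \<open>p - 1\<close> factors that are \<open>Q\<close>-th powers of variables, and \<open>x\<^sub>i\<^sup>r\<close> with \<open>r < Q\<close> for a single \<open>i\<close>. The
  last two parts are extracted from \<open>g\<^bsup>q - 1\<^esup>\<close>.
\<close>

lemma hyperplane_step:
  assumes I: "finite I" "I \<noteq> {}" and f: "\<And>x. x \<in> pts I \<Longrightarrow> f x \<in> carrier K"
    and HP: "\<And>i l. i \<in> I \<Longrightarrow> plt (I - {i}) 2 l \<Longrightarrow> plt (I - {i}) n (\<lambda>y. f (y(i := l y)))"
    and n: "n \<le> (card I - 1) * (q - Q)"
  shows "plt I n f"
proof (rule plt_of_moments[OF I(1) f])
  fix b assume b: "sum b I + n \<le> card I * (q - 1)"
  have Qq: "Q \<le> q" "Q \<ge> 1" using Q_pos by auto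
  have cI: "card I \<ge> 1" using I by (simp add: Suc_leI card_gt_0_iff)
  have main: "moment I b f = \<zero>"
    if a: "sum a I \<le> p - 1" and i: "i \<in> I" and r: "r < Q"
      and dec: "\<And>j. j \<in> I \<Longrightarrow> b j = b' j + Q * a j + (if j = i then r else 0)"
      and b': "sum b' I + n \<le> (card I - 1) * (q - 1)" for a i r b'
  proof -
    let ?h = "mono I b'"
    have base: "pairing I f (\<lambda>x. ?h x \<otimes> g x [^] (q - 1)) = \<zero>" if "plt I 2 g" for g
      by (rule pairing_hyperplane_power[OF I f HP plt_mono_fun[OF I(1)] b' that])
    have step: "pairing I f (\<lambda>x. ?h x \<otimes> (mono I (\<lambda>i. Q * a i) x \<otimes> g x [^] (Q - 1))) = \<zero>" if "plt I 2 g" for g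
      using pairing_mono_power[OF I(1) f mono_closed base, of "p - 1" a g] a that by simp
    obtain e where e: "Q = p ^ e" using Q_prime_power by blast
    have one: "plt I 2 (\<lambda>_. \<one>)" using plt_const[of \<one> I "\<lambda>_. \<one>" 1] by (simp add: numeral_2_eq_2)
    have xi: "x i \<in> carrier K" if "x \<in> pts I" for x using pts_mem[OF that i] .
    have "pairing I f (\<lambda>x. (?h x \<otimes> mono I (\<lambda>i. Q * a i) x) \<otimes> (x i [^] r \<otimes> \<one> [^] (Q - 1 - r))) = \<zero>"
    proof (rule pairing_extract)
      fix c assume c: "c \<in> carrier K"
      have pl: "plt I 2 (\<lambda>x. c \<otimes> x i \<oplus> \<one>)"
        by (rule plt_add[OF plt_smult[OF plt_var[OF i] c] one]) simp
      have "pairing I f (\<lambda>x. ?h x \<otimes> mono I (\<lambda>i. Q * a i) x \<otimes> (c \<otimes> x i \<oplus> \<one>) [^] (Q - 1))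
        = pairing I f (\<lambda>x. ?h x \<otimes> (mono I (\<lambda>i. Q * a i) x \<otimes> (c \<otimes> x i \<oplus> \<one>) [^] (Q - 1)))"
        by (rule pairing_cong) (use f c xi in \<open>auto simp: mono_closed m_assoc\<close>)
      thus "pairing I f (\<lambda>x. ?h x \<otimes> mono I (\<lambda>i. Q * a i) x \<otimes> (c \<otimes> x i \<oplus> \<one>) [^] (Q - 1)) = \<zero>"
        using step[OF pl] by simp
    next
      show "\<not> p dvd (Q - 1 choose r)" using not_dvd_choose_pred_prime_power[OF prime_p, of r e] r unfolding e by simp
      show "Q - 1 < q" using Qq by linarith
    qed (use I f xi r in \<open>auto intro!: m_closed mono_closed\<close>)
    moreover have "pairing I f (\<lambda>x. (?h x \<otimes> mono I (\<lambda>i. Q * a i) x) \<otimes> (x i [^] r \<otimes> \<one> [^] (Q - 1 - r)))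
       = moment I b f"
      unfolding moment_def pairing_def
    proof (rule finsum_cong')
      fix x assume x: "x \<in> pts I"
      have xj: "x j \<in> carrier K" if "j \<in> I" for j using pts_mem[OF x that] .
      have "mono I b x = (\<Otimes>j\<in>I. (x j [^] b' j \<otimes> x j [^] (Q * a j)) \<otimes> (if i = j then x j [^] r else \<one>))"
        unfolding mono_def by (rule finprod_cong') (use xj in \<open>auto simp: dec nat_pow_mult\<close>)
      also have "\<dots> = (\<Otimes>j\<in>I. x j [^] b' j \<otimes> x j [^] (Q * a j)) \<otimes> (\<Otimes>j\<in>I. if i = j then x j [^] r else \<one>)"
        by (rule finprod_multf) (use xj in auto)
      also have "(\<Otimes>j\<in>I. if i = j then x j [^] r else \<one>) = x i [^] r"
        by (rule finprod_singleton) (use xj I i in auto)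
      also have "(\<Otimes>j\<in>I. x j [^] b' j \<otimes> x j [^] (Q * a j)) = mono I b' x \<otimes> mono I (\<lambda>i. Q * a i) x"
        unfolding mono_def by (rule finprod_multf) (use xj in auto)
      finally show "f x \<otimes> (mono I b' x \<otimes> mono I (\<lambda>i. Q * a i) x \<otimes> (x i [^] r \<otimes> \<one> [^] (Q - 1 - r))) = f x \<otimes> mono I b x"
        using xi[OF x] by simp
    qed (use f in \<open>auto simp: mono_closed\<close>)
    ultimately show ?thesis by simp
  qed
  show "moment I b f = \<zero>"
  proof (cases "(\<Sum>i\<in>I. b i div Q) \<le> p - 1")
    case True
    \<comment> \<open>All \<open>Q\<close>-th powers can be extracted, together with one full exponent; what remains has
      exponents at most \<open>Q - 1\<close> in \<open>|I| - 1\<close> variables. This is where the bound on \<open>n\<close> is needed.\<close>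
    obtain i where i: "i \<in> I" using I by auto
    define b' where "b' j = (if j = i then 0 else b j mod Q)" for j
    have "sum b' I = b' i + sum b' (I - {i})" using I i by (simp add: sum.remove)
    also have "\<dots> \<le> 0 + (\<Sum>j\<in>I - {i}. Q - 1)"
    proof (intro add_mono sum_mono)
      fix j
      have "b j mod Q \<le> Q - 1" using mod_less_divisor[OF Q_pos, of "b j"] by linarith
      thus "b' j \<le> Q - 1" unfolding b'_def by (cases "j = i") simp_all
    qed (simp add: b'_def)
    also have "\<dots> = (card I - 1) * (Q - 1)" using I i by simp
    finally have "sum b' I + n \<le> (card I - 1) * (Q - 1) + (card I - 1) * (q - Q)" using n by simp
    also have "\<dots> = (card I - 1) * (q - 1)" using Qq by (simp add: add_mult_distrib2[symmetric])
    finally have bb: "sum b' I + n \<le> (card I - 1) * (q - 1)" .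
    show ?thesis
      by (rule main[OF True i mod_less_divisor[OF Q_pos, of "b i"] _ bb]) (auto simp: b'_def)
  next
    case False
    \<comment> \<open>There is enough to extract a monomial of degree exactly \<open>(p - 1) Q + (Q - 1) = q - 1\<close>, which is as much as
      the bound on the degree decreases.\<close>
    hence ge: "p - 1 < (\<Sum>i\<in>I. b i div Q)" by simp
    obtain a where a: "\<forall>i\<in>I. a i \<le> b i div Q" "sum a I = p - 1"
      using exists_bounded_with_sum[OF I(1), of "p - 1" "\<lambda>i. b i div Q"] ge by auto
    have "\<not> (\<forall>i\<in>I. b i div Q \<le> a i)" using sum_mono[of I "\<lambda>i. b i div Q" a] a ge by auto
    then obtain i where i: "i \<in> I" "a i < b i div Q" by auto
    define k where "k j = Q * a j + (if j = i then Q - 1 else 0)" for j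
    define b' where "b' j = b j - k j" for j
    have kb: "k j \<le> b j" if "j \<in> I" for j
    proof -
      have bd: "Q * (b j div Q) \<le> b j" by (rule times_div_less_eq_dividend)
      show ?thesis
      proof (cases "j = i")
        case True
        have "Q * (a j + 1) \<le> Q * (b j div Q)" using i True by (intro mult_left_mono) auto
        hence "Q * a j + Q \<le> Q * (b j div Q)" by (simp only: add_mult_distrib2 mult_1_right)
        moreover have "k j = Q * a j + (Q - 1)" using True by (simp add: k_def)
        ultimately show ?thesis using bd by linarith
      next
        case False
        have "Q * a j \<le> Q * (b j div Q)" using a that by (intro mult_left_mono) auto
        moreover have "k j = Q * a j" using False by (simp add: k_def)
        ultimately show ?thesis using bd by linarith
      qed
    qed
    have "sum k I = (\<Sum>j\<in>I. Q * a j) + (\<Sum>j\<in>I. if j = i then Q - 1 else 0)"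
      unfolding k_def by (rule sum.distrib)
    also have "(\<Sum>j\<in>I. if j = i then Q - 1 else 0) = Q - 1" using I(1) i(1) by simp
    also have "(\<Sum>j\<in>I. Q * a j) = (p - 1) * Q"
      unfolding sum_distrib_left[symmetric] a(2) by (rule mult.commute)
    finally have "sum k I = (p - 1) * Q + (Q - 1)" .
    hence sk: "sum k I = q - 1" using q_minus_1_eq by (rule trans)
    have "sum b I = sum b' I + sum k I"
      unfolding sum.distrib[symmetric] by (rule sum.cong) (use kb in \<open>auto simp: b'_def\<close>)
    hence sb: "sum b I = sum b' I + (q - 1)" using sk by simp
    have "card I * (q - 1) = (card I - 1) * (q - 1) + (q - 1)" using cI by (cases "card I") auto
    hence bb: "sum b' I + n \<le> (card I - 1) * (q - 1)" using b sb by linarith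
    show ?thesis
    proof (rule main[OF _ i(1) _ _ bb, of a "Q - 1"])
      fix j assume "j \<in> I"
      thus "b j = b' j + Q * a j + (if j = i then Q - 1 else 0)" using kb[of j] by (simp add: b'_def k_def)
    qed (use a Q_pos in auto)
  qed
qed

section \<open>Restrictions to affine subspaces\<close>

definition amap :: "'j set \<Rightarrow> 'i set \<Rightarrow> (('j \<Rightarrow> 'a) \<Rightarrow> 'i \<Rightarrow> 'a) \<Rightarrow> bool" where
  "amap J I \<phi> \<longleftrightarrow> (\<forall>x\<in>pts J. \<phi> x \<in> pts I) \<and> (\<forall>i\<in>I. plt J 2 (\<lambda>x. \<phi> x i))"

lemma amap_pts: "amap J I \<phi> \<Longrightarrow> x \<in> pts J \<Longrightarrow> \<phi> x \<in> pts I" by (simp add: amap_def)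

lemma plt_amap: "plt I n f \<Longrightarrow> amap J I \<phi> \<Longrightarrow> plt J n (\<lambda>x. f (\<phi> x))"
  by (rule plt_comp) (auto simp: amap_def)

lemma amap_comp: "amap T J \<eta> \<Longrightarrow> amap J I \<phi> \<Longrightarrow> amap T I (\<lambda>x. \<phi> (\<eta> x))"
  unfolding amap_def[of T I] amap_def[of J I] using plt_amap[of J 2 _ T \<eta>] amap_pts[of T J \<eta>] by blast

lemma amap_id: "amap I I (\<lambda>x. x)" by (auto simp: amap_def plt_var)

text \<open>
  Affine subspaces are given by injective affine parametrisations. Hyperplanes are parametrised as
  graphs \<open>y(i := u y)\<close>, so that the induction on the dimension stays within index sets
  contained in \<open>I\<close>.
\<close>

lemma plt_of_subspace_restrictions:
  assumes "finite I" "\<And>x. x \<in> pts I \<Longrightarrow> f x \<in> carrier K" "T \<le> card I" "1 \<le> T" "n \<le> T * (q - Q)"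
    and "\<And>J \<phi>. J \<subseteq> I \<Longrightarrow> card J = T \<Longrightarrow> amap J I \<phi> \<Longrightarrow> inj_on \<phi> (pts J) \<Longrightarrow> plt J n (\<lambda>x. f (\<phi> x))"
  shows "plt I n f"
  using assms(1,2,3,6)
proof (induction "card I - T" arbitrary: I f)
  case 0
  show ?case using 0(5)[of I "\<lambda>x. x"] 0(1,4) by (simp add: amap_id)
next
  case (Suc k)
  have cI: "card I \<ge> 1" using Suc.hyps by linarith
  show ?case
  proof (rule hyperplane_step)
    show "I \<noteq> {}" using cI by auto
    have "T \<le> card I - 1" using Suc.hyps by linarith
    thus "n \<le> (card I - 1) * (q - Q)" using assms(5) by (meson le_trans mult_le_mono1)
  next
    fix i l assume i: "i \<in> I" and l: "plt (I - {i}) 2 l"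
    have up: "y(i := c) \<in> pts I" if "y \<in> pts (I - {i})" "c \<in> carrier K" for y c
      using that i by (auto simp: PiE_def extensional_def Pi_def)
    have am: "amap (I - {i}) I (\<lambda>y. y(i := l y))"
      unfolding amap_def using up plt_closed[OF l] plt_fun_upd[OF plt_var i l] by auto
    have inj: "inj_on (\<lambda>y. y(i := l y)) (pts (I - {i}))"
    proof (rule inj_onI)
      fix x y assume xy: "x \<in> pts (I - {i})" "y \<in> pts (I - {i})" and e: "x(i := l x) = y(i := l y)"
      show "x = y"
      proof (rule PiE_ext[OF xy])
        fix j assume "j \<in> I - {i}" thus "x j = y j" using fun_cong[OF e, of j] by auto
      qed
    qed
    show "plt (I - {i}) n (\<lambda>y. f (y(i := l y)))"
    proof (rule Suc.hyps(1))
      show "k = card (I - {i}) - T" "T \<le> card (I - {i})" using Suc.hyps(2) Suc.prems(1) i by auto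
      show "f (y(i := l y)) \<in> carrier K" if "y \<in> pts (I - {i})" for y
        using Suc.prems(2) amap_pts[OF am that] by simp
      fix J \<phi> assume J: "J \<subseteq> I - {i}" "card J = T" "amap J (I - {i}) \<phi>" "inj_on \<phi> (pts J)"
      show "plt J n (\<lambda>x. f ((\<phi> x)(i := l (\<phi> x))))"
      proof (rule Suc.prems(4))
        show "amap J I (\<lambda>x. (\<phi> x)(i := l (\<phi> x)))" by (rule amap_comp[OF J(3) am])
        show "inj_on (\<lambda>x. (\<phi> x)(i := l (\<phi> x))) (pts J)"
          using comp_inj_on[OF J(4) inj_on_subset[OF inj]] amap_pts[OF J(3)] by (auto simp: o_def)
      qed (use J in auto)
    qed (use Suc.prems in auto)
  qed (use Suc.prems in auto)
qed

text \<open>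
  Functions of degree at most \<open>1\<close> respect affine combinations.
\<close>

lemma plt_2_affine_comb:
  assumes "finite J" "finite T" "plt J n g" "n \<le> 2" "y0 \<in> pts J" "\<And>t. t \<in> T \<Longrightarrow> y t \<in> pts J"
    and "\<And>t. t \<in> T \<Longrightarrow> x t \<in> carrier K" "z \<in> pts J"
    and "\<And>j. j \<in> J \<Longrightarrow> z j = y0 j \<oplus> (\<Oplus>t\<in>T. x t \<otimes> (y t j \<ominus> y0 j))"
  shows "g z = g y0 \<oplus> (\<Oplus>t\<in>T. x t \<otimes> (g (y t) \<ominus> g y0))"
  using assms(3,4)
proof (induction rule: plt.induct)
  case (plt_zero f n)
  have "(\<Oplus>t\<in>T. x t \<otimes> (f (y t) \<ominus> f y0)) = (\<Oplus>t\<in>T. \<zero>)"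
    by (rule finsum_cong') (use plt_zero assms in \<open>auto simp: minus_eq\<close>)
  thus ?case using plt_zero assms by simp
next
  case (plt_const c f n)
  have "(\<Oplus>t\<in>T. x t \<otimes> (f (y t) \<ominus> f y0)) = (\<Oplus>t\<in>T. \<zero>)"
    by (rule finsum_cong') (use plt_const assms in \<open>auto simp: minus_eq r_neg\<close>)
  thus ?case using plt_const assms by simp
next
  case (plt_add n f g h)
  have c: "f w \<in> carrier K" "g w \<in> carrier K" if "w \<in> pts J" for w
    using plt_closed[OF plt_add.hyps(1) that] plt_closed[OF plt_add.hyps(2) that] .
  have "(\<Oplus>t\<in>T. x t \<otimes> (h (y t) \<ominus> h y0)) = (\<Oplus>t\<in>T. x t \<otimes> (f (y t) \<ominus> f y0) \<oplus> x t \<otimes> (g (y t) \<ominus> g y0))"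
  proof (rule finsum_cong')
    fix t assume t: "t \<in> T"
    have "a \<otimes> ((b \<oplus> b') \<ominus> (d \<oplus> d')) = a \<otimes> (b \<ominus> d) \<oplus> a \<otimes> (b' \<ominus> d')"
      if "a \<in> carrier K" "b \<in> carrier K" "b' \<in> carrier K" "d \<in> carrier K" "d' \<in> carrier K" for a b b' d d'
      using that by algebra
    thus "x t \<otimes> (h (y t) \<ominus> h y0) = x t \<otimes> (f (y t) \<ominus> f y0) \<oplus> x t \<otimes> (g (y t) \<ominus> g y0)"
      using plt_add.hyps(3) assms t c by simp
  qed (use c assms in auto)
  also have "\<dots> = (\<Oplus>t\<in>T. x t \<otimes> (f (y t) \<ominus> f y0)) \<oplus> (\<Oplus>t\<in>T. x t \<otimes> (g (y t) \<ominus> g y0))"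
    by (rule finsum_addf) (use c assms in auto)
  finally have e: "(\<Oplus>t\<in>T. x t \<otimes> (h (y t) \<ominus> h y0)) = (\<Oplus>t\<in>T. x t \<otimes> (f (y t) \<ominus> f y0)) \<oplus> (\<Oplus>t\<in>T. x t \<otimes> (g (y t) \<ominus> g y0))" .
  have "(\<Oplus>t\<in>T. x t \<otimes> (f (y t) \<ominus> f y0)) \<in> carrier K" "(\<Oplus>t\<in>T. x t \<otimes> (g (y t) \<ominus> g y0)) \<in> carrier K"
    using c assms by (auto intro!: finsum_closed)
  hence "(f y0 \<oplus> g y0) \<oplus> ((\<Oplus>t\<in>T. x t \<otimes> (f (y t) \<ominus> f y0)) \<oplus> (\<Oplus>t\<in>T. x t \<otimes> (g (y t) \<ominus> g y0))) = h z"
    unfolding plt_add.hyps(3)[OF assms(8)] plt_add.IH(1)[OF plt_add.prems] plt_add.IH(2)[OF plt_add.prems]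
    using c[OF assms(5)] by (simp add: a_ac)
  thus ?case by (subst e) (simp only: plt_add.hyps(3)[OF assms(5)])
next
  case (plt_var_mult n f i h)
  obtain c where c: "c \<in> carrier K" "\<forall>x\<in>pts J. f x = c" using plt_1D[OF plt_var_mult.hyps(1)] plt_var_mult.prems by auto
  have h: "h w = c \<otimes> w i" if "w \<in> pts J" for w
    using plt_var_mult.hyps(3)[OF that] c that pts_mem[OF that plt_var_mult.hyps(2)] by (simp add: m_comm)
  have yi: "y0 i \<in> carrier K" "\<And>t. t \<in> T \<Longrightarrow> y t i \<in> carrier K"
    using pts_mem[OF assms(5) plt_var_mult.hyps(2)] pts_mem[OF assms(6) plt_var_mult.hyps(2)] .
  have "(\<Oplus>t\<in>T. x t \<otimes> (h (y t) \<ominus> h y0)) = (\<Oplus>t\<in>T. c \<otimes> (x t \<otimes> (y t i \<ominus> y0 i)))"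
  proof (rule finsum_cong')
    fix t assume t: "t \<in> T"
    have "a \<otimes> (c \<otimes> b \<ominus> c \<otimes> d) = c \<otimes> (a \<otimes> (b \<ominus> d))" if "a \<in> carrier K" "b \<in> carrier K" "d \<in> carrier K" for a b d
      using that c by algebra
    thus "x t \<otimes> (h (y t) \<ominus> h y0) = c \<otimes> (x t \<otimes> (y t i \<ominus> y0 i))"
      using h assms t yi by simp
  qed (use c assms yi in auto)
  also have "\<dots> = c \<otimes> (\<Oplus>t\<in>T. x t \<otimes> (y t i \<ominus> y0 i))"
    by (rule finsum_rdistr[symmetric]) (use c assms yi in auto)
  finally have e: "(\<Oplus>t\<in>T. x t \<otimes> (h (y t) \<ominus> h y0)) = c \<otimes> (\<Oplus>t\<in>T. x t \<otimes> (y t i \<ominus> y0 i))" .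
  have "(\<Oplus>t\<in>T. x t \<otimes> (y t i \<ominus> y0 i)) \<in> carrier K" using yi assms by (auto intro!: finsum_closed)
  hence "c \<otimes> y0 i \<oplus> c \<otimes> (\<Oplus>t\<in>T. x t \<otimes> (y t i \<ominus> y0 i)) = h z"
    unfolding h[OF assms(8)] assms(9)[OF plt_var_mult.hyps(2)] using c yi by (simp add: r_distr)
  thus ?case by (subst e) (simp only: h[OF assms(5)])
qed

definition origin :: "'i set \<Rightarrow> 'i \<Rightarrow> 'a" where "origin I = (\<lambda>i\<in>I. \<zero>)"
definition unitpt :: "'i set \<Rightarrow> 'i \<Rightarrow> 'i \<Rightarrow> 'a" where "unitpt I t = (\<lambda>i\<in>I. if i = t then \<one> else \<zero>)"

lemma origin_pts [simp]: "origin I \<in> pts I" by (auto simp: origin_def)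
lemma unitpt_pts [simp]: "unitpt I t \<in> pts I" by (auto simp: unitpt_def)

lemma plt_2_expand:
  assumes "finite T" "plt T 2 g" "x \<in> pts T"
  shows "g x = g (origin T) \<oplus> (\<Oplus>t\<in>T. x t \<otimes> (g (unitpt T t) \<ominus> g (origin T)))"
proof (rule plt_2_affine_comb[OF assms(1,1,2)])
  fix j assume j: "j \<in> T"
  have "(\<Oplus>t\<in>T. x t \<otimes> (unitpt T t j \<ominus> origin T j)) = (\<Oplus>t\<in>T. if j = t then x t else \<zero>)"
    by (rule finsum_cong') (use j pts_mem[OF assms(3)] in \<open>auto simp: unitpt_def origin_def minus_eq\<close>)
  also have "\<dots> = x j" using finsum_singleton[of j T x] j assms(1) pts_mem[OF assms(3)] by auto
  finally show "x j = origin T j \<oplus> (\<Oplus>t\<in>T. x t \<otimes> (unitpt T t j \<ominus> origin T j))"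
    using j pts_mem[OF assms(3) j] by (simp add: origin_def)
qed (use pts_mem[OF assms(3)] assms in auto)

text \<open>
  An affine map with values in the image of an injective affine map \<open>\<psi>\<close> lifts to an affine map: lift the values at the
  origin and the unit points, and extend affinely. This makes degrees on an affine subspace
  independent of its parametrisation.
\<close>

lemma amap_factor:
  assumes "finite J" "finite T" "amap J B \<psi>" "inj_on \<psi> (pts J)" "amap T B \<chi>" "\<chi> ` pts T \<subseteq> \<psi> ` pts J"
  shows "\<exists>\<eta>. amap T J \<eta> \<and> (\<forall>x\<in>pts T. \<psi> (\<eta> x) = \<chi> x)"
proof -
  define \<gamma> where "\<gamma> x = inv_into (pts J) \<psi> (\<chi> x)" for x
  have \<gamma>: "\<gamma> x \<in> pts J" "\<psi> (\<gamma> x) = \<chi> x" if "x \<in> pts T" for x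
    using assms(6) that unfolding \<gamma>_def by (auto simp: inv_into_into f_inv_into_f image_subset_iff)
  let ?o = "origin T" and ?u = "unitpt T"
  define \<eta> where "\<eta> x = (\<lambda>k\<in>J. \<gamma> ?o k \<oplus> (\<Oplus>t\<in>T. (\<gamma> (?u t) k \<ominus> \<gamma> ?o k) \<otimes> x t))" for x
  have gk: "\<gamma> ?o k \<in> carrier K" "\<gamma> (?u t) k \<in> carrier K" if "k \<in> J" for k t
    using pts_mem[OF \<gamma>(1)[OF origin_pts] that] pts_mem[OF \<gamma>(1)[OF unitpt_pts] that] .
  have pk: "plt T 2 (\<lambda>x. \<gamma> ?o k \<oplus> (\<Oplus>t\<in>T. (\<gamma> (?u t) k \<ominus> \<gamma> ?o k) \<otimes> x t))" if "k \<in> J" for k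
    by (rule plt_affine) (use assms gk[OF that] in \<open>auto simp: plt_var\<close>)
  have am: "amap T J \<eta>"
    unfolding amap_def
  proof (intro conjI ballI)
    fix x assume "x \<in> pts T"
    thus "\<eta> x \<in> pts J" using plt_closed[OF pk] by (auto simp: \<eta>_def)
  next
    fix k assume k: "k \<in> J" show "plt T 2 (\<lambda>x. \<eta> x k)" using pk[OF k] k by (simp add: \<eta>_def)
  qed
  have "\<psi> (\<eta> x) = \<chi> x" if x: "x \<in> pts T" for x
  proof (rule PiE_ext)
    show "\<psi> (\<eta> x) \<in> pts B" "\<chi> x \<in> pts B" using assms am x by (auto simp: amap_def)
    fix b assume b: "b \<in> B"
    have pb: "plt J 2 (\<lambda>y. \<psi> y b)" and cb: "plt T 2 (\<lambda>x. \<chi> x b)" using assms b by (auto simp: amap_def)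
    have "\<psi> (\<eta> x) b = \<psi> (\<gamma> ?o) b \<oplus> (\<Oplus>t\<in>T. x t \<otimes> (\<psi> (\<gamma> (?u t)) b \<ominus> \<psi> (\<gamma> ?o) b))"
    proof (rule plt_2_affine_comb[OF assms(1,2) pb])
      fix k assume k: "k \<in> J"
      have "(\<Oplus>t\<in>T. (\<gamma> (?u t) k \<ominus> \<gamma> ?o k) \<otimes> x t) = (\<Oplus>t\<in>T. x t \<otimes> (\<gamma> (?u t) k \<ominus> \<gamma> ?o k))"
        by (rule finsum_cong') (use gk[OF k] pts_mem[OF x] in \<open>auto simp: m_comm\<close>)
      thus "\<eta> x k = \<gamma> ?o k \<oplus> (\<Oplus>t\<in>T. x t \<otimes> (\<gamma> (?u t) k \<ominus> \<gamma> ?o k))" using k by (simp add: \<eta>_def)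
    qed (use \<gamma> pts_mem[OF x] amap_pts[OF am x] in auto)
    also have "\<dots> = \<chi> x b" using plt_2_expand[OF assms(2) cb x] \<gamma>(2) by simp
    finally show "\<psi> (\<eta> x) b = \<chi> x b" .
  qed
  thus ?thesis using am by blast
qed

section \<open>Formal polynomials and polynomial functions\<close>

lemma mpoly_support:
  assumes "P \<in> mpolys K B"
  shows "finite {\<mu>. P \<mu> \<noteq> \<zero>}" "P \<mu> \<noteq> \<zero> \<Longrightarrow> set_mset \<mu> \<subseteq> B" "P \<mu> \<in> carrier K"
proof -
  have "finite {\<mu>. P \<mu> \<noteq> \<zero>} \<and> (\<forall>\<mu>. P \<mu> \<noteq> \<zero> \<longrightarrow> set_mset \<mu> \<subseteq> B) \<and> (\<forall>\<mu>. P \<mu> \<in> carrier K)"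
    using assms
  proof (induction rule: indexed_pset.induct)
    case (indexed_const k)
    have "{\<mu>. indexed_const k \<mu> \<noteq> \<zero>} \<subseteq> {{#}}" by (auto simp: indexed_const_def)
    thus ?case using indexed_const by (auto simp: indexed_const_def intro: finite_subset)
  next
    case (indexed_padd P Q)
    have "{\<mu>. indexed_padd P Q \<mu> \<noteq> \<zero>} \<subseteq> {\<mu>. P \<mu> \<noteq> \<zero>} \<union> {\<mu>. Q \<mu> \<noteq> \<zero>}"
      by (auto simp: indexed_padd_def)
    moreover from this have "\<forall>\<mu>. indexed_padd P Q \<mu> \<noteq> \<zero> \<longrightarrow> set_mset \<mu> \<subseteq> B" using indexed_padd.IH by blast
    ultimately show ?case using indexed_padd.IH by (auto simp: indexed_padd_def intro: finite_subset)
  next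
    case (indexed_pmult P i)
    have s: "{\<mu>. indexed_pmult P i \<mu> \<noteq> \<zero>} \<subseteq> add_mset i ` {\<mu>. P \<mu> \<noteq> \<zero>}"
    proof
      fix \<mu> assume "\<mu> \<in> {\<mu>. indexed_pmult P i \<mu> \<noteq> \<zero>}"
      hence "i \<in># \<mu>" "P (\<mu> - {#i#}) \<noteq> \<zero>" by (auto simp: indexed_pmult_def split: if_splits)
      thus "\<mu> \<in> add_mset i ` {\<mu>. P \<mu> \<noteq> \<zero>}" by (intro image_eqI[of _ _ "\<mu> - {#i#}"]) auto
    qed
    hence "\<forall>\<mu>. indexed_pmult P i \<mu> \<noteq> \<zero> \<longrightarrow> set_mset \<mu> \<subseteq> B" using indexed_pmult by fastforce
    moreover have "finite {\<mu>. indexed_pmult P i \<mu> \<noteq> \<zero>}" using finite_subset[OF s] indexed_pmult.IH by simp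
    ultimately show ?case using indexed_pmult.IH by (auto simp: indexed_pmult_def)
  qed
  thus "finite {\<mu>. P \<mu> \<noteq> \<zero>}" "P \<mu> \<noteq> \<zero> \<Longrightarrow> set_mset \<mu> \<subseteq> B" "P \<mu> \<in> carrier K" by auto
qed

lemma mpoly_eval_restrict:
  assumes "P \<in> mpolys K S" "c \<in> S \<rightarrow> carrier K"
  shows "mpoly_eval K P (restrict c S) = mpoly_eval K P c"
  unfolding mpoly_eval_def
proof (rule finsum_cong')
  fix \<mu> assume "\<mu> \<in> {\<mu>. P \<mu> \<noteq> \<zero>}"
  hence sub: "set_mset \<mu> \<subseteq> S" using mpoly_support[OF assms(1)] by simp
  have "(\<Otimes>i\<in>set_mset \<mu>. restrict c S i [^] count \<mu> i) = (\<Otimes>i\<in>set_mset \<mu>. c i [^] count \<mu> i)"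
    by (rule finprod_cong') (use sub assms(2) in \<open>auto simp: Pi_def subset_iff\<close>)
  thus "P \<mu> \<otimes> (\<Otimes>i\<in>set_mset \<mu>. restrict c S i [^] count \<mu> i) = P \<mu> \<otimes> (\<Otimes>i\<in>set_mset \<mu>. c i [^] count \<mu> i)" by simp
next
  show "(\<lambda>\<mu>. P \<mu> \<otimes> (\<Otimes>i\<in>set_mset \<mu>. c i [^] count \<mu> i)) \<in> {\<mu>. P \<mu> \<noteq> \<zero>} \<rightarrow> carrier K"
  proof
    fix \<mu> assume "\<mu> \<in> {\<mu>. P \<mu> \<noteq> \<zero>}"
    hence sub: "set_mset \<mu> \<subseteq> S" using mpoly_support[OF assms(1)] by simp
    show "P \<mu> \<otimes> (\<Otimes>i\<in>set_mset \<mu>. c i [^] count \<mu> i) \<in> carrier K"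
      by (intro m_closed mpoly_support(3)[OF assms(1)] finprod_closed) (use sub assms(2) in \<open>auto simp: Pi_def subset_iff\<close>)
  qed
qed simp

lemma mpoly_eval_mono:
  assumes "finite B" "P \<in> mpolys K B" "c \<in> pts B" "finite S" "{\<mu>. P \<mu> \<noteq> \<zero>} \<subseteq> S"
  shows "mpoly_eval K P c = (\<Oplus>\<mu>\<in>S. P \<mu> \<otimes> mono B (count \<mu>) c)"
  unfolding mpoly_eval_def
proof (rule add.finprod_mono_neutral_cong_left)
  fix \<mu> assume m: "\<mu> \<in> {\<mu>. P \<mu> \<noteq> \<zero>}"
  hence sub: "set_mset \<mu> \<subseteq> B" using mpoly_support[OF assms(2)] by simp
  have cc: "c i \<in> carrier K" if "i \<in> B" for i using pts_mem[OF assms(3) that] .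
  have "(\<Otimes>i\<in>set_mset \<mu>. c i [^] count \<mu> i) = mono B (count \<mu>) c"
    unfolding mono_def
    by (rule finprod_mono_neutral_cong_left) (use sub cc assms in \<open>auto simp: not_in_iff\<close>)
  thus "P \<mu> \<otimes> (\<Otimes>i\<in>set_mset \<mu>. c i [^] count \<mu> i) = P \<mu> \<otimes> mono B (count \<mu>) c" by simp
qed (use assms mpoly_support[OF assms(2)] in \<open>auto simp: mono_closed\<close>)

lemma plt_mpoly_eval:
  assumes "finite B" "P \<in> mpolys K B" "\<And>\<mu>. P \<mu> \<noteq> \<zero> \<Longrightarrow> size \<mu> < n"
  shows "plt B n (mpoly_eval K P)"
proof (rule plt_cong)
  show "plt B n (\<lambda>c. \<Oplus>\<mu>\<in>{\<mu>. P \<mu> \<noteq> \<zero>}. P \<mu> \<otimes> mono B (count \<mu>) c)"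
  proof (rule plt_sum)
    fix \<mu> assume m: "\<mu> \<in> {\<mu>. P \<mu> \<noteq> \<zero>}"
    have sub: "set_mset \<mu> \<subseteq> B" using mpoly_support[OF assms(2)] m by simp
    have "sum (count \<mu>) B = size \<mu>"
      unfolding size_multiset_overloaded_eq
      by (rule sum.mono_neutral_right) (use sub assms in \<open>auto simp: not_in_iff\<close>)
    hence "Suc (sum (count \<mu>) B) \<le> n" using assms(3)[of \<mu>] m by (simp add: Suc_leI)
    thus "plt B n (\<lambda>c. P \<mu> \<otimes> mono B (count \<mu>) c)"
      by (intro plt_smult plt_mono[OF plt_mono_fun[OF assms(1)]] mpoly_support[OF assms(2)])
  qed (rule mpoly_support[OF assms(2)])
qed (rule mpoly_eval_mono[OF assms(1,2)], use mpoly_support[OF assms(2)] in auto)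

lemma mpoly_of_plt:
  assumes "finite B" "plt B n f"
  shows "\<exists>P\<in>mpolys K B. (\<forall>\<mu>. P \<mu> \<noteq> \<zero> \<longrightarrow> size \<mu> < n) \<and> (\<forall>c\<in>pts B. f c = mpoly_eval K P c)"
  using assms(2)
proof (induction rule: plt.induct)
  case (plt_zero f n)
  thus ?case using indexed_pset.indexed_const[of \<zero> "carrier K" B]
    by (intro bexI[of _ "indexed_const \<zero>"]) (auto simp: mpoly_eval_def indexed_zero_def)
next
  case (plt_const a f n)
  have P: "indexed_const a \<in> mpolys K B" using indexed_pset.indexed_const[of a "carrier K" B] plt_const by auto
  have "mpoly_eval K (indexed_const a) c = a" if c: "c \<in> pts B" for c
  proof -
    have "mpoly_eval K (indexed_const a) c = (\<Oplus>\<mu>\<in>{{#}}. indexed_const a \<mu> \<otimes> mono B (count \<mu>) c)"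
      by (rule mpoly_eval_mono[OF assms(1) P c]) (auto simp: indexed_const_def)
    thus ?thesis using plt_const by (simp add: indexed_const_def mono_def)
  qed
  thus ?case using P plt_const by (intro bexI[OF _ P]) (auto simp: indexed_const_def)
next
  case (plt_add n f g h)
  obtain P where P: "P \<in> mpolys K B" "\<And>\<mu>. P \<mu> \<noteq> \<zero> \<Longrightarrow> size \<mu> < n" "\<And>c. c \<in> pts B \<Longrightarrow> f c = mpoly_eval K P c"
    using plt_add.IH by blast
  obtain Q where Q: "Q \<in> mpolys K B" "\<And>\<mu>. Q \<mu> \<noteq> \<zero> \<Longrightarrow> size \<mu> < n" "\<And>c. c \<in> pts B \<Longrightarrow> g c = mpoly_eval K Q c"
    using plt_add.IH by blast
  have R: "indexed_padd P Q \<in> mpolys K B" using P Q by (auto intro: indexed_pset.intros)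
  have sup: "{\<mu>. indexed_padd P Q \<mu> \<noteq> \<zero>} \<subseteq> {\<mu>. P \<mu> \<noteq> \<zero>} \<union> {\<mu>. Q \<mu> \<noteq> \<zero>}"
    by (auto simp: indexed_padd_def)
  let ?S = "{\<mu>. P \<mu> \<noteq> \<zero>} \<union> {\<mu>. Q \<mu> \<noteq> \<zero>}"
  have fS: "finite ?S" using mpoly_support P Q by blast
  have "h c = mpoly_eval K (indexed_padd P Q) c" if c: "c \<in> pts B" for c
  proof -
    have "h c = mpoly_eval K P c \<oplus> mpoly_eval K Q c" using plt_add.hyps(3)[OF c] P(3)[OF c] Q(3)[OF c] by simp
    also have "\<dots> = (\<Oplus>\<mu>\<in>?S. P \<mu> \<otimes> mono B (count \<mu>) c) \<oplus> (\<Oplus>\<mu>\<in>?S. Q \<mu> \<otimes> mono B (count \<mu>) c)"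
      using mpoly_eval_mono[OF assms(1) P(1) c fS] mpoly_eval_mono[OF assms(1) Q(1) c fS] by simp
    also have "\<dots> = (\<Oplus>\<mu>\<in>?S. P \<mu> \<otimes> mono B (count \<mu>) c \<oplus> Q \<mu> \<otimes> mono B (count \<mu>) c)"
      by (rule finsum_addf[symmetric]) (use mpoly_support(3)[OF P(1)] mpoly_support(3)[OF Q(1)] mono_closed[OF c] in auto)
    also have "\<dots> = (\<Oplus>\<mu>\<in>?S. indexed_padd P Q \<mu> \<otimes> mono B (count \<mu>) c)"
      by (rule finsum_cong') (use mpoly_support(3)[OF P(1)] mpoly_support(3)[OF Q(1)] mono_closed[OF c] in \<open>auto simp: indexed_padd_def l_distr\<close>)
    also have "\<dots> = mpoly_eval K (indexed_padd P Q) c"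
      by (rule mpoly_eval_mono[OF assms(1) R c fS sup, symmetric])
    finally show ?thesis .
  qed
  moreover have "size \<mu> < n" if "indexed_padd P Q \<mu> \<noteq> \<zero>" for \<mu> using sup that P(2) Q(2) by blast
  ultimately show ?case using R by blast
next
  case (plt_var_mult n f i h)
  obtain P where P: "P \<in> mpolys K B" "\<And>\<mu>. P \<mu> \<noteq> \<zero> \<Longrightarrow> size \<mu> < n" "\<And>c. c \<in> pts B \<Longrightarrow> f c = mpoly_eval K P c"
    using plt_var_mult.IH by blast
  have R: "indexed_pmult P i \<in> mpolys K B" using P plt_var_mult.hyps by (auto intro: indexed_pset.intros)
  let ?S = "{\<mu>. P \<mu> \<noteq> \<zero>}"
  have sup: "{\<mu>. indexed_pmult P i \<mu> \<noteq> \<zero>} \<subseteq> add_mset i ` ?S"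
  proof
    fix \<mu> assume "\<mu> \<in> {\<mu>. indexed_pmult P i \<mu> \<noteq> \<zero>}"
    hence "i \<in># \<mu>" "P (\<mu> - {#i#}) \<noteq> \<zero>" by (auto simp: indexed_pmult_def split: if_splits)
    thus "\<mu> \<in> add_mset i ` {\<mu>. P \<mu> \<noteq> \<zero>}" by (intro image_eqI[of _ _ "\<mu> - {#i#}"]) auto
  qed
  have fS: "finite ?S" using mpoly_support P by blast
  have cl: "indexed_pmult P i \<mu> \<in> carrier K" for \<mu> using mpoly_support(3)[OF R] .
  have "h c = mpoly_eval K (indexed_pmult P i) c" if c: "c \<in> pts B" for c
  proof -
    have ci: "c i \<in> carrier K" using pts_mem[OF c plt_var_mult.hyps(2)] .
    have mm: "mono B (count (add_mset i \<mu>)) c = c i \<otimes> mono B (count \<mu>) c" for \<mu>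
    proof -
      have "count (add_mset i \<mu>) = (count \<mu>)(i := Suc (count \<mu> i))" by (auto simp: fun_eq_iff)
      thus ?thesis using mono_Suc[OF assms(1) plt_var_mult.hyps(2) c, of "count \<mu>"] by simp
    qed
    have "mpoly_eval K (indexed_pmult P i) c = (\<Oplus>\<mu>\<in>add_mset i ` ?S. indexed_pmult P i \<mu> \<otimes> mono B (count \<mu>) c)"
      by (rule mpoly_eval_mono[OF assms(1) R c _ sup]) (use fS in auto)
    also have "\<dots> = (\<Oplus>\<mu>\<in>?S. indexed_pmult P i (add_mset i \<mu>) \<otimes> mono B (count (add_mset i \<mu>)) c)"
      by (rule finsum_reindex) (auto simp: inj_on_def intro!: m_closed cl mono_closed[OF c])
    also have "\<dots> = (\<Oplus>\<mu>\<in>?S. c i \<otimes> (P \<mu> \<otimes> mono B (count \<mu>) c))"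
      by (rule finsum_cong')
         (use ci mpoly_support(3)[OF P(1)] mono_closed[OF c] in \<open>auto simp: mm indexed_pmult_def m_lcomm\<close>)
    also have "\<dots> = c i \<otimes> (\<Oplus>\<mu>\<in>?S. P \<mu> \<otimes> mono B (count \<mu>) c)"
      by (rule finsum_rdistr[symmetric]) (use ci fS mpoly_support(3)[OF P(1)] mono_closed[OF c] in auto)
    also have "\<dots> = h c"
      using plt_var_mult.hyps(3)[OF c] P(3)[OF c] mpoly_eval_mono[OF assms(1) P(1) c fS] by simp
    finally show ?thesis by simp
  qed
  moreover have "size \<mu> < Suc n" if "indexed_pmult P i \<mu> \<noteq> \<zero>" for \<mu> using sup that P(2) by fastforce
  ultimately show ?case using R by blast
qed

end

section \<open>Affine subspaces in coordinates\<close>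

locale coord_space = vectorspace K V + galois_field K
  for K (structure) and V :: "('a, 'v, 'm) module_scheme" +
  fixes B :: "'v set"
  assumes finite_B: "finite B" and basis_B: "basis B"
begin

abbreviation \<Phi> :: "('v \<Rightarrow> 'a) \<Rightarrow> 'v" where "\<Phi> c \<equiv> lincomb c B"

definition coord :: "'v \<Rightarrow> 'v \<Rightarrow> 'a" where "coord v = inv_into (pts B) \<Phi> v"

lemma B_sub: "B \<subseteq> carrier V" using basis_B by (simp add: basis_def)

lemma bij_basis:
  assumes "finite S" "basis S" shows "bij_betw (\<lambda>c. lincomb c S) (pts S) (carrier V)"
proof -
  have S: "S \<subseteq> carrier V" using assms by (simp add: basis_def)
  have ex1: "\<exists>!a. a \<in> pts S \<and> lincomb a S = v" if "v \<in> carrier V" for v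
    using basis_criterion[OF assms(1) S] assms(2) that by blast
  have cl: "lincomb c S \<in> carrier V" if "c \<in> pts S" for c using that S by (intro lincomb_closed) (auto simp: PiE_def)
  show ?thesis
    unfolding bij_betw_def
  proof
    show "inj_on (\<lambda>c. lincomb c S) (pts S)"
    proof (rule inj_onI)
      fix x y assume xy: "x \<in> pts S" "y \<in> pts S" and e: "lincomb x S = lincomb y S"
      show "x = y" using ex1[OF cl[OF xy(1)]] xy e by metis
    qed
    show "(\<lambda>c. lincomb c S) ` pts S = carrier V"
    proof
      show "carrier V \<subseteq> (\<lambda>c. lincomb c S) ` pts S"
      proof
        fix v assume "v \<in> carrier V"
        then obtain a where "a \<in> pts S" "lincomb a S = v" using ex1 by blast
        thus "v \<in> (\<lambda>c. lincomb c S) ` pts S" by blast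
      qed
    qed (use cl in auto)
  qed
qed

lemmas bij_\<Phi> = bij_basis[OF finite_B basis_B]

lemma \<Phi>_closed: "c \<in> pts B \<Longrightarrow> \<Phi> c \<in> carrier V"
  using bij_\<Phi> by (auto simp: bij_betw_def)

lemma coord_pts: "v \<in> carrier V \<Longrightarrow> coord v \<in> pts B"
  unfolding coord_def by (rule bij_betw_apply[OF bij_betw_inv_into[OF bij_\<Phi>]])

lemma \<Phi>_coord: "v \<in> carrier V \<Longrightarrow> \<Phi> (coord v) = v"
  unfolding coord_def by (rule bij_betw_inv_into_right[OF bij_\<Phi>])

lemma coord_\<Phi>: "c \<in> pts B \<Longrightarrow> coord (\<Phi> c) = c"
  unfolding coord_def by (rule bij_betw_inv_into_left[OF bij_\<Phi>])

lemma finite_V: "finite (carrier V)"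
  using bij_betw_finite[OF bij_\<Phi>] finite_pts[OF finite_B] by simp

lemma \<Phi>_restrict: "c \<in> B \<rightarrow> carrier K \<Longrightarrow> \<Phi> (restrict c B) = \<Phi> c"
  by (rule lincomb_cong) (use B_sub in auto)

lemma pts_Pi: "x \<in> pts I \<Longrightarrow> x \<in> I \<rightarrow> carrier K" by (simp add: PiE_def)

lemma \<Phi>_add: "x \<in> pts B \<Longrightarrow> y \<in> pts B \<Longrightarrow> \<Phi> (\<lambda>b\<in>B. x b \<oplus> y b) = \<Phi> x \<oplus>\<^bsub>V\<^esub> \<Phi> y"
proof -
  assume xy: "x \<in> pts B" "y \<in> pts B"
  have "\<Phi> (\<lambda>b\<in>B. x b \<oplus> y b) = \<Phi> (\<lambda>b. x b \<oplus> y b)"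
    by (rule \<Phi>_restrict) (use pts_mem[OF xy(1)] pts_mem[OF xy(2)] in auto)
  thus ?thesis using lincomb_sum[OF finite_B B_sub pts_Pi[OF xy(1)] pts_Pi[OF xy(2)]] by simp
qed

lemma \<Phi>_smult: "x \<in> pts B \<Longrightarrow> a \<in> carrier K \<Longrightarrow> \<Phi> (\<lambda>b\<in>B. a \<otimes> x b) = a \<odot>\<^bsub>V\<^esub> \<Phi> x"
proof -
  assume x: "x \<in> pts B" and a: "a \<in> carrier K"
  have "\<Phi> (\<lambda>b\<in>B. a \<otimes> x b) = \<Phi> (\<lambda>b. a \<otimes> x b)"
    by (rule \<Phi>_restrict) (use pts_mem[OF x] a in auto)
  thus ?thesis using lincomb_smult[OF B_sub pts_Pi[OF x] a] by simp
qed

lemma coord_add: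
  assumes "u \<in> carrier V" "v \<in> carrier V" "b \<in> B" shows "coord (u \<oplus>\<^bsub>V\<^esub> v) b = coord u b \<oplus> coord v b"
proof -
  have p: "(\<lambda>b\<in>B. coord u b \<oplus> coord v b) \<in> pts B"
    using pts_mem[OF coord_pts[OF assms(1)]] pts_mem[OF coord_pts[OF assms(2)]] by auto
  have "u \<oplus>\<^bsub>V\<^esub> v = \<Phi> (\<lambda>b\<in>B. coord u b \<oplus> coord v b)"
    using \<Phi>_add[OF coord_pts coord_pts] \<Phi>_coord assms by simp
  thus ?thesis using coord_\<Phi>[OF p] assms(3) by simp
qed

lemma coord_smult:
  assumes "v \<in> carrier V" "a \<in> carrier K" "b \<in> B" shows "coord (a \<odot>\<^bsub>V\<^esub> v) b = a \<otimes> coord v b"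
proof -
  have p: "(\<lambda>b\<in>B. a \<otimes> coord v b) \<in> pts B"
    using pts_mem[OF coord_pts[OF assms(1)]] assms(2) by auto
  have "a \<odot>\<^bsub>V\<^esub> v = \<Phi> (\<lambda>b\<in>B. a \<otimes> coord v b)"
    using \<Phi>_smult[OF coord_pts] \<Phi>_coord assms by simp
  thus ?thesis using coord_\<Phi>[OF p] assms(3) by simp
qed

lemma coord_lincomb:
  assumes "finite S" "S \<subseteq> carrier V" "c \<in> S \<rightarrow> carrier K" "b \<in> B"
  shows "coord (lincomb c S) b = (\<Oplus>s\<in>S. c s \<otimes> coord s b)"
  using assms(1,2,3)
proof (induction S rule: finite_induct)
  case empty
  have z: "coord \<zero>\<^bsub>V\<^esub> b \<in> carrier K" using pts_mem[OF coord_pts[of "\<zero>\<^bsub>V\<^esub>"] assms(4)] by simp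
  have "coord (\<zero>\<^bsub>V\<^esub> \<oplus>\<^bsub>V\<^esub> \<zero>\<^bsub>V\<^esub>) b = coord \<zero>\<^bsub>V\<^esub> b \<oplus> coord \<zero>\<^bsub>V\<^esub> b" by (rule coord_add) (use assms in auto)
  hence "coord \<zero>\<^bsub>V\<^esub> b = \<zero>" using z by simp
  thus ?case by (simp add: lincomb_def)
next
  case (insert s S)
  have s: "s \<in> carrier V" "c s \<in> carrier K" and S: "S \<subseteq> carrier V" "c \<in> S \<rightarrow> carrier K" using insert.prems by auto
  have cs: "coord t b \<in> carrier K" if "t \<in> carrier V" for t using pts_mem[OF coord_pts[OF that] assms(4)] .
  have "lincomb c (insert s S) = c s \<odot>\<^bsub>V\<^esub> s \<oplus>\<^bsub>V\<^esub> lincomb c S"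
    unfolding lincomb_def by (rule M.finsum_insert) (use insert s S in auto)
  hence "coord (lincomb c (insert s S)) b = c s \<otimes> coord s b \<oplus> coord (lincomb c S) b"
    using s S assms(4) by (simp add: coord_add coord_smult lincomb_closed)
  also have "\<dots> = c s \<otimes> coord s b \<oplus> (\<Oplus>s\<in>S. c s \<otimes> coord s b)" using insert.IH S by simp
  also have "\<dots> = (\<Oplus>s\<in>insert s S. c s \<otimes> coord s b)"
    by (rule R.finsum_insert[symmetric]) (use insert.hyps s S cs in auto)
  finally show ?case .
qed

lemma \<Phi>_inj: "x \<in> pts B \<Longrightarrow> y \<in> pts B \<Longrightarrow> \<Phi> x = \<Phi> y \<Longrightarrow> x = y"
  using inj_onD[OF bij_betw_imp_inj_on[OF bij_\<Phi>]] by simp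

lemma inj_on_\<Phi>_comp:
  assumes "amap J B \<psi>" "inj_on \<psi> (pts J)" shows "inj_on (\<lambda>c. \<Phi> (\<psi> c)) (pts J)"
proof (rule inj_onI)
  fix x y assume xy: "x \<in> pts J" "y \<in> pts J" and e: "\<Phi> (\<psi> x) = \<Phi> (\<psi> y)"
  have "\<psi> x = \<psi> y" by (rule \<Phi>_inj[OF amap_pts[OF assms(1) xy(1)] amap_pts[OF assms(1) xy(2)] e])
  thus "x = y" by (rule inj_onD[OF assms(2) _ xy])
qed

lemma subspace_sub: "VectorSpace.subspace K U V \<Longrightarrow> U \<subseteq> carrier V"
  by (simp add: VectorSpace.subspace_def submodule_def)

text \<open>
  Linear combinations in the record with carrier \<open>U\<close> agree with those in \<open>V\<close>, so that a basis of a
  subspace gives coordinates on it that make sense in \<open>V\<close>.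
\<close>

lemma subspace_basis:
  assumes U: "VectorSpace.subspace K U V" and S: "vectorspace.basis K (V\<lparr>carrier := U\<rparr>) S"
  shows "finite S" "S \<subseteq> U" "S \<subseteq> carrier V" "bij_betw (\<lambda>c. lincomb c S) (pts S) U"
    "vectorspace.dim K (V\<lparr>carrier := U\<rparr>) = card S"
proof -
  interpret U: vectorspace K "V\<lparr>carrier := U\<rparr>" by (rule subspace_is_vs[OF U])
  have sub: "submodule K U V" using U by simp
  show SU: "S \<subseteq> U" using S by (simp add: U.basis_def)
  show SV: "S \<subseteq> carrier V" using SU subspace_sub[OF U] by blast
  show fS: "finite S" using SV finite_V finite_subset by blast
  show "vectorspace.dim K (V\<lparr>carrier := U\<rparr>) = card S" by (rule U.dim_basis[OF fS S])
  have lc: "U.lincomb c S = lincomb c S" if "c \<in> pts S" for c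
    by (rule lincomb_not_depend[OF fS SU sub pts_Pi[OF that], symmetric])
  have ex1: "\<exists>!a. a \<in> pts S \<and> U.lincomb a S = v" if "v \<in> U" for v
    using U.basis_criterion[OF fS] SU S that by auto
  have cl: "lincomb c S \<in> U" if "c \<in> pts S" for c
    using U.lincomb_closed[OF _ pts_Pi[OF that]] SU lc[OF that] by auto
  show "bij_betw (\<lambda>c. lincomb c S) (pts S) U"
    unfolding bij_betw_def
  proof
    show "inj_on (\<lambda>c. lincomb c S) (pts S)"
    proof (rule inj_onI)
      fix x y assume xy: "x \<in> pts S" "y \<in> pts S" and e: "lincomb x S = lincomb y S"
      show "x = y" using ex1[OF cl[OF xy(1)]] xy e lc[OF xy(1)] lc[OF xy(2)] by metis
    qed
    show "(\<lambda>c. lincomb c S) ` pts S = U"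
    proof
      show "(\<lambda>c. lincomb c S) ` pts S \<subseteq> U" using cl by auto
      show "U \<subseteq> (\<lambda>c. lincomb c S) ` pts S"
      proof
        fix v assume "v \<in> U"
        then obtain a where a: "a \<in> pts S" "U.lincomb a S = v" using ex1 by blast
        hence "v = lincomb a S" using lc by simp
        thus "v \<in> (\<lambda>c. lincomb c S) ` pts S" using a(1) by blast
      qed
    qed
  qed
qed

lemma subspace_has_basis:
  assumes U: "VectorSpace.subspace K U V" shows "\<exists>S. vectorspace.basis K (V\<lparr>carrier := U\<rparr>) S"
proof -
  interpret U: vectorspace K "V\<lparr>carrier := U\<rparr>" by (rule subspace_is_vs[OF U])
  have fU: "finite U" using finite_V subspace_sub[OF U] finite_subset by blast
  have "U.span U = U"
  proof
    show "U.span U \<subseteq> U" using U.span_is_subset2[of U] by simp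
    show "U \<subseteq> U.span U" using U.in_own_span[of U] by simp
  qed
  hence "U.fin_dim" unfolding U.fin_dim_def using fU by (intro exI[of _ U]) simp
  thus ?thesis using U.finite_basis_exists by blast
qed

lemma basis_param:
  assumes U: "VectorSpace.subspace K U V" and S: "vectorspace.basis K (V\<lparr>carrier := U\<rparr>) S" and a: "a \<in> carrier V"
  defines "\<psi> \<equiv> \<lambda>c. coord (a \<oplus>\<^bsub>V\<^esub> lincomb c S)"
  shows "amap S B \<psi>" "inj_on \<psi> (pts S)" "(\<lambda>c. \<Phi> (\<psi> c)) ` pts S = {a \<oplus>\<^bsub>V\<^esub> u | u. u \<in> U}"
    "\<And>c. c \<in> pts S \<Longrightarrow> \<Phi> (\<psi> c) = a \<oplus>\<^bsub>V\<^esub> lincomb c S"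
proof -
  note S' = subspace_basis[OF U S]
  have cl: "lincomb c S \<in> carrier V" if "c \<in> pts S" for c
    using lincomb_closed[OF S'(3) pts_Pi[OF that]] .
  show eq: "\<Phi> (\<psi> c) = a \<oplus>\<^bsub>V\<^esub> lincomb c S" if "c \<in> pts S" for c
    unfolding \<psi>_def using \<Phi>_coord a cl[OF that] by simp
  have cb: "coord v b \<in> carrier K" if "v \<in> carrier V" "b \<in> B" for v b
    using pts_mem[OF coord_pts[OF that(1)] that(2)] .
  show "amap S B \<psi>"
    unfolding amap_def
  proof (intro conjI ballI)
    fix c assume "c \<in> pts S" thus "\<psi> c \<in> pts B" unfolding \<psi>_def using coord_pts a cl by simp
  next
    fix b assume b: "b \<in> B"
    have "plt S 2 (\<lambda>c. coord a b \<oplus> (\<Oplus>s\<in>S. coord s b \<otimes> c s))"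
      by (rule plt_affine) (use S'(1) cb[OF a b] cb[OF _ b] S'(3) in \<open>auto intro: plt_var\<close>)
    thus "plt S 2 (\<lambda>c. \<psi> c b)"
    proof (rule plt_cong)
      fix c assume c: "c \<in> pts S"
      have "(\<Oplus>s\<in>S. c s \<otimes> coord s b) = (\<Oplus>s\<in>S. coord s b \<otimes> c s)"
      proof (rule R.finsum_cong')
        show "(\<lambda>s. coord s b \<otimes> c s) \<in> S \<rightarrow> carrier K" using cb[OF _ b] S'(3) pts_mem[OF c] by auto
        fix s assume s: "s \<in> S"
        show "c s \<otimes> coord s b = coord s b \<otimes> c s" by (rule m_comm[OF pts_mem[OF c s] cb[OF _ b]]) (use S'(3) s in auto)
      qed simp
      thus "\<psi> c b = coord a b \<oplus> (\<Oplus>s\<in>S. coord s b \<otimes> c s)"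
        unfolding \<psi>_def using coord_add[OF a cl[OF c] b] coord_lincomb[OF S'(1,3) pts_Pi[OF c] b] by simp
    qed
  qed
  show "inj_on \<psi> (pts S)"
  proof (rule inj_onI)
    fix x y assume xy: "x \<in> pts S" "y \<in> pts S" and "\<psi> x = \<psi> y"
    hence "a \<oplus>\<^bsub>V\<^esub> lincomb x S = a \<oplus>\<^bsub>V\<^esub> lincomb y S" using eq by metis
    hence "lincomb x S = lincomb y S" using a cl xy by simp
    thus "x = y" using S'(4) xy by (auto simp: bij_betw_def inj_on_def)
  qed
  have "(\<lambda>c. lincomb c S) ` pts S = U" using S'(4) by (simp add: bij_betw_def)
  moreover have "(\<lambda>c. \<Phi> (\<psi> c)) ` pts S = (\<lambda>u. a \<oplus>\<^bsub>V\<^esub> u) ` (\<lambda>c. lincomb c S) ` pts S"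
    unfolding image_image by (rule image_cong[OF refl eq])
  ultimately show "(\<lambda>c. \<Phi> (\<psi> c)) ` pts S = {a \<oplus>\<^bsub>V\<^esub> u | u. u \<in> U}" by blast
qed

lemma affine_subspace_param:
  assumes "affine_subspace K V j W"
  shows "\<exists>(J :: 'v set) \<psi>. finite J \<and> card J = j \<and> amap J B \<psi> \<and> inj_on \<psi> (pts J) \<and> (\<lambda>c. \<Phi> (\<psi> c)) ` pts J = W"
proof -
  obtain a U where a: "a \<in> carrier V" and U: "VectorSpace.subspace K U V"
    and j: "vectorspace.dim K (V\<lparr>carrier := U\<rparr>) = j" and W: "W = {a \<oplus>\<^bsub>V\<^esub> u | u. u \<in> U}"
    using assms unfolding affine_subspace_def by blast
  obtain S where S: "vectorspace.basis K (V\<lparr>carrier := U\<rparr>) S" using subspace_has_basis[OF U] by blast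
  show ?thesis
    by (intro exI[of _ S] exI[of _ "\<lambda>c. coord (a \<oplus>\<^bsub>V\<^esub> lincomb c S)"] conjI subspace_basis(1)[OF U S]
        basis_param(1,2)[OF U S a]) (simp_all only: basis_param(3)[OF U S a] W subspace_basis(5)[OF U S, symmetric] j)
qed

lemma card_affine_subspace: "affine_subspace K V j W \<Longrightarrow> card W = q ^ j"
proof -
  assume W: "affine_subspace K V j W"
  obtain J :: "'v set" and \<psi> where J: "finite J" "card J = j" "amap J B \<psi>" "inj_on \<psi> (pts J)" "(\<lambda>c. \<Phi> (\<psi> c)) ` pts J = W"
    using affine_subspace_param[OF W] by (elim exE conjE) (rule that; assumption)
  have "inj_on (\<lambda>c. \<Phi> (\<psi> c)) (pts J)" by (rule inj_on_\<Phi>_comp[OF J(3,4)])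
  hence "card W = card (pts J)" unfolding J(5)[symmetric] by (rule card_image)
  also have "\<dots> = q ^ card J" by (rule card_PiE[OF J(1), of "\<lambda>_. carrier K", simplified])
  finally show ?thesis unfolding J(2) .
qed

text \<open>
  The directions of the image are spanned by the differences between the values at the unit points and
  the value at the origin.
\<close>

lemma amap_image_affine_subspace:
  assumes T: "finite T" and am: "amap T B \<chi>"
  shows "\<exists>j. affine_subspace K V j ((\<lambda>c. \<Phi> (\<chi> c)) ` pts T)"
proof -
  let ?o = "origin T"
  define a where "a = \<Phi> (\<chi> ?o)"
  define \<delta> where "\<delta> t b = \<chi> (unitpt T t) b \<ominus> \<chi> ?o b" for t b
  define lin where "lin c = (\<lambda>b\<in>B. \<Oplus>t\<in>T. c t \<otimes> \<delta> t b)" for c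
  define U where "U = (\<lambda>c. \<Phi> (lin c)) ` pts T"
  have \<chi>b: "\<chi> c b \<in> carrier K" if "c \<in> pts T" "b \<in> B" for c b using pts_mem[OF amap_pts[OF am that(1)] that(2)] .
  have \<delta>b: "\<delta> t b \<in> carrier K" if "b \<in> B" for t b unfolding \<delta>_def using \<chi>b[OF _ that] by simp
  have lin_pts: "lin c \<in> pts B" if "c \<in> pts T" for c
    unfolding lin_def using \<delta>b pts_mem[OF that] by (auto intro!: R.finsum_closed)
  have a: "a \<in> carrier V" unfolding a_def using \<Phi>_closed amap_pts[OF am] by simp
  have \<chi>: "\<Phi> (\<chi> c) = a \<oplus>\<^bsub>V\<^esub> \<Phi> (lin c)" if c: "c \<in> pts T" for c
  proof -
    have "\<chi> c = (\<lambda>b\<in>B. \<chi> ?o b \<oplus> lin c b)"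
    proof (rule PiE_ext)
      show "\<chi> c \<in> pts B" by (rule amap_pts[OF am c])
      show "(\<lambda>b\<in>B. \<chi> ?o b \<oplus> lin c b) \<in> pts B" using \<chi>b[OF origin_pts] pts_mem[OF lin_pts[OF c]] by auto
      fix b assume b: "b \<in> B"
      have "plt T 2 (\<lambda>x. \<chi> x b)" using am b by (simp add: amap_def)
      from plt_2_expand[OF T this c] show "\<chi> c b = (\<lambda>b\<in>B. \<chi> ?o b \<oplus> lin c b) b"
        using b by (simp add: lin_def \<delta>_def)
    qed
    thus ?thesis unfolding a_def using \<Phi>_add[OF amap_pts[OF am origin_pts] lin_pts[OF c]] by simp
  qed
  have lin_add: "(\<lambda>b\<in>B. lin c b \<oplus> lin c' b) = lin (\<lambda>t\<in>T. c t \<oplus> c' t)" if c: "c \<in> pts T" "c' \<in> pts T" for c c'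
  proof
    fix b
    show "(\<lambda>b\<in>B. lin c b \<oplus> lin c' b) b = lin (\<lambda>t\<in>T. c t \<oplus> c' t) b"
    proof (cases "b \<in> B")
      case b: True
      have "(\<Oplus>t\<in>T. (\<lambda>t\<in>T. c t \<oplus> c' t) t \<otimes> \<delta> t b) = (\<Oplus>t\<in>T. c t \<otimes> \<delta> t b \<oplus> c' t \<otimes> \<delta> t b)"
        by (rule R.finsum_cong') (use \<delta>b[OF b] pts_mem[OF c(1)] pts_mem[OF c(2)] in \<open>auto simp: l_distr\<close>)
      also have "\<dots> = (\<Oplus>t\<in>T. c t \<otimes> \<delta> t b) \<oplus> (\<Oplus>t\<in>T. c' t \<otimes> \<delta> t b)"
        by (rule R.finsum_addf) (use \<delta>b[OF b] pts_mem[OF c(1)] pts_mem[OF c(2)] in auto)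
      finally show ?thesis using b by (simp add: lin_def)
    qed (simp add: lin_def)
  qed
  have lin_smult: "(\<lambda>b\<in>B. r \<otimes> lin c b) = lin (\<lambda>t\<in>T. r \<otimes> c t)" if c: "c \<in> pts T" and r: "r \<in> carrier K" for c r
  proof
    fix b
    show "(\<lambda>b\<in>B. r \<otimes> lin c b) b = lin (\<lambda>t\<in>T. r \<otimes> c t) b"
    proof (cases "b \<in> B")
      case b: True
      have "(\<Oplus>t\<in>T. (\<lambda>t\<in>T. r \<otimes> c t) t \<otimes> \<delta> t b) = (\<Oplus>t\<in>T. r \<otimes> (c t \<otimes> \<delta> t b))"
        by (rule R.finsum_cong') (use \<delta>b[OF b] pts_mem[OF c] r in \<open>auto simp: m_assoc\<close>)
      also have "\<dots> = r \<otimes> (\<Oplus>t\<in>T. c t \<otimes> \<delta> t b)"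
        by (rule finsum_rdistr[symmetric]) (use \<delta>b[OF b] pts_mem[OF c] r T in auto)
      finally show ?thesis using b by (simp add: lin_def)
    qed (simp add: lin_def)
  qed
  have "submodule K U V"
  proof (rule submodule.intro)
    show "module K V" by (rule module_axioms)
    show "U \<subseteq> carrier V" unfolding U_def using \<Phi>_closed lin_pts by auto
  next
    fix v w assume "v \<in> U" "w \<in> U"
    then obtain c c' where c: "c \<in> pts T" "c' \<in> pts T" "v = \<Phi> (lin c)" "w = \<Phi> (lin c')" unfolding U_def by blast
    have "v \<oplus>\<^bsub>V\<^esub> w = \<Phi> (lin (\<lambda>t\<in>T. c t \<oplus> c' t))"
      using \<Phi>_add[OF lin_pts[OF c(1)] lin_pts[OF c(2)]] lin_add[OF c(1,2)] c by simp
    moreover have "(\<lambda>t\<in>T. c t \<oplus> c' t) \<in> pts T" using pts_mem[OF c(1)] pts_mem[OF c(2)] by auto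
    ultimately show "v \<oplus>\<^bsub>V\<^esub> w \<in> U" unfolding U_def by blast
  next
    fix r v assume r: "r \<in> carrier K" and "v \<in> U"
    then obtain c where c: "c \<in> pts T" "v = \<Phi> (lin c)" unfolding U_def by blast
    have "r \<odot>\<^bsub>V\<^esub> v = \<Phi> (lin (\<lambda>t\<in>T. r \<otimes> c t))"
      using \<Phi>_smult[OF lin_pts[OF c(1)] r] lin_smult[OF c(1) r] c by simp
    moreover have "(\<lambda>t\<in>T. r \<otimes> c t) \<in> pts T" using pts_mem[OF c(1)] r by auto
    ultimately show "r \<odot>\<^bsub>V\<^esub> v \<in> U" unfolding U_def by blast
  next
    have o: "?o \<in> pts T" by simp
    have "\<Phi> (\<lambda>b\<in>B. \<zero> \<otimes> lin ?o b) = \<zero> \<odot>\<^bsub>V\<^esub> \<Phi> (lin ?o)" by (rule \<Phi>_smult[OF lin_pts[OF o]]) simp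
    also have "\<dots> = \<zero>\<^bsub>V\<^esub>" using \<Phi>_closed[OF lin_pts[OF o]] by simp
    finally have "\<zero>\<^bsub>V\<^esub> = \<Phi> (lin (\<lambda>t\<in>T. \<zero> \<otimes> ?o t))" using lin_smult[OF o R.zero_closed] by simp
    moreover have "(\<lambda>t\<in>T. \<zero> \<otimes> ?o t) \<in> pts T" using pts_mem[OF o] by auto
    ultimately show "\<zero>\<^bsub>V\<^esub> \<in> U" unfolding U_def by blast
  qed
  hence U: "VectorSpace.subspace K U V"
    unfolding VectorSpace.subspace_def using vectorspace_axioms by blast
  have "(\<lambda>c. \<Phi> (\<chi> c)) ` pts T = {a \<oplus>\<^bsub>V\<^esub> u | u. u \<in> U}"
  proof -
    have "(\<lambda>c. \<Phi> (\<chi> c)) ` pts T = (\<lambda>u. a \<oplus>\<^bsub>V\<^esub> u) ` U"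
      unfolding U_def image_image by (rule image_cong[OF refl \<chi>])
    thus ?thesis by blast
  qed
  thus ?thesis unfolding affine_subspace_def using a U by blast
qed

lemma inj_amap_image_affine_subspace:
  assumes "finite J" "amap J B \<psi>" "inj_on \<psi> (pts J)"
  shows "affine_subspace K V (card J) ((\<lambda>c. \<Phi> (\<psi> c)) ` pts J)"
proof -
  obtain j where j: "affine_subspace K V j ((\<lambda>c. \<Phi> (\<psi> c)) ` pts J)"
    using amap_image_affine_subspace[OF assms(1,2)] by (elim exE) (rule that; assumption)
  have "inj_on (\<lambda>c. \<Phi> (\<psi> c)) (pts J)" by (rule inj_on_\<Phi>_comp[OF assms(2,3)])
  hence "card ((\<lambda>c. \<Phi> (\<psi> c)) ` pts J) = card (pts J)" by (rule card_image)
  also have "\<dots> = q ^ card J" by (rule card_PiE[OF assms(1), of "\<lambda>_. carrier K", simplified])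
  finally have "card ((\<lambda>c. \<Phi> (\<psi> c)) ` pts J) = q ^ card J" .
  hence "q ^ j = q ^ card J" using card_affine_subspace[OF j] by simp
  hence "j = card J" using q_ge_2 by (metis One_nat_def Suc_1 less_le_trans lessI power_inject_exp)
  thus ?thesis using j by simp
qed

text \<open>
  \<open>polynomial_on\<close> provides a base point and a basis of its own. Every affine map into \<open>W\<close> factors through
  this parametrisation of \<open>W\<close>, whether or not it is injective.
\<close>

lemma polynomial_on_plt:
  assumes "polynomial_on K V n W f" "finite T" "amap T B \<chi>" "(\<lambda>c. \<Phi> (\<chi> c)) ` pts T \<subseteq> W"
  shows "plt T (Suc n) (\<lambda>c. f (\<Phi> (\<chi> c)))"
proof -
  obtain a U S Q where a: "a \<in> carrier V" and U: "VectorSpace.subspace K U V" and W: "W = {a \<oplus>\<^bsub>V\<^esub> u | u. u \<in> U}"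
    and S: "vectorspace.basis K (V\<lparr>carrier := U\<rparr>) S" and Q: "Q \<in> mpolys K S" "mpoly_degree_le K Q n"
    and fQ: "\<forall>c\<in>S \<rightarrow> carrier K. f (a \<oplus>\<^bsub>V\<^esub> lincomb c S) = mpoly_eval K Q c"
    using assms(1) unfolding polynomial_on_def by blast
  define \<psi> where "\<psi> = (\<lambda>c. coord (a \<oplus>\<^bsub>V\<^esub> lincomb c S))"
  have bp: "amap S B \<psi>" "inj_on \<psi> (pts S)" "(\<lambda>c. \<Phi> (\<psi> c)) ` pts S = {a \<oplus>\<^bsub>V\<^esub> u | u. u \<in> U}"
    "\<And>c. c \<in> pts S \<Longrightarrow> \<Phi> (\<psi> c) = a \<oplus>\<^bsub>V\<^esub> lincomb c S"
    unfolding \<psi>_def by (rule basis_param[OF U S a])+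
  note S' = subspace_basis[OF U S]
  have "\<chi> ` pts T \<subseteq> \<psi> ` pts S"
  proof
    fix y assume "y \<in> \<chi> ` pts T"
    then obtain c where c: "c \<in> pts T" "y = \<chi> c" by (elim imageE)
    have "\<Phi> (\<chi> c) \<in> (\<lambda>c. \<Phi> (\<psi> c)) ` pts S" unfolding bp(3) W[symmetric] using assms(4) imageI[OF c(1), of "\<lambda>c. \<Phi> (\<chi> c)"] by (rule subsetD)
    then obtain s where s: "s \<in> pts S" "\<Phi> (\<chi> c) = \<Phi> (\<psi> s)" by (rule imageE)
    have "\<chi> c = \<psi> s" by (rule \<Phi>_inj[OF amap_pts[OF assms(3) c(1)] amap_pts[OF bp(1) s(1)] s(2)])
    thus "y \<in> \<psi> ` pts S" unfolding c(2) using s(1) by (simp only: imageI)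
  qed
  then obtain \<eta> where \<eta>: "amap T S \<eta>" "\<And>x. x \<in> pts T \<Longrightarrow> \<psi> (\<eta> x) = \<chi> x"
    using amap_factor[OF S'(1) assms(2) bp(1,2) assms(3)] by auto
  have "plt S (Suc n) (mpoly_eval K Q)"
    by (rule plt_mpoly_eval[OF S'(1) Q(1)]) (use Q(2) in \<open>auto simp: mpoly_degree_le_def less_Suc_eq_le\<close>)
  hence "plt T (Suc n) (\<lambda>c. mpoly_eval K Q (\<eta> c))" by (rule plt_amap[OF _ \<eta>(1)])
  thus ?thesis
  proof (rule plt_cong)
    fix c assume c: "c \<in> pts T"
    note e = amap_pts[OF \<eta>(1) c]
    show "f (\<Phi> (\<chi> c)) = mpoly_eval K Q (\<eta> c)"
      unfolding \<eta>(2)[OF c, symmetric] bp(4)[OF e] using fQ pts_Pi[OF e] by blast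
  qed
qed

lemma plt_polynomial_on:
  assumes "finite J" "amap J B \<psi>" "inj_on \<psi> (pts J)" "plt J (Suc n) (\<lambda>c. f (\<Phi> (\<psi> c)))"
  shows "polynomial_on K V n ((\<lambda>c. \<Phi> (\<psi> c)) ` pts J) f"
proof -
  let ?W = "(\<lambda>c. \<Phi> (\<psi> c)) ` pts J"
  obtain a U where a: "a \<in> carrier V" and U: "VectorSpace.subspace K U V" and W: "?W = {a \<oplus>\<^bsub>V\<^esub> u | u. u \<in> U}"
    using amap_image_affine_subspace[OF assms(1,2)] unfolding affine_subspace_def by (elim exE bexE conjE) (rule that; assumption)
  obtain S where S: "vectorspace.basis K (V\<lparr>carrier := U\<rparr>) S" using subspace_has_basis[OF U] by blast
  define \<chi> where "\<chi> = (\<lambda>c. coord (a \<oplus>\<^bsub>V\<^esub> lincomb c S))"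
  have bp: "amap S B \<chi>" "inj_on \<chi> (pts S)" "(\<lambda>c. \<Phi> (\<chi> c)) ` pts S = {a \<oplus>\<^bsub>V\<^esub> u | u. u \<in> U}"
    "\<And>c. c \<in> pts S \<Longrightarrow> \<Phi> (\<chi> c) = a \<oplus>\<^bsub>V\<^esub> lincomb c S"
    unfolding \<chi>_def by (rule basis_param[OF U S a])+
  note S' = subspace_basis[OF U S]
  have "\<chi> ` pts S \<subseteq> \<psi> ` pts J"
  proof
    fix y assume "y \<in> \<chi> ` pts S"
    then obtain c where c: "c \<in> pts S" "y = \<chi> c" by (elim imageE)
    have "\<Phi> (\<chi> c) \<in> ?W" unfolding W bp(3)[symmetric] using imageI[OF c(1), of "\<lambda>c. \<Phi> (\<chi> c)"] .
    then obtain s where s: "s \<in> pts J" "\<Phi> (\<chi> c) = \<Phi> (\<psi> s)" by (elim imageE)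
    have "\<chi> c = \<psi> s" by (rule \<Phi>_inj[OF amap_pts[OF bp(1) c(1)] amap_pts[OF assms(2) s(1)] s(2)])
    thus "y \<in> \<psi> ` pts J" unfolding c(2) using s(1) by (simp only: imageI)
  qed
  then obtain \<eta> where \<eta>: "amap S J \<eta>" "\<And>x. x \<in> pts S \<Longrightarrow> \<psi> (\<eta> x) = \<chi> x"
    using amap_factor[OF assms(1) S'(1) assms(2,3) bp(1)] by auto
  have "plt S (Suc n) (\<lambda>c. f (\<Phi> (\<psi> (\<eta> c))))" using plt_amap[OF assms(4) \<eta>(1)] .
  hence p: "plt S (Suc n) (\<lambda>c. f (a \<oplus>\<^bsub>V\<^esub> lincomb c S))"
    by (rule plt_cong) (simp only: \<eta>(2) bp(4))
  obtain Q where Q: "Q \<in> mpolys K S" "\<And>\<mu>. Q \<mu> \<noteq> \<zero> \<Longrightarrow> size \<mu> < Suc n"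
    "\<And>c. c \<in> pts S \<Longrightarrow> f (a \<oplus>\<^bsub>V\<^esub> lincomb c S) = mpoly_eval K Q c"
    using mpoly_of_plt[OF S'(1) p] by blast
  have "f (a \<oplus>\<^bsub>V\<^esub> lincomb c S) = mpoly_eval K Q c" if c: "c \<in> S \<rightarrow> carrier K" for c
  proof -
    have r: "restrict c S \<in> pts S" using c by auto
    have "lincomb (restrict c S) S = lincomb c S" by (rule lincomb_cong) (use S'(3) c in auto)
    moreover have "mpoly_eval K Q (restrict c S) = mpoly_eval K Q c"
      unfolding mpoly_eval_def
    proof (rule R.finsum_cong')
      fix \<mu> assume "\<mu> \<in> {\<mu>. Q \<mu> \<noteq> \<zero>}"
      hence sub: "set_mset \<mu> \<subseteq> S" using mpoly_support[OF Q(1)] by simp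
      have "(\<Otimes>i\<in>set_mset \<mu>. restrict c S i [^] count \<mu> i) = (\<Otimes>i\<in>set_mset \<mu>. c i [^] count \<mu> i)"
        by (rule finprod_cong') (use sub c in \<open>auto simp: Pi_def subset_iff\<close>)
      thus "Q \<mu> \<otimes> (\<Otimes>i\<in>set_mset \<mu>. restrict c S i [^] count \<mu> i) = Q \<mu> \<otimes> (\<Otimes>i\<in>set_mset \<mu>. c i [^] count \<mu> i)" by simp
    next
      show "(\<lambda>\<mu>. Q \<mu> \<otimes> (\<Otimes>i\<in>set_mset \<mu>. c i [^] count \<mu> i)) \<in> {\<mu>. Q \<mu> \<noteq> \<zero>} \<rightarrow> carrier K"
      proof
        fix \<mu> assume "\<mu> \<in> {\<mu>. Q \<mu> \<noteq> \<zero>}"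
        hence sub: "set_mset \<mu> \<subseteq> S" using mpoly_support[OF Q(1)] by simp
        show "Q \<mu> \<otimes> (\<Otimes>i\<in>set_mset \<mu>. c i [^] count \<mu> i) \<in> carrier K"
          by (intro m_closed mpoly_support(3)[OF Q(1)] finprod_closed) (use sub c in \<open>auto simp: Pi_def subset_iff\<close>)
      qed
    qed simp
    ultimately show ?thesis using Q(3)[OF r] by simp
  qed
  moreover have "mpoly_degree_le K Q n" unfolding mpoly_degree_le_def using Q(2) by (simp add: less_Suc_eq_le)
  ultimately show ?thesis unfolding polynomial_on_def using a U W S Q(1) by blast
qed

end

context galois_field begin

section \<open>Common zeros of polynomial functions\<close>

text \<open>
  The sum of \<open>G\<close> over all points vanishes for reasons of degree, so \<open>G\<close> cannot be supported at a
  single point.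
\<close>

lemma sum_only_origin:
  assumes "finite S" "plt S n G" "n \<le> card S * (q - 1)" "G (origin S) \<noteq> \<zero>"
  shows "\<exists>s\<in>pts S. s \<noteq> origin S \<and> G s \<noteq> \<zero>"
proof (rule ccontr)
  assume "\<not> ?thesis"
  hence z: "G s = \<zero>" if "s \<in> pts S" "s \<noteq> origin S" for s using that by blast
  have "(\<Oplus>s\<in>pts S. G s) = (\<Oplus>s\<in>pts S. if origin S = s then G s else \<zero>)"
    by (rule finsum_cong') (use z plt_closed[OF assms(2)] in auto)
  also have "\<dots> = G (origin S)"
    using finsum_singleton[of "origin S" "pts S" G] finite_pts[OF assms(1)] plt_closed[OF assms(2)] by auto
  finally show False using sum_plt_zero[OF assms(1,2,3)] assms(4) by simp
qed

lemma plt_const': "c \<in> carrier K \<Longrightarrow> plt I (Suc n) (\<lambda>_. c)"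
  by (rule plt_const[of c]) auto

lemma plt_diff_const:
  assumes "plt I (Suc n) f" "c \<in> carrier K" shows "plt I (Suc n) (\<lambda>x. f x \<ominus> c)"
  by (rule plt_add[OF assms(1) plt_const'[of "\<ominus> c"]]) (use assms in \<open>auto simp: minus_eq\<close>)

text \<open>
  \<open>\<Prod>\<^sub>a (1 - h\<^sub>a\<^bsup>q - 1\<^esup>)\<close> is the indicator function of the set of common zeros, and its degree is too small for this set to
  consist of the origin alone.
\<close>

lemma chevalley:
  assumes "finite S" "finite A" "\<And>a. a \<in> A \<Longrightarrow> plt S (Suc d) (h a)" "\<And>a. a \<in> A \<Longrightarrow> h a (origin S) = \<zero>"
    and "card A * d < card S"
  shows "\<exists>s\<in>pts S. s \<noteq> origin S \<and> (\<forall>a\<in>A. h a s = \<zero>)"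
proof -
  have p1: "plt S (Suc ((q - 1) * d)) (\<lambda>s. \<one> \<ominus> h a s [^] (q - 1))" if "a \<in> A" for a
  proof (rule plt_add)
    show "plt S (Suc ((q - 1) * d)) (\<lambda>s. \<one>)" by (rule plt_const') simp
    show "plt S (Suc ((q - 1) * d)) (\<lambda>s. \<ominus> \<one> \<otimes> h a s [^] (q - 1))"
      by (rule plt_smult[OF plt_pow[OF assms(3)[OF that]]]) simp
    fix s assume "s \<in> pts S"
    hence "h a s \<in> carrier K" using plt_closed[OF assms(3)[OF that]] by simp
    thus "\<one> \<ominus> h a s [^] (q - 1) = \<one> \<oplus> \<ominus> \<one> \<otimes> h a s [^] (q - 1)" by (simp add: minus_eq l_minus)
  qed
  define F where "F s = (\<Otimes>a\<in>A. \<one> \<ominus> h a s [^] (q - 1))" for s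
  have hc: "h a s \<in> carrier K" if "a \<in> A" "s \<in> pts S" for a s using plt_closed[OF assms(3)[OF that(1)] that(2)] .
  have "plt S (Suc (\<Sum>a\<in>A. (q - 1) * d)) F" unfolding F_def by (rule plt_prod[OF assms(2) p1])
  hence pF: "plt S (Suc (card A * d * (q - 1))) F" by (simp add: ac_simps)
  have deg: "Suc (card A * d * (q - 1)) \<le> card S * (q - 1)"
  proof -
    have "Suc (card A * d) * (q - 1) \<le> card S * (q - 1)" using assms(5) by (intro mult_right_mono) auto
    thus ?thesis using q_ge_2 by simp
  qed
  have "F (origin S) = (\<Otimes>a\<in>A. \<one>)" unfolding F_def
  proof (rule finprod_cong')
    fix a assume "a \<in> A"
    thus "\<one> \<ominus> h a (origin S) [^] (q - 1) = \<one>"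
      using trans[OF one_minus_pow[OF hc[OF _ origin_pts]] if_P[OF assms(4)]] by blast
  qed auto
  hence "F (origin S) \<noteq> \<zero>" by simp
  from sum_only_origin[OF assms(1) pF deg this] obtain s where s: "s \<in> pts S" "s \<noteq> origin S" "F s \<noteq> \<zero>" by blast
  have "h a s = \<zero>" if a: "a \<in> A" for a
  proof (rule ccontr)
    assume "h a s \<noteq> \<zero>"
    from trans[OF one_minus_pow[OF hc[OF a s(1)]] if_not_P[OF this]] have z: "\<one> \<ominus> h a s [^] (q - 1) = \<zero>" .
    have e: "insert a (A - {a}) = A" using a by auto
    have cl: "\<one> \<ominus> h b s [^] (q - 1) \<in> carrier K" if "b \<in> A" for b using hc[OF that s(1)] by simp
    have "F s = (\<one> \<ominus> h a s [^] (q - 1)) \<otimes> (\<Otimes>b\<in>A - {a}. \<one> \<ominus> h b s [^] (q - 1))"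
      unfolding F_def using finprod_insert[of "A - {a}" a "\<lambda>b. \<one> \<ominus> h b s [^] (q - 1)"] cl a assms(2) unfolding e by auto
    moreover have "(\<Otimes>b\<in>A - {a}. \<one> \<ominus> h b s [^] (q - 1)) \<in> carrier K" by (rule finprod_closed) (use cl in auto)
    ultimately have "F s = \<zero>" unfolding z by simp
    thus False using s(3) by simp
  qed
  thus ?thesis using s by blast
qed

text \<open>
  Products are expanded into sums over words rather than monomials; this avoids multinomial
  coefficients, and the number of terms is still bounded in terms of the degree and of the number of letters.
\<close>

definition words :: "'k set \<Rightarrow> nat \<Rightarrow> 'k list set" where "words T n = {w. set w \<subseteq> T \<and> length w = n}"

lemma finite_words: "finite T \<Longrightarrow> finite (words T n)" unfolding words_def by (rule finite_lists_length_eq)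
lemma card_words: "finite T \<Longrightarrow> card (words T n) = card T ^ n" unfolding words_def by (rule card_lists_length_eq)

lemma words_Suc: "words T (Suc n) = (\<lambda>z. fst z # snd z) ` (T \<times> words T n)"
  unfolding words_def by (auto simp: length_Suc_conv image_iff)

definition wprod :: "('k \<Rightarrow> 'a) \<Rightarrow> 'k list \<Rightarrow> 'a" where "wprod tm w = foldr (\<lambda>k r. tm k \<otimes> r) w \<one>"

lemma wprod_simps [simp]: "wprod tm [] = \<one>" "wprod tm (k # w) = tm k \<otimes> wprod tm w"
  by (simp_all add: wprod_def)

lemma wprod_closed: "(\<And>k. k \<in> T \<Longrightarrow> tm k \<in> carrier K) \<Longrightarrow> set w \<subseteq> T \<Longrightarrow> wprod tm w \<in> carrier K"
  by (induction w) auto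

lemma wprod_replicate: "tm k = \<one> \<Longrightarrow> wprod tm (replicate n k) = \<one>"
  by (induction n) auto

text \<open>
  The coordinates of \<open>g s t\<close> are sums of products of a function of \<open>s\<close> and a function of \<open>t\<close>; multiplying out a
  polynomial in these coordinates separates the two kinds of variables. The letter \<open>k0\<close>, which
  stands for the constant \<open>1\<close>, pads shorter products to words of length \<open>n\<close>.
\<close>

lemma plt_separate:
  fixes S :: "'s set" and I :: "'i set"
  assumes T: "finite T" "k0 \<in> T" and tm: "\<And>t k. t \<in> D \<Longrightarrow> k \<in> T \<Longrightarrow> tm t k \<in> carrier K" "\<And>t. t \<in> D \<Longrightarrow> tm t k0 = \<one>"
    and c: "\<And>k i. k \<in> T \<Longrightarrow> i \<in> I \<Longrightarrow> plt S 2 (c k i)"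
    and gp: "\<And>s t. s \<in> pts S \<Longrightarrow> t \<in> D \<Longrightarrow> g s t \<in> pts I"
    and g: "\<And>s t i. s \<in> pts S \<Longrightarrow> t \<in> D \<Longrightarrow> i \<in> I \<Longrightarrow> g s t i = (\<Oplus>k\<in>T. c k i s \<otimes> tm t k)"
    and F: "plt I n F"
  shows "\<exists>A. (\<forall>w\<in>words T n. plt S n (A w)) \<and>
    (\<forall>s\<in>pts S. \<forall>t\<in>D. F (g s t) = (\<Oplus>w\<in>words T n. A w s \<otimes> wprod (tm t) w))"
  using F
proof (induction rule: plt.induct)
  case (plt_zero f n)
  have wc: "wprod (tm t) w \<in> carrier K" if "t \<in> D" "w \<in> words T m" for t w m
    using wprod_closed[of T "tm t" w] tm(1) that by (auto simp: words_def)
  have "(\<Oplus>w\<in>words T n. \<zero> \<otimes> wprod (tm t) w) = (\<Oplus>w\<in>words T n. \<zero>)" if "t \<in> D" for t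
    by (rule finsum_cong') (use wc that in auto)
  thus ?case using plt_zero gp by (intro exI[of _ "\<lambda>_ _. \<zero>"]) (auto intro!: plt.plt_zero)
next
  case (plt_const a f n)
  have wc: "wprod (tm t) w \<in> carrier K" if "t \<in> D" "w \<in> words T m" for t w m
    using wprod_closed[of T "tm t" w] tm(1) that by (auto simp: words_def)
  let ?r = "replicate (Suc n) k0"
  define A where "A w = (\<lambda>_::'s \<Rightarrow> 'a. if ?r = w then a else \<zero>)" for w
  have r: "?r \<in> words T (Suc n)" using T(2) by (auto simp: words_def set_replicate_conv_if)
  have "f (g s t) = (\<Oplus>w\<in>words T (Suc n). A w s \<otimes> wprod (tm t) w)" if st: "s \<in> pts S" "t \<in> D" for s t
  proof -
    have "(\<Oplus>w\<in>words T (Suc n). A w s \<otimes> wprod (tm t) w) = (\<Oplus>w\<in>words T (Suc n). if ?r = w then a \<otimes> wprod (tm t) w else \<zero>)"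
      by (rule finsum_cong') (use wc[OF st(2)] plt_const.hyps(1) in \<open>auto simp: A_def\<close>)
    also have "\<dots> = a \<otimes> wprod (tm t) ?r"
      by (rule finsum_singleton) (use r finite_words[OF T(1)] wc[OF st(2)] plt_const.hyps(1) in auto)
    also have "wprod (tm t) ?r = \<one>" by (rule wprod_replicate) (rule tm(2)[OF st(2)])
    finally show ?thesis using plt_const gp[OF st] by simp
  qed
  moreover have "plt S (Suc n) (A w)" for w unfolding A_def by (rule plt_const') (use plt_const in auto)
  ultimately show ?case by (intro exI[of _ A]) auto
next
  case (plt_add n f f' h)
  have wc: "wprod (tm t) w \<in> carrier K" if "t \<in> D" "w \<in> words T m" for t w m
    using wprod_closed[of T "tm t" w] tm(1) that by (auto simp: words_def)
  obtain A where A: "\<And>w. w \<in> words T n \<Longrightarrow> plt S n (A w)"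
    "\<And>s t. s \<in> pts S \<Longrightarrow> t \<in> D \<Longrightarrow> f (g s t) = (\<Oplus>w\<in>words T n. A w s \<otimes> wprod (tm t) w)" using plt_add.IH by blast
  obtain A' where A': "\<And>w. w \<in> words T n \<Longrightarrow> plt S n (A' w)"
    "\<And>s t. s \<in> pts S \<Longrightarrow> t \<in> D \<Longrightarrow> f' (g s t) = (\<Oplus>w\<in>words T n. A' w s \<otimes> wprod (tm t) w)" using plt_add.IH by blast
  have "h (g s t) = (\<Oplus>w\<in>words T n. (A w s \<oplus> A' w s) \<otimes> wprod (tm t) w)" if st: "s \<in> pts S" "t \<in> D" for s t
  proof -
    have cl: "A w s \<in> carrier K" "A' w s \<in> carrier K" if "w \<in> words T n" for w
      using plt_closed[OF A(1)[OF that] st(1)] plt_closed[OF A'(1)[OF that] st(1)] .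
    have "(\<Oplus>w\<in>words T n. (A w s \<oplus> A' w s) \<otimes> wprod (tm t) w)
        = (\<Oplus>w\<in>words T n. A w s \<otimes> wprod (tm t) w \<oplus> A' w s \<otimes> wprod (tm t) w)"
      by (rule finsum_cong') (use cl wc[OF st(2)] in \<open>auto simp: l_distr\<close>)
    also have "\<dots> = f (g s t) \<oplus> f' (g s t)" unfolding A(2)[OF st] A'(2)[OF st]
      by (rule finsum_addf) (use cl wc[OF st(2)] in auto)
    finally show ?thesis using plt_add.hyps(3)[OF gp[OF st]] by simp
  qed
  moreover have "plt S n (\<lambda>s. A w s \<oplus> A' w s)" if "w \<in> words T n" for w
    by (rule plt.plt_add[OF A(1)[OF that] A'(1)[OF that]]) simp
  ultimately show ?case by (intro exI[of _ "\<lambda>w s. A w s \<oplus> A' w s"]) auto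
next
  case (plt_var_mult n f i h)
  have wc: "wprod (tm t) w \<in> carrier K" if "t \<in> D" "w \<in> words T m" for t w m
    using wprod_closed[of T "tm t" w] tm(1) that by (auto simp: words_def)
  obtain A where A: "\<And>w. w \<in> words T n \<Longrightarrow> plt S n (A w)"
    "\<And>s t. s \<in> pts S \<Longrightarrow> t \<in> D \<Longrightarrow> f (g s t) = (\<Oplus>w\<in>words T n. A w s \<otimes> wprod (tm t) w)" using plt_var_mult.IH by blast
  define A' where "A' w = (\<lambda>s. A (tl w) s \<otimes> c (hd w) i s)" for w
  have pA: "plt S (Suc n) (A' w)" if "w \<in> words T (Suc n)" for w
  proof -
    have "hd w \<in> T" "tl w \<in> words T n" using that by (auto simp: words_Suc)
    from plt_mult[OF c[OF this(1) plt_var_mult.hyps(2)] A(1)[OF this(2)]] show ?thesis by (simp add: A'_def)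
  qed
  have "h (g s t) = (\<Oplus>w\<in>words T (Suc n). A' w s \<otimes> wprod (tm t) w)" if st: "s \<in> pts S" "t \<in> D" for s t
  proof -
    have Acl: "A w s \<in> carrier K" if "w \<in> words T n" for w using plt_closed[OF A(1)[OF that] st(1)] .
    have ccl: "c k i s \<in> carrier K" if "k \<in> T" for k using plt_closed[OF c[OF that plt_var_mult.hyps(2)] st(1)] .
    have Wf: "finite (words T n)" using finite_words[OF T(1)] .
    have "(\<Oplus>w\<in>words T (Suc n). A' w s \<otimes> wprod (tm t) w)
        = (\<Oplus>z\<in>T \<times> words T n. A' (fst z # snd z) s \<otimes> wprod (tm t) (fst z # snd z))"
      unfolding words_Suc
    proof (rule finsum_reindex)
      show "(\<lambda>w. A' w s \<otimes> wprod (tm t) w) \<in> (\<lambda>z. fst z # snd z) ` (T \<times> words T n) \<rightarrow> carrier K"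
        using plt_closed[OF pA st(1)] wc[OF st(2)] unfolding words_Suc[symmetric] by auto
    qed (auto simp: inj_on_def)
    also have "\<dots> = (\<Oplus>z\<in>T \<times> words T n. (\<lambda>k w. (A w s \<otimes> c k i s) \<otimes> (tm t k \<otimes> wprod (tm t) w)) (fst z) (snd z))"
      by (simp add: A'_def)
    also have "\<dots> = (\<Oplus>k\<in>T. \<Oplus>w\<in>words T n. (A w s \<otimes> c k i s) \<otimes> (tm t k \<otimes> wprod (tm t) w))"
      by (rule finsum_Times[OF T(1) Wf]) (use Acl ccl tm(1)[OF st(2)] wc[OF st(2)] in auto)
    also have "\<dots> = (\<Oplus>k\<in>T. (c k i s \<otimes> tm t k) \<otimes> f (g s t))"
    proof (rule finsum_cong')
      fix k assume k: "k \<in> T"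
      have "(\<Oplus>w\<in>words T n. (A w s \<otimes> c k i s) \<otimes> (tm t k \<otimes> wprod (tm t) w))
          = (\<Oplus>w\<in>words T n. (c k i s \<otimes> tm t k) \<otimes> (A w s \<otimes> wprod (tm t) w))"
        by (rule finsum_cong') (use Acl ccl[OF k] tm(1)[OF st(2) k] wc[OF st(2)] in \<open>auto simp: m_ac\<close>)
      also have "\<dots> = (c k i s \<otimes> tm t k) \<otimes> f (g s t)" unfolding A(2)[OF st]
        by (rule finsum_rdistr[symmetric]) (use Wf Acl ccl[OF k] tm(1)[OF st(2) k] wc[OF st(2)] in auto)
      finally show "(\<Oplus>w\<in>words T n. (A w s \<otimes> c k i s) \<otimes> (tm t k \<otimes> wprod (tm t) w)) = (c k i s \<otimes> tm t k) \<otimes> f (g s t)" .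
    qed (use ccl tm(1)[OF st(2)] plt_closed[OF plt_var_mult.hyps(1) gp[OF st]] in auto)
    also have "\<dots> = (\<Oplus>k\<in>T. c k i s \<otimes> tm t k) \<otimes> f (g s t)"
      by (rule finsum_ldistr[symmetric]) (use T ccl tm(1)[OF st(2)] plt_closed[OF plt_var_mult.hyps(1) gp[OF st]] in auto)
    also have "\<dots> = h (g s t)" using g[OF st plt_var_mult.hyps(2)] plt_var_mult.hyps(3)[OF gp[OF st]] by simp
    finally show ?thesis by simp
  qed
  thus ?case using pA by (intro exI[of _ A']) auto
qed

section \<open>Counting tuples by their linear combinations\<close>

definition comb :: "'s set \<Rightarrow> 'k set \<Rightarrow> 'i set \<Rightarrow> ('s \<Rightarrow> 'a) \<Rightarrow> ('s \<times> 'k \<Rightarrow> 'i \<Rightarrow> 'a) \<Rightarrow> 'k \<Rightarrow> 'i \<Rightarrow> 'a" where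
  "comb S A I s y = (\<lambda>a\<in>A. \<lambda>i\<in>I. \<Oplus>r\<in>S. s r \<otimes> y (r, a) i)"

abbreviation tuples :: "'k set \<Rightarrow> 'i set \<Rightarrow> ('k \<Rightarrow> 'i \<Rightarrow> 'a) set" where "tuples A I \<equiv> A \<rightarrow>\<^sub>E pts I"

lemma card_pts: "finite I \<Longrightarrow> card (pts I) = q ^ card I" by (simp add: card_PiE)

lemma card_tuples: "finite A \<Longrightarrow> finite I \<Longrightarrow> card (tuples A I) = q ^ (card I * card A)"
  by (simp add: card_PiE card_pts power_mult)

lemma finite_tuples: "finite A \<Longrightarrow> finite I \<Longrightarrow> finite (tuples A I)"
  by (simp add: finite_PiE finite_pts)

lemma tuple_mem: "y \<in> tuples A I \<Longrightarrow> a \<in> A \<Longrightarrow> i \<in> I \<Longrightarrow> y a i \<in> carrier K"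
  using PiE_mem[of y A "\<lambda>_. pts I" a] pts_mem[of "y a" I i] by simp

lemma comb_tuple: "s \<in> pts S \<Longrightarrow> y \<in> tuples (S \<times> A) I \<Longrightarrow> comb S A I s y \<in> tuples A I"
proof -
  assume s: "s \<in> pts S" and y: "y \<in> tuples (S \<times> A) I"
  have "(\<Oplus>r\<in>S. s r \<otimes> y (r, a) i) \<in> carrier K" if "a \<in> A" "i \<in> I" for a i
    by (rule finsum_closed) (use tuple_mem[OF y] pts_mem[OF s] that in auto)
  thus ?thesis by (auto simp: comb_def)
qed

text \<open>
  For fixed \<open>s\<close> with \<open>s r \<noteq> 0\<close>, the tuple \<open>y\<close> is determined by its combination with coefficients \<open>s\<close> and by its
  components with first index other than \<open>r\<close>.
\<close>

lemma count_by_combinations: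
  assumes fin: "finite S" "finite A" "finite I" and G: "G \<subseteq> tuples (S \<times> A) I" and Z: "Z \<subseteq> tuples A I"
    and ex: "\<And>y. y \<in> G \<Longrightarrow> \<exists>s\<in>pts S. s \<noteq> origin S \<and> comb S A I s y \<in> Z"
  shows "card G \<le> q ^ card S * (card Z * q ^ (card I * ((card S - 1) * card A)))"
proof -
  define Y where "Y s = {y \<in> tuples (S \<times> A) I. comb S A I s y \<in> Z}" for s
  have finZ: "finite Z" using Z finite_tuples[OF fin(2,3)] finite_subset by blast
  have finY: "finite (Y s)" for s unfolding Y_def using finite_tuples[of "S \<times> A" I] fin by auto
  have cY: "card (Y s) \<le> card Z * q ^ (card I * ((card S - 1) * card A))" if s: "s \<in> pts S" "s \<noteq> origin S" for s
  proof -
    obtain r where r: "r \<in> S" "s r \<noteq> \<zero>"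
    proof -
      have "\<exists>r\<in>S. s r \<noteq> \<zero>"
      proof (rule ccontr)
        assume "\<not> (\<exists>r\<in>S. s r \<noteq> \<zero>)"
        hence "s = origin S" by (intro PiE_ext[OF s(1) origin_pts]) (auto simp: origin_def)
        thus False using s(2) by simp
      qed
      thus ?thesis using that by blast
    qed
    let ?R = "(S - {r}) \<times> A"
    let ?f = "\<lambda>y. (comb S A I s y, restrict y ?R)"
    have inj: "inj_on ?f (Y s)"
    proof (rule inj_onI)
      fix y z assume "y \<in> Y s" "z \<in> Y s" and e: "?f y = ?f z"
      hence y: "y \<in> tuples (S \<times> A) I" and z: "z \<in> tuples (S \<times> A) I" by (auto simp: Y_def)
      have e1: "comb S A I s y = comb S A I s z" and e2: "restrict y ?R = restrict z ?R" using e by auto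
      have same: "y (t, a) = z (t, a)" if "t \<in> S - {r}" "a \<in> A" for t a
        using fun_cong[OF e2, of "(t, a)"] that by auto
      show "y = z"
      proof (rule PiE_ext[OF y z])
        fix k assume "k \<in> S \<times> A"
        then obtain t a where k: "k = (t, a)" "t \<in> S" "a \<in> A" by auto
        show "y k = z k"
        proof (cases "t = r")
          case False thus ?thesis using same k by auto
        next
          case True
          have ins: "insert r (S - {r}) = S" using r by auto
          have "y (r, a) = z (r, a)"
          proof (rule PiE_ext)
            show "y (r, a) \<in> pts I" "z (r, a) \<in> pts I"
              using PiE_mem[OF y, of "(r, a)"] PiE_mem[OF z, of "(r, a)"] r k by auto
            fix i assume i: "i \<in> I"
            have sr: "s r \<in> carrier K" using pts_mem[OF s(1) r(1)] .
            have cl: "s t \<otimes> y (t, a) i \<in> carrier K" "s t \<otimes> z (t, a) i \<in> carrier K" if "t \<in> S" for t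
              using pts_mem[OF s(1) that] tuple_mem[OF y _ i, of "(t, a)"] tuple_mem[OF z _ i, of "(t, a)"] that k by auto
            have spl: "(\<Oplus>t\<in>S. s t \<otimes> w (t, a) i) = s r \<otimes> w (r, a) i \<oplus> (\<Oplus>t\<in>S - {r}. s t \<otimes> w (t, a) i)"
              if "\<And>t. t \<in> S \<Longrightarrow> s t \<otimes> w (t, a) i \<in> carrier K" for w
              using finsum_insert[of "S - {r}" r "\<lambda>t. s t \<otimes> w (t, a) i"] that fin(1) r(1) unfolding ins by auto
            have eqr: "(\<Oplus>t\<in>S - {r}. s t \<otimes> y (t, a) i) = (\<Oplus>t\<in>S - {r}. s t \<otimes> z (t, a) i)"
              by (rule finsum_cong') (use same k(3) cl in auto)
            have R: "(\<Oplus>t\<in>S - {r}. s t \<otimes> z (t, a) i) \<in> carrier K" by (rule finsum_closed) (use cl in auto)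
            have sp: "(\<Oplus>t\<in>S. s t \<otimes> y (t, a) i) = (\<Oplus>t\<in>S. s t \<otimes> z (t, a) i)"
              using fun_cong[OF fun_cong[OF e1, of a], of i] k i by (simp add: comb_def)
            have "s r \<otimes> y (r, a) i \<oplus> (\<Oplus>t\<in>S - {r}. s t \<otimes> z (t, a) i) = (\<Oplus>t\<in>S. s t \<otimes> y (t, a) i)"
              unfolding eqr[symmetric] by (rule spl[of y, OF cl(1), symmetric])
            also have "\<dots> = s r \<otimes> z (r, a) i \<oplus> (\<Oplus>t\<in>S - {r}. s t \<otimes> z (t, a) i)"
              unfolding sp by (rule spl[of z, OF cl(2)])
            finally have "s r \<otimes> y (r, a) i \<oplus> (\<Oplus>t\<in>S - {r}. s t \<otimes> z (t, a) i) = s r \<otimes> z (r, a) i \<oplus> (\<Oplus>t\<in>S - {r}. s t \<otimes> z (t, a) i)" .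
            hence "s r \<otimes> y (r, a) i = s r \<otimes> z (r, a) i"
              by (rule iffD1[OF add.right_cancel[OF R cl(1)[OF r(1)] cl(2)[OF r(1)]]])
            thus "y (r, a) i = z (r, a) i"
              using m_lcancel[OF r(2) sr, of "y (r, a) i" "z (r, a) i"] tuple_mem[OF y _ i, of "(r, a)"] tuple_mem[OF z _ i, of "(r, a)"] r k by auto
          qed
          thus ?thesis using k True by simp
        qed
      qed
    qed
    have im: "?f ` Y s \<subseteq> Z \<times> tuples ?R I"
    proof
      fix v assume "v \<in> ?f ` Y s"
      then obtain y where y: "y \<in> tuples (S \<times> A) I" "comb S A I s y \<in> Z" "v = ?f y" by (auto simp: Y_def)
      have "restrict y ?R \<in> tuples ?R I"
        using PiE_mem[OF y(1)] by (intro restrict_PiE_iff[THEN iffD2]) auto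
      thus "v \<in> Z \<times> tuples ?R I" using y by auto
    qed
    have finR: "finite ?R" using fin by auto
    have "card (Y s) \<le> card (Z \<times> tuples ?R I)"
      by (rule card_inj_on_le[OF inj im]) (use finZ finite_tuples[OF finR fin(3)] in auto)
    also have "\<dots> = card Z * q ^ (card I * ((card S - 1) * card A))"
      using card_tuples[OF finR fin(3)] fin r by (simp add: card_cartesian_product)
    finally show ?thesis .
  qed
  have "G \<subseteq> (\<Union>s\<in>pts S - {origin S}. Y s)"
  proof
    fix y assume y: "y \<in> G"
    from ex[OF y] obtain s where "s \<in> pts S" "s \<noteq> origin S" "comb S A I s y \<in> Z" by blast
    thus "y \<in> (\<Union>s\<in>pts S - {origin S}. Y s)" using y G by (auto simp: Y_def)
  qed
  hence "card G \<le> card (\<Union>s\<in>pts S - {origin S}. Y s)"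
    by (rule card_mono[rotated]) (use finY finite_pts[OF fin(1)] in auto)
  also have "\<dots> \<le> (\<Sum>s\<in>pts S - {origin S}. card (Y s))" by (rule card_UN_le) (use finite_pts[OF fin(1)] in auto)
  also have "\<dots> \<le> (\<Sum>s\<in>pts S - {origin S}. card Z * q ^ (card I * ((card S - 1) * card A)))"
    by (rule sum_mono) (use cY in auto)
  also have "\<dots> \<le> card (pts S) * (card Z * q ^ (card I * ((card S - 1) * card A)))"
    by (simp add: card_mono finite_pts[OF fin(1)] card_Diff_subset mult_right_mono)
  finally show ?thesis using card_pts[OF fin(1)] by simp
qed

section \<open>Extending affine maps into a variety\<close>

text \<open>
  The index set of an affine frame: \<open>None\<close> stands for the base point and \<open>Some j\<close> for the \<open>j\<close>-th
  direction.
\<close>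

definition frame_idx :: "'j set \<Rightarrow> 'j option set" where "frame_idx J = insert None (Some ` J)"

lemma frame_idx_simps [simp]: "None \<in> frame_idx J" "Some j \<in> frame_idx J \<longleftrightarrow> j \<in> J" "finite (frame_idx J) \<longleftrightarrow> finite J"
  by (auto simp: frame_idx_def finite_image_iff)

lemma card_frame_idx: "finite J \<Longrightarrow> card (frame_idx J) = Suc (card J)"
  by (simp add: frame_idx_def card_image)

lemma finsum_frame_idx:
  assumes "finite J" "\<And>k. k \<in> frame_idx J \<Longrightarrow> F k \<in> carrier K"
  shows "(\<Oplus>k\<in>frame_idx J. F k) = F None \<oplus> (\<Oplus>j\<in>J. F (Some j))"
proof -
  have "(\<Oplus>k\<in>frame_idx J. F k) = F None \<oplus> (\<Oplus>k\<in>Some ` J. F k)"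
    unfolding frame_idx_def by (rule finsum_insert) (use assms in auto)
  also have "(\<Oplus>k\<in>Some ` J. F k) = (\<Oplus>j\<in>J. F (Some j))"
    by (rule finsum_reindex) (use assms in auto)
  finally show ?thesis .
qed

lemma finsum_Plus:
  assumes "finite J" "finite A" "\<And>k. k \<in> Sum_Type.Plus J A \<Longrightarrow> F k \<in> carrier K"
  shows "(\<Oplus>k\<in>Sum_Type.Plus J A. F k) = (\<Oplus>j\<in>J. F (Inl j)) \<oplus> (\<Oplus>a\<in>A. F (Inr a))"
proof -
  have "(\<Oplus>k\<in>Sum_Type.Plus J A. F k) = (\<Oplus>k\<in>Inl ` J. F k) \<oplus> (\<Oplus>k\<in>Inr ` A. F k)"
    unfolding Plus_def by (rule finsum_Un_disjoint) (use assms in auto)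
  also have "(\<Oplus>k\<in>Inl ` J. F k) = (\<Oplus>j\<in>J. F (Inl j))"
    by (rule finsum_reindex) (use assms in auto)
  also have "(\<Oplus>k\<in>Inr ` A. F k) = (\<Oplus>a\<in>A. F (Inr a))"
    by (rule finsum_reindex) (use assms in auto)
  finally show ?thesis .
qed

definition frame_map :: "'j set \<Rightarrow> 'i set \<Rightarrow> ('j option \<Rightarrow> 'i \<Rightarrow> 'a) \<Rightarrow> ('j \<Rightarrow> 'a) \<Rightarrow> 'i \<Rightarrow> 'a" where
  "frame_map J I z t = (\<lambda>i\<in>I. z None i \<oplus> (\<Oplus>j\<in>J. t j \<otimes> z (Some j) i))"

text \<open>
  The affine map of a frame \<open>z\<close> extended by further directions \<open>x\<close>.
\<close>

definition ext_map :: "'j set \<Rightarrow> 'k set \<Rightarrow> 'i set \<Rightarrow> ('j option \<Rightarrow> 'i \<Rightarrow> 'a) \<Rightarrow> ('k \<Rightarrow> 'i \<Rightarrow> 'a) \<Rightarrow> ('j + 'k \<Rightarrow> 'a) \<Rightarrow> 'i \<Rightarrow> 'a" where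
  "ext_map J A I z x c = (\<lambda>i\<in>I. (z None i \<oplus> (\<Oplus>j\<in>J. c (Inl j) \<otimes> z (Some j) i)) \<oplus> (\<Oplus>a\<in>A. c (Inr a) \<otimes> x a i))"

lemma plt_lin:
  assumes "finite J" "\<And>j. j \<in> J \<Longrightarrow> u j \<in> carrier K" "\<And>j. j \<in> J \<Longrightarrow> plt T 2 (\<lambda>t. g j t)"
  shows "plt T 2 (\<lambda>t. \<Oplus>j\<in>J. g j t \<otimes> u j)"
proof (rule plt_cong[OF plt_sum[OF assms(1) plt_smult[OF assms(3,2)]]])
  fix x assume x: "x \<in> pts T"
  show "(\<Oplus>j\<in>J. g j x \<otimes> u j) = (\<Oplus>j\<in>J. u j \<otimes> g j x)"
    by (rule finsum_cong') (use assms(2) plt_closed[OF assms(3) x] in \<open>auto simp: m_comm\<close>)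
qed

lemma amap_frame_map:
  assumes J: "finite J" and z: "z \<in> tuples (frame_idx J) I" shows "amap J I (frame_map J I z)"
proof -
  have p: "plt J 2 (\<lambda>t. z None i \<oplus> (\<Oplus>j\<in>J. t j \<otimes> z (Some j) i))" if i: "i \<in> I" for i
  proof (rule plt_add)
    show "plt J 2 (\<lambda>t. z None i)" unfolding numeral_2_eq_2 by (rule plt_const') (use tuple_mem[OF z _ i] in simp)
    show "plt J 2 (\<lambda>t. \<Oplus>j\<in>J. t j \<otimes> z (Some j) i)"
      by (rule plt_lin[OF J]) (use tuple_mem[OF z _ i] plt_var in auto)
  qed simp
  show ?thesis unfolding amap_def
  proof (intro conjI ballI)
    fix t assume t: "t \<in> pts J" show "frame_map J I z t \<in> pts I" using plt_closed[OF p t] by (auto simp: frame_map_def)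
  next
    fix i assume i: "i \<in> I" show "plt J 2 (\<lambda>t. frame_map J I z t i)" using p[OF i] i by (simp add: frame_map_def)
  qed
qed

lemma amap_ext_map:
  assumes J: "finite J" "finite A" and z: "z \<in> tuples (frame_idx J) I" and x: "x \<in> tuples A I"
  shows "amap (Sum_Type.Plus J A) I (ext_map J A I z x)"
proof -
  have p: "plt (Sum_Type.Plus J A) 2 (\<lambda>c. (z None i \<oplus> (\<Oplus>j\<in>J. c (Inl j) \<otimes> z (Some j) i)) \<oplus> (\<Oplus>a\<in>A. c (Inr a) \<otimes> x a i))"
    if i: "i \<in> I" for i
  proof (rule plt_add)
    show "plt (Sum_Type.Plus J A) 2 (\<lambda>c. z None i \<oplus> (\<Oplus>j\<in>J. c (Inl j) \<otimes> z (Some j) i))"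
    proof (rule plt_add)
      show "plt (Sum_Type.Plus J A) 2 (\<lambda>c. z None i)" unfolding numeral_2_eq_2 by (rule plt_const') (use tuple_mem[OF z _ i] in simp)
      show "plt (Sum_Type.Plus J A) 2 (\<lambda>c. \<Oplus>j\<in>J. c (Inl j) \<otimes> z (Some j) i)"
        by (rule plt_lin[OF J(1)]) (use tuple_mem[OF z _ i] in \<open>auto intro: plt_var\<close>)
    qed simp
    show "plt (Sum_Type.Plus J A) 2 (\<lambda>c. \<Oplus>a\<in>A. c (Inr a) \<otimes> x a i)"
      by (rule plt_lin[OF J(2)]) (use tuple_mem[OF x _ i] in \<open>auto intro: plt_var\<close>)
  qed simp
  show ?thesis unfolding amap_def
  proof (intro conjI ballI)
    fix c assume c: "c \<in> pts (Sum_Type.Plus J A)" show "ext_map J A I z x c \<in> pts I" using plt_closed[OF p c] by (auto simp: ext_map_def)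
  next
    fix i assume i: "i \<in> I" show "plt (Sum_Type.Plus J A) 2 (\<lambda>c. ext_map J A I z x c i)" using p[OF i] i by (simp add: ext_map_def)
  qed
qed

lemma comb_origin: "y \<in> tuples (S \<times> A) I \<Longrightarrow> a \<in> A \<Longrightarrow> i \<in> I \<Longrightarrow> comb S A I (origin S) y a i = \<zero>"
proof -
  assume y: "y \<in> tuples (S \<times> A) I" and a: "a \<in> A" "i \<in> I"
  have "(\<Oplus>r\<in>S. origin S r \<otimes> y (r, a) i) = (\<Oplus>r\<in>S. \<zero>)"
    by (rule finsum_cong') (use tuple_mem[OF y _ a(2)] a in \<open>auto simp: origin_def\<close>)
  thus ?thesis using a by (simp add: comb_def)
qed

text \<open>
  Let \<open>y\<close> consist of \<open>N\<close> families of directions, and let \<open>s \<in> K\<^sup>N\<close>. The coefficients of \<open>P\<^sub>i\<close>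
  along the map extended by \<open>\<Sum>\<^sub>r s\<^sub>r y\<^sub>r\<close> are polynomials in \<open>s\<close> of degree at most \<open>d\<close>, and their number is bounded.
  Because \<open>N\<close> is large, there is \<open>s \<noteq> 0\<close> at which all of them take the same value as at \<open>s = 0\<close>, and for
  \<open>s = 0\<close> the image is contained in the variety. Every \<open>y\<close> has thus a non-trivial combination that is a good
  extension, which is possible only if there are many good extensions.
\<close>

lemma many_extensions:
  fixes J :: "'j set" and A :: "'k set" and I :: "'i set"
  assumes J: "finite J" and A: "finite A" and I: "finite I" and z: "z \<in> tuples (frame_idx J) I"
    and P: "\<And>i. i < L \<Longrightarrow> plt I (Suc d) (P i)"
    and Xs: "Xs = {x \<in> pts I. \<forall>i<L. P i x = \<zero>}" and zX: "\<And>t. t \<in> pts J \<Longrightarrow> frame_map J I z t \<in> Xs"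
    and N: "N = Suc (L * Suc (card J + card A) ^ Suc d * d)"
  shows "q ^ (card I * card A) \<le> q ^ N * card {x \<in> tuples A I. \<forall>c\<in>pts (Sum_Type.Plus J A). ext_map J A I z x c \<in> Xs}"
proof -
  let ?Good = "{x \<in> tuples A I. \<forall>c\<in>pts (Sum_Type.Plus J A). ext_map J A I z x c \<in> Xs}"
  define S where "S = {..<N}"
  have S: "finite S" "card S = N" by (simp_all add: S_def)
  define T where "T = frame_idx (Sum_Type.Plus J A)"
  have T: "finite T" "None \<in> T" "card T = Suc (card J + card A)"
    using J A by (simp_all add: T_def card_frame_idx card_Plus)
  have ex: "\<exists>s\<in>pts S. s \<noteq> origin S \<and> comb S A I s y \<in> ?Good" if y: "y \<in> tuples (S \<times> A) I" for y
  proof -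
    define cf where "cf k i s = (case k of None \<Rightarrow> z None i | Some (Inl j) \<Rightarrow> z (Some j) i | Some (Inr a) \<Rightarrow> (\<Oplus>r\<in>S. s r \<otimes> y (r, a) i))" for k i s
    define tm where "tm c k = (case k of None \<Rightarrow> \<one> | Some k \<Rightarrow> c k)" for c :: "'j + 'k \<Rightarrow> 'a" and k
    define g where "g s c = ext_map J A I z (comb S A I s y) c" for s c
    have pcf: "plt S 2 (cf k i)" if "k \<in> T" "i \<in> I" for k i
    proof (cases k)
      case None
      thus ?thesis unfolding cf_def numeral_2_eq_2 using tuple_mem[OF z _ that(2), of None] by (auto intro: plt_const')
    next
      case (Some k')
      show ?thesis
      proof (cases k')
        case (Inl j)
        thus ?thesis unfolding cf_def numeral_2_eq_2 using tuple_mem[OF z _ that(2), of "Some j"] that Some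
          by (auto intro!: plt_const' simp: T_def)
      next
        case (Inr a)
        hence a: "a \<in> A" using that Some by (auto simp: T_def)
        have "plt S 2 (\<lambda>s. \<Oplus>r\<in>S. s r \<otimes> y (r, a) i)"
          by (rule plt_lin[OF S(1)]) (use tuple_mem[OF y _ that(2)] a in \<open>auto intro: plt_var\<close>)
        moreover have "cf k i = (\<lambda>s. \<Oplus>r\<in>S. s r \<otimes> y (r, a) i)" using Some Inr by (auto simp: cf_def)
        ultimately show ?thesis by simp
      qed
    qed
    have tmc: "tm c k \<in> carrier K" if "c \<in> pts (Sum_Type.Plus J A)" "k \<in> T" for c k
      using that pts_mem[OF that(1)] by (auto simp: tm_def T_def split: option.split)
    have gp: "g s c \<in> pts I" if "s \<in> pts S" "c \<in> pts (Sum_Type.Plus J A)" for s c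
      unfolding g_def using amap_pts[OF amap_ext_map[OF J A z comb_tuple[OF that(1) y]] that(2)] .
    have ge: "g s c i = (\<Oplus>k\<in>T. cf k i s \<otimes> tm c k)" if s: "s \<in> pts S" and c: "c \<in> pts (Sum_Type.Plus J A)" and i: "i \<in> I" for s c i
    proof -
      have cl: "cf k i s \<otimes> tm c k \<in> carrier K" if "k \<in> T" for k
        using plt_closed[OF pcf[OF that i] s] tmc[OF c that] by simp
      have cJA: "\<And>j. j \<in> J \<Longrightarrow> c (Inl j) \<in> carrier K" "\<And>a. a \<in> A \<Longrightarrow> c (Inr a) \<in> carrier K"
        using pts_mem[OF c InlI] pts_mem[OF c InrI] by simp_all
      have ct: "comb S A I s y \<in> tuples A I" by (rule comb_tuple[OF s y])
      have "(\<Oplus>k\<in>T. cf k i s \<otimes> tm c k) = cf None i s \<otimes> tm c None \<oplus> (\<Oplus>k\<in>Sum_Type.Plus J A. cf (Some k) i s \<otimes> tm c (Some k))"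
        unfolding T_def by (rule finsum_frame_idx) (use J A cl in \<open>auto simp: T_def\<close>)
      also have "(\<Oplus>k\<in>Sum_Type.Plus J A. cf (Some k) i s \<otimes> tm c (Some k)) =
          (\<Oplus>j\<in>J. cf (Some (Inl j)) i s \<otimes> tm c (Some (Inl j))) \<oplus> (\<Oplus>a\<in>A. cf (Some (Inr a)) i s \<otimes> tm c (Some (Inr a)))"
        by (rule finsum_Plus[OF J A]) (use cl in \<open>auto simp: T_def\<close>)
      also have "(\<Oplus>j\<in>J. cf (Some (Inl j)) i s \<otimes> tm c (Some (Inl j))) = (\<Oplus>j\<in>J. c (Inl j) \<otimes> z (Some j) i)"
        by (rule finsum_cong') (use tuple_mem[OF z _ i] cJA in \<open>auto simp: cf_def tm_def m_comm\<close>)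
      also have "(\<Oplus>a\<in>A. cf (Some (Inr a)) i s \<otimes> tm c (Some (Inr a))) = (\<Oplus>a\<in>A. c (Inr a) \<otimes> comb S A I s y a i)"
      proof (rule finsum_cong')
        fix a assume a: "a \<in> A"
        have "cf (Some (Inr a)) i s = comb S A I s y a i" using a i by (simp add: cf_def comb_def)
        moreover have "c (Inr a) \<in> carrier K" using cJA a by auto
        ultimately show "cf (Some (Inr a)) i s \<otimes> tm c (Some (Inr a)) = c (Inr a) \<otimes> comb S A I s y a i"
          using tuple_mem[OF ct a i] by (simp add: tm_def m_comm)
      qed (use tuple_mem[OF ct _ i] cJA in auto)
      also have "cf None i s \<otimes> tm c None = z None i" using tuple_mem[OF z _ i] by (simp add: cf_def tm_def)
      finally have 1: "(\<Oplus>k\<in>T. cf k i s \<otimes> tm c k) =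
         z None i \<oplus> ((\<Oplus>j\<in>J. c (Inl j) \<otimes> z (Some j) i) \<oplus> (\<Oplus>a\<in>A. c (Inr a) \<otimes> comb S A I s y a i))" .
      have "z None i \<in> carrier K" "(\<Oplus>j\<in>J. c (Inl j) \<otimes> z (Some j) i) \<in> carrier K"
        "(\<Oplus>a\<in>A. c (Inr a) \<otimes> comb S A I s y a i) \<in> carrier K"
        using tuple_mem[OF z _ i] tuple_mem[OF ct _ i] cJA by (auto intro!: finsum_closed)
      thus ?thesis unfolding 1 g_def ext_map_def using i by (simp add: a_assoc)
    qed
    have sep: "\<exists>A'. (\<forall>w\<in>words T (Suc d). plt S (Suc d) (A' w)) \<and>
       (\<forall>s\<in>pts S. \<forall>c\<in>pts (Sum_Type.Plus J A). P i (g s c) = (\<Oplus>w\<in>words T (Suc d). A' w s \<otimes> wprod (tm c) w))" if "i < L" for i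
      by (rule plt_separate[OF T(1,2) tmc _ pcf gp ge P[OF that]]) (simp_all add: tm_def)
    obtain A' where A': "\<And>i w. i < L \<Longrightarrow> w \<in> words T (Suc d) \<Longrightarrow> plt S (Suc d) (A' i w)"
      "\<And>i s c. i < L \<Longrightarrow> s \<in> pts S \<Longrightarrow> c \<in> pts (Sum_Type.Plus J A) \<Longrightarrow> P i (g s c) = (\<Oplus>w\<in>words T (Suc d). A' i w s \<otimes> wprod (tm c) w)"
    proof -
      have "\<forall>i\<in>{..<L}. \<exists>A'. (\<forall>w\<in>words T (Suc d). plt S (Suc d) (A' w)) \<and>
       (\<forall>s\<in>pts S. \<forall>c\<in>pts (Sum_Type.Plus J A). P i (g s c) = (\<Oplus>w\<in>words T (Suc d). A' w s \<otimes> wprod (tm c) w))" using sep by simp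
      from bchoice[OF this] obtain A' where "\<forall>i\<in>{..<L}. (\<forall>w\<in>words T (Suc d). plt S (Suc d) (A' i w)) \<and>
       (\<forall>s\<in>pts S. \<forall>c\<in>pts (Sum_Type.Plus J A). P i (g s c) = (\<Oplus>w\<in>words T (Suc d). A' i w s \<otimes> wprod (tm c) w))" by (rule exE)
      thus ?thesis using that[of A'] by simp
    qed
    \<comment> \<open>The equations: the coefficient of \<open>P\<^sub>i\<close> at each word is the same at \<open>s\<close> as at the origin.\<close>
    define h where "h iw s = A' (fst iw) (snd iw) s \<ominus> A' (fst iw) (snd iw) (origin S)" for iw s
    let ?Ix = "{..<L} \<times> words T (Suc d)"
    have A'c: "A' i w s \<in> carrier K" if "i < L" "w \<in> words T (Suc d)" "s \<in> pts S" for i w s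
      using plt_closed[OF A'(1)[OF that(1,2)] that(3)] .
    have "\<exists>s\<in>pts S. s \<noteq> origin S \<and> (\<forall>iw\<in>?Ix. h iw s = \<zero>)"
    proof (rule chevalley)
      show "finite ?Ix" using finite_words[OF T(1)] by simp
      show "plt S (Suc d) (h iw)" if "iw \<in> ?Ix" for iw
        unfolding h_def by (rule plt_diff_const) (use that A' A'c in auto)
      show "h iw (origin S) = \<zero>" if "iw \<in> ?Ix" for iw
        unfolding h_def using that A'c[of "fst iw" "snd iw" "origin S"] by (auto simp: minus_eq r_neg)
      have "card ?Ix = L * Suc (card J + card A) ^ Suc d" using card_words[OF T(1)] T(3) by (simp only: card_cartesian_product card_lessThan)
      thus "card ?Ix * d < card S" unfolding S(2) N by simp
    qed (rule S(1))
    then obtain s where s: "s \<in> pts S" "s \<noteq> origin S" "\<And>iw. iw \<in> ?Ix \<Longrightarrow> h iw s = \<zero>" by blast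
    have eqA: "A' i w s = A' i w (origin S)" if "i < L" "w \<in> words T (Suc d)" for i w
      using s(3)[of "(i, w)"] that A'c[OF that s(1)] A'c[OF that origin_pts] by (simp add: h_def)
    have "comb S A I s y \<in> ?Good"
    proof -
      have "g s c \<in> Xs" if c: "c \<in> pts (Sum_Type.Plus J A)" for c
      proof -
        have cJA: "\<And>j. j \<in> J \<Longrightarrow> c (Inl j) \<in> carrier K" "\<And>a. a \<in> A \<Longrightarrow> c (Inr a) \<in> carrier K"
          using pts_mem[OF c InlI] pts_mem[OF c InrI] by simp_all
        have "P i (g s c) = \<zero>" if i: "i < L" for i
        proof -
          have wc: "wprod (tm c) w \<in> carrier K" if "w \<in> words T (Suc d)" for w
            using wprod_closed[of T "tm c" w] tmc[OF c] that by (auto simp: words_def)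
          have "P i (g s c) = (\<Oplus>w\<in>words T (Suc d). A' i w s \<otimes> wprod (tm c) w)" by (rule A'(2)[OF i s(1) c])
          also have "\<dots> = (\<Oplus>w\<in>words T (Suc d). A' i w (origin S) \<otimes> wprod (tm c) w)"
            by (rule finsum_cong') (use eqA[OF i] A'c[OF i _ origin_pts] wc in auto)
          also have "\<dots> = P i (g (origin S) c)" by (rule A'(2)[OF i origin_pts c, symmetric])
          also have "g (origin S) c = frame_map J I z (\<lambda>j\<in>J. c (Inl j))"
          proof
            fix b
            show "g (origin S) c b = frame_map J I z (\<lambda>j\<in>J. c (Inl j)) b"
            proof (cases "b \<in> I")
              case b: True
              have "(\<Oplus>a\<in>A. c (Inr a) \<otimes> comb S A I (origin S) y a b) = (\<Oplus>a\<in>A. \<zero>)"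
                by (rule finsum_cong') (use comb_origin[OF y _ b] cJA in auto)
              moreover have "(\<Oplus>j\<in>J. (\<lambda>j\<in>J. c (Inl j)) j \<otimes> z (Some j) b) = (\<Oplus>j\<in>J. c (Inl j) \<otimes> z (Some j) b)"
                by (rule finsum_cong') (use tuple_mem[OF z _ b] cJA in auto)
              moreover have "z None b \<in> carrier K" "(\<Oplus>j\<in>J. c (Inl j) \<otimes> z (Some j) b) \<in> carrier K"
                using tuple_mem[OF z _ b] cJA by (auto intro!: finsum_closed)
              ultimately show ?thesis using b by (simp add: g_def ext_map_def frame_map_def)
            qed (simp add: g_def ext_map_def frame_map_def)
          qed
          also have "P i (frame_map J I z (\<lambda>j\<in>J. c (Inl j))) = \<zero>"
            using zX[of "\<lambda>j\<in>J. c (Inl j)"] cJA i Xs by auto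
          finally show ?thesis .
        qed
        thus ?thesis using gp[OF s(1) c] Xs by simp
      qed
      thus ?thesis using comb_tuple[OF s(1) y] by (simp add: g_def)
    qed
    thus ?thesis using s(1,2) by blast
  qed
  have "card (tuples (S \<times> A) I) \<le> q ^ card S * (card ?Good * q ^ (card I * ((card S - 1) * card A)))"
    by (rule count_by_combinations[OF S(1) A I order_refl _ ex]) auto
  moreover have "card (tuples (S \<times> A) I) = q ^ (card I * (N * card A))"
    using card_tuples[of "S \<times> A" I] S A I by (simp add: card_cartesian_product)
  moreover have "card I * (N * card A) = card I * card A + card I * ((N - 1) * card A)"
    unfolding N by (simp add: algebra_simps)
  ultimately have "q ^ (card I * card A) * q ^ (card I * ((N - 1) * card A))
      \<le> (q ^ N * card ?Good) * q ^ (card I * ((N - 1) * card A))"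
    unfolding S(2) by (simp only: power_add mult.assoc)
  moreover have "0 < q ^ (card I * ((N - 1) * card A))" using q_ge_2 by simp
  ultimately show ?thesis by (simp only: mult_le_cancel2)
qed

definition tuple_add :: "'k set \<Rightarrow> 'i set \<Rightarrow> ('k \<Rightarrow> 'i \<Rightarrow> 'a) \<Rightarrow> ('k \<Rightarrow> 'i \<Rightarrow> 'a) \<Rightarrow> 'k \<Rightarrow> 'i \<Rightarrow> 'a" where
  "tuple_add A I z y = (\<lambda>a\<in>A. \<lambda>i\<in>I. z a i \<oplus> y a i)"

lemma tuple_add_tuple: "z \<in> tuples A I \<Longrightarrow> y \<in> tuples A I \<Longrightarrow> tuple_add A I z y \<in> tuples A I"
proof -
  assume z: "z \<in> tuples A I" and y: "y \<in> tuples A I"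
  have "z a i \<oplus> y a i \<in> carrier K" if "a \<in> A" "i \<in> I" for a i
    using tuple_mem[OF z that] tuple_mem[OF y that] by simp
  thus ?thesis by (auto simp: tuple_add_def)
qed

lemma inj_tuple_add: assumes z: "z \<in> tuples A I" shows "inj_on (tuple_add A I z) (tuples A I)"
proof (rule inj_onI)
  fix x y assume x: "x \<in> tuples A I" and y: "y \<in> tuples A I" and e: "tuple_add A I z x = tuple_add A I z y"
  show "x = y"
  proof (rule PiE_ext[OF x y])
    fix a assume a: "a \<in> A"
    show "x a = y a"
    proof (rule PiE_ext)
      show "x a \<in> pts I" "y a \<in> pts I" using PiE_mem[OF x a] PiE_mem[OF y a] .
      fix i assume i: "i \<in> I"
      have "z a i \<oplus> x a i = z a i \<oplus> y a i" using fun_cong[OF fun_cong[OF e, of a], of i] a i by (simp add: tuple_add_def)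
      thus "x a i = y a i" using tuple_mem[OF z a i] tuple_mem[OF x a i] tuple_mem[OF y a i] by simp
    qed
  qed
qed

section \<open>Perturbing an affine map\<close>

text \<open>
  The coordinates, with respect to the extended map, of the point with parameter \<open>t\<close> on the frame perturbed by
  \<open>\<Sum>\<^sub>r \<sigma>\<^sub>r x\<^sub>r\<close>. They are affine in \<open>\<sigma>\<close> for every fixed \<open>t\<close>.
\<close>

definition scaled :: "'j set \<Rightarrow> nat \<Rightarrow> (nat \<Rightarrow> 'a) \<Rightarrow> ('j \<Rightarrow> 'a) \<Rightarrow> 'j + nat \<times> 'j option \<Rightarrow> 'a" where
  "scaled J m \<sigma> t = (\<lambda>k\<in>Sum_Type.Plus J ({..m} \<times> frame_idx J). case k of Inl j \<Rightarrow> t j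
     | Inr ro \<Rightarrow> (case snd ro of None \<Rightarrow> \<sigma> (fst ro) | Some j \<Rightarrow> \<sigma> (fst ro) \<otimes> t j))"

lemma amap_scaled:
  assumes "t \<in> pts J" shows "amap {..m} (Sum_Type.Plus J ({..m} \<times> frame_idx J)) (\<lambda>\<sigma>. scaled J m \<sigma> t)"
proof -
  have p: "plt {..m} 2 (\<lambda>\<sigma>. scaled J m \<sigma> t k)" if k: "k \<in> Sum_Type.Plus J ({..m} \<times> frame_idx J)" for k
  proof (cases k)
    case (Inl j)
    hence "t j \<in> carrier K" using k pts_mem[OF assms] by auto
    hence "plt {..m} 2 (\<lambda>\<sigma>. t j)" unfolding numeral_2_eq_2 by (rule plt_const')
    moreover have "scaled J m \<sigma> t k = t j" for \<sigma> using Inl k by (simp add: scaled_def)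
    ultimately show ?thesis by simp
  next
    case (Inr ro)
    obtain r u where ro: "ro = (r, u)" by (cases ro)
    hence ru: "r \<in> {..m}" "u \<in> frame_idx J" using k Inr by auto
    show ?thesis
    proof (cases u)
      case None thus ?thesis using Inr ro k ru by (simp add: scaled_def plt_var)
    next
      case (Some j)
      hence tj: "t j \<in> carrier K" using ru pts_mem[OF assms] by auto
      have "plt {..m} 2 (\<lambda>\<sigma>. t j \<otimes> \<sigma> r)" by (rule plt_smult[OF plt_var[OF ru(1)] tj])
      thus ?thesis
      proof (rule plt_cong)
        fix \<sigma> assume s: "\<sigma> \<in> pts {..m}"
        show "scaled J m \<sigma> t k = t j \<otimes> \<sigma> r"
          using Some Inr ro k m_comm[OF tj pts_mem[OF s ru(1)]] by (simp add: scaled_def)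
      qed
    qed
  qed
  show ?thesis unfolding amap_def
  proof (intro conjI ballI)
    fix \<sigma> assume s: "\<sigma> \<in> pts {..m}"
    have "scaled J m \<sigma> t k \<in> carrier K" if "k \<in> Sum_Type.Plus J ({..m} \<times> frame_idx J)" for k using plt_closed[OF p[OF that] s] .
    thus "scaled J m \<sigma> t \<in> pts (Sum_Type.Plus J ({..m} \<times> frame_idx J))"
      by (intro PiE_I) (auto simp: scaled_def)
  qed (rule p)
qed

lemma frame_map_perturb:
  assumes J: "finite J" and z: "z \<in> tuples (frame_idx J) I" and x: "x \<in> tuples ({..m} \<times> frame_idx J) I"
    and \<sigma>: "\<sigma> \<in> pts {..m}" and t: "t \<in> pts J"
  shows "frame_map J I (tuple_add (frame_idx J) I z (comb {..m} (frame_idx J) I \<sigma> x)) t = ext_map J ({..m} \<times> frame_idx J) I z x (scaled J m \<sigma> t)"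
proof
  fix i
  show "frame_map J I (tuple_add (frame_idx J) I z (comb {..m} (frame_idx J) I \<sigma> x)) t i = ext_map J ({..m} \<times> frame_idx J) I z x (scaled J m \<sigma> t) i"
  proof (cases "i \<in> I")
    case i: True
    define C where "C u = (\<Oplus>r\<in>{..m}. \<sigma> r \<otimes> x (r, u) i)" for u
    have xc: "x (r, u) i \<in> carrier K" if "r \<in> {..m}" "u \<in> frame_idx J" for r u using tuple_mem[OF x _ i, of "(r, u)"] that by simp
    have sc: "\<sigma> r \<in> carrier K" if "r \<in> {..m}" for r using pts_mem[OF \<sigma> that] .
    have tc: "t j \<in> carrier K" if "j \<in> J" for j using pts_mem[OF t that] .
    have zc: "z u i \<in> carrier K" if "u \<in> frame_idx J" for u using tuple_mem[OF z that i] .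
    have Cc: "C u \<in> carrier K" if "u \<in> frame_idx J" for u unfolding C_def by (rule finsum_closed) (use xc sc that in auto)
    let ?k = "scaled J m \<sigma> t"
    have kI: "?k (Inl j) = t j" if "j \<in> J" for j using that by (simp add: scaled_def InlI)
    have kN: "?k (Inr (r, None)) = \<sigma> r" if "r \<in> {..m}" for r using that by (simp add: scaled_def InrI)
    have kS: "?k (Inr (r, Some j)) = \<sigma> r \<otimes> t j" if "r \<in> {..m}" "j \<in> J" for r j using that by (simp add: scaled_def InrI)
    have kc: "?k (Inr (r, u)) \<in> carrier K" if "r \<in> {..m}" "u \<in> frame_idx J" for r u
      by (rule pts_mem[OF amap_pts[OF amap_scaled[OF t] \<sigma>]]) (use that in auto)
    have "(\<Oplus>a\<in>{..m} \<times> frame_idx J. ?k (Inr a) \<otimes> x a i)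
        = (\<Oplus>a\<in>{..m} \<times> frame_idx J. (\<lambda>r u. ?k (Inr (r, u)) \<otimes> x (r, u) i) (fst a) (snd a))" by simp
    also have "\<dots> = (\<Oplus>r\<in>{..m}. \<Oplus>u\<in>frame_idx J. ?k (Inr (r, u)) \<otimes> x (r, u) i)"
      by (rule finsum_Times) (use J kc xc in auto)
    also have "\<dots> = (\<Oplus>u\<in>frame_idx J. \<Oplus>r\<in>{..m}. ?k (Inr (r, u)) \<otimes> x (r, u) i)"
      by (rule finsum_swap) (use J kc xc in auto)
    also have "\<dots> = (\<Oplus>r\<in>{..m}. ?k (Inr (r, None)) \<otimes> x (r, None) i) \<oplus> (\<Oplus>j\<in>J. \<Oplus>r\<in>{..m}. ?k (Inr (r, Some j)) \<otimes> x (r, Some j) i)"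
      by (rule finsum_frame_idx[OF J]) (use kc xc in \<open>auto intro!: finsum_closed\<close>)
    also have "(\<Oplus>r\<in>{..m}. ?k (Inr (r, None)) \<otimes> x (r, None) i) = C None"
      unfolding C_def by (rule finsum_cong') (use kN sc xc in auto)
    also have "(\<Oplus>j\<in>J. \<Oplus>r\<in>{..m}. ?k (Inr (r, Some j)) \<otimes> x (r, Some j) i) = (\<Oplus>j\<in>J. t j \<otimes> C (Some j))"
    proof (rule finsum_cong')
      fix j assume j: "j \<in> J"
      have "(\<Oplus>r\<in>{..m}. ?k (Inr (r, Some j)) \<otimes> x (r, Some j) i) = (\<Oplus>r\<in>{..m}. t j \<otimes> (\<sigma> r \<otimes> x (r, Some j) i))"
      proof (rule finsum_cong')
        fix r assume r: "r \<in> {..m}"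
        show "?k (Inr (r, Some j)) \<otimes> x (r, Some j) i = t j \<otimes> (\<sigma> r \<otimes> x (r, Some j) i)"
          unfolding kS[OF r j] using sc[OF r] tc[OF j] xc[OF r, of "Some j"] j by (simp add: m_ac)
      qed (use sc tc xc j in auto)
      also have "\<dots> = t j \<otimes> C (Some j)" unfolding C_def
        by (rule finsum_rdistr[symmetric]) (use sc tc xc j in auto)
      finally show "(\<Oplus>r\<in>{..m}. ?k (Inr (r, Some j)) \<otimes> x (r, Some j) i) = t j \<otimes> C (Some j)" .
    qed (use tc Cc in auto)
    finally have R: "(\<Oplus>a\<in>{..m} \<times> frame_idx J. ?k (Inr a) \<otimes> x a i) = C None \<oplus> (\<Oplus>j\<in>J. t j \<otimes> C (Some j))" .
    have R2: "(\<Oplus>j\<in>J. ?k (Inl j) \<otimes> z (Some j) i) = (\<Oplus>j\<in>J. t j \<otimes> z (Some j) i)"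
      by (rule finsum_cong') (use kI tc zc in auto)
    have L: "tuple_add (frame_idx J) I z (comb {..m} (frame_idx J) I \<sigma> x) u i = z u i \<oplus> C u" if "u \<in> frame_idx J" for u
      using that i by (simp add: tuple_add_def comb_def C_def)
    have "(\<Oplus>j\<in>J. t j \<otimes> tuple_add (frame_idx J) I z (comb {..m} (frame_idx J) I \<sigma> x) (Some j) i)
        = (\<Oplus>j\<in>J. t j \<otimes> z (Some j) i \<oplus> t j \<otimes> C (Some j))"
      by (rule finsum_cong') (use L tc zc Cc in \<open>auto simp: r_distr\<close>)
    also have "\<dots> = (\<Oplus>j\<in>J. t j \<otimes> z (Some j) i) \<oplus> (\<Oplus>j\<in>J. t j \<otimes> C (Some j))"
      by (rule finsum_addf) (use tc zc Cc in auto)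
    finally have L2: "(\<Oplus>j\<in>J. t j \<otimes> tuple_add (frame_idx J) I z (comb {..m} (frame_idx J) I \<sigma> x) (Some j) i)
        = (\<Oplus>j\<in>J. t j \<otimes> z (Some j) i) \<oplus> (\<Oplus>j\<in>J. t j \<otimes> C (Some j))" .
    have cl: "(\<Oplus>j\<in>J. t j \<otimes> z (Some j) i) \<in> carrier K" "(\<Oplus>j\<in>J. t j \<otimes> C (Some j)) \<in> carrier K"
      using tc zc Cc by (auto intro!: finsum_closed)
    show ?thesis unfolding frame_map_def ext_map_def using i cl zc[of None] Cc[of None] by (simp add: L L2 R R2 a_ac)
  qed (simp add: frame_map_def ext_map_def)
qed

text \<open>
  Fix a non-vanishing moment that shows \<open>F\<close> to have degree at least \<open>m\<close> on the frame \<open>z\<close>. The same moment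
  along the frame perturbed by \<open>\<sigma>\<close> is a polynomial in \<open>\<sigma>\<close> of degree at most \<open>m\<close>, since \<open>F\<close> is one on the extended
  frame. It is non-zero at \<open>\<sigma> = 0\<close>, hence also somewhere else, as there are \<open>m + 1\<close> variables.
\<close>

lemma bad_perturbation:
  assumes J: "finite J" and z: "z \<in> tuples (frame_idx J) I" and x: "x \<in> tuples ({..m} \<times> frame_idx J) I"
    and H: "plt (Sum_Type.Plus J ({..m} \<times> frame_idx J)) (Suc m) (\<lambda>c. F (ext_map J ({..m} \<times> frame_idx J) I z x c))"
    and z0: "\<not> plt J m (\<lambda>t. F (frame_map J I z t))" "\<And>t. t \<in> pts J \<Longrightarrow> F (frame_map J I z t) \<in> carrier K"
  shows "\<exists>\<sigma>\<in>pts {..m}. \<sigma> \<noteq> origin {..m} \<and>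
    \<not> plt J m (\<lambda>t. F (frame_map J I (tuple_add (frame_idx J) I z (comb {..m} (frame_idx J) I \<sigma> x)) t))"
proof -
  let ?z = "\<lambda>\<sigma>. tuple_add (frame_idx J) I z (comb {..m} (frame_idx J) I \<sigma> x)"
  obtain b where b: "sum b J + m \<le> card J * (q - 1)" "moment J b (\<lambda>t. F (frame_map J I z t)) \<noteq> \<zero>"
  proof (rule ccontr)
    assume n: "\<not> thesis"
    have "plt J m (\<lambda>t. F (frame_map J I z t))"
    proof (rule plt_of_moments[OF J z0(2)])
      fix b assume "sum b J + m \<le> card J * (q - 1)"
      thus "moment J b (\<lambda>t. F (frame_map J I z t)) = \<zero>" using n that by (cases "moment J b (\<lambda>t. F (frame_map J I z t)) = \<zero>") simp_all
    qed
    with z0(1) show False by (rule notE)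
  qed
  define G where "G \<sigma> = moment J b (\<lambda>t. F (frame_map J I (?z \<sigma>) t))" for \<sigma>
  have pt: "plt {..m} (Suc m) (\<lambda>\<sigma>. mono J b t \<otimes> F (frame_map J I (?z \<sigma>) t))" if t: "t \<in> pts J" for t
  proof (rule plt_smult[OF _ mono_closed[OF t]])
    show "plt {..m} (Suc m) (\<lambda>\<sigma>. F (frame_map J I (?z \<sigma>) t))"
      by (rule plt_cong[OF plt_amap[OF H amap_scaled[OF t]]]) (simp only: frame_map_perturb[OF J z x _ t])
  qed
  have "plt {..m} (Suc m) (\<lambda>\<sigma>. \<Oplus>t\<in>pts J. mono J b t \<otimes> F (frame_map J I (?z \<sigma>) t))"
    by (rule plt_sum[OF finite_pts[OF J] pt])
  hence pG: "plt {..m} (Suc m) G"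
  proof (rule plt_cong)
    fix \<sigma> assume s: "\<sigma> \<in> pts {..m}"
    have "F (frame_map J I (?z \<sigma>) t) \<in> carrier K" if t: "t \<in> pts J" for t
      unfolding frame_map_perturb[OF J z x s t] by (rule plt_closed[OF H amap_pts[OF amap_scaled[OF t] s]])
    hence c: "F (frame_map J I (?z \<sigma>) t) \<otimes> mono J b t = mono J b t \<otimes> F (frame_map J I (?z \<sigma>) t)"
      "mono J b t \<otimes> F (frame_map J I (?z \<sigma>) t) \<in> carrier K" if "t \<in> pts J" for t
      using that mono_closed[OF that] by (simp_all add: m_comm)
    show "G \<sigma> = (\<Oplus>t\<in>pts J. mono J b t \<otimes> F (frame_map J I (?z \<sigma>) t))"
      unfolding G_def moment_def by (rule finsum_cong') (rule refl, rule Pi_I, rule c(2), assumption, rule c(1))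
  qed
  have "?z (origin {..m}) = z"
  proof (rule PiE_ext[OF tuple_add_tuple[OF z comb_tuple[OF origin_pts x]] z])
    fix u assume u: "u \<in> frame_idx J"
    show "?z (origin {..m}) u = z u"
    proof (rule PiE_ext)
      show "?z (origin {..m}) u \<in> pts I" using PiE_mem[OF tuple_add_tuple[OF z comb_tuple[OF origin_pts x]] u] .
      show "z u \<in> pts I" using PiE_mem[OF z u] .
      fix i assume i: "i \<in> I"
      show "?z (origin {..m}) u i = z u i" using comb_origin[OF x u i] tuple_mem[OF z u i] u i by (simp add: tuple_add_def)
    qed
  qed
  hence G0: "G (origin {..m}) \<noteq> \<zero>" using b(2) by (simp add: G_def)
  have "Suc m * 1 \<le> card {..m} * (q - 1)" using q_ge_2 unfolding card_atMost by (intro mult_left_mono) auto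
  hence dm: "Suc m \<le> card {..m} * (q - 1)" by (simp only: mult_1_right)
  obtain \<sigma> where s: "\<sigma> \<in> pts {..m}" "\<sigma> \<noteq> origin {..m}" "G \<sigma> \<noteq> \<zero>"
    using sum_only_origin[OF finite_atMost pG dm G0] by (elim bexE conjE) (rule that; assumption)
  have "\<not> plt J m (\<lambda>t. F (frame_map J I (?z \<sigma>) t))"
  proof
    assume "plt J m (\<lambda>t. F (frame_map J I (?z \<sigma>) t))"
    from moment_plt_zero[OF J this b(1)] s(3) show False unfolding G_def by simp
  qed
  thus ?thesis using s(1,2) by (intro bexI[of _ \<sigma>] conjI)
qed

text \<open>
  The directions of a frame that is not injective have a non-trivial linear combination equal to zero. The base point is
  arbitrary.
\<close>

lemma count_dependent:
  fixes J :: "'j set" and I :: "'i set"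
  assumes J: "finite J" "J \<noteq> {}" and I: "finite I"
  shows "card {z \<in> tuples (frame_idx J) I. \<not> inj_on (frame_map J I z) (pts J)} \<le> q ^ (card J + card I * card J)"
proof -
  let ?N = "{z \<in> tuples (frame_idx J) I. \<not> inj_on (frame_map J I z) (pts J)}"
  let ?U = "{()}"
  \<comment> \<open>The directions as a tuple indexed by \<open>J\<close> times a single point, to match the shape of \<open>comb\<close>.\<close>
  define y where "y z = (\<lambda>k\<in>J \<times> ?U. z (Some (fst k)))" for z :: "'j option \<Rightarrow> 'i \<Rightarrow> 'a"
  define zz where "zz = (\<lambda>_\<in>?U. \<lambda>_\<in>I. \<zero>)"
  define G where "G = y ` ?N"
  have yt: "y z \<in> tuples (J \<times> ?U) I" if "z \<in> tuples (frame_idx J) I" for z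
    unfolding y_def using PiE_mem[OF that] by (intro restrict_PiE_iff[THEN iffD2]) auto
  have ex: "\<exists>s\<in>pts J. s \<noteq> origin J \<and> comb J ?U I s v \<in> {zz}" if vG: "v \<in> G" for v
  proof -
    obtain z where z: "z \<in> tuples (frame_idx J) I" "\<not> inj_on (frame_map J I z) (pts J)" "v = y z"
      using vG unfolding G_def by (elim imageE CollectE conjE) (rule that; assumption)
    obtain t t' where t: "t \<in> pts J" "t' \<in> pts J" "frame_map J I z t = frame_map J I z t'" "t \<noteq> t'"
      using z(2) unfolding inj_on_def by (simp only: Ball_def not_all not_imp) (elim exE conjE, rule that; assumption)
    define s where "s = (\<lambda>j\<in>J. t j \<ominus> t' j)"
    have tc: "t j \<in> carrier K" "t' j \<in> carrier K" if "j \<in> J" for j using pts_mem[OF t(1) that] pts_mem[OF t(2) that] .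
    have s: "s \<in> pts J" using tc by (auto simp: s_def)
    have "s \<noteq> origin J"
    proof
      assume e: "s = origin J"
      have "t = t'"
      proof (rule PiE_ext[OF t(1,2)])
        fix j assume j: "j \<in> J"
        have "t j \<ominus> t' j = \<zero>" using fun_cong[OF e, of j] j by (simp add: s_def origin_def)
        thus "t j = t' j" using tc[OF j] by simp
      qed
      thus False using t(4) by simp
    qed
    moreover have "comb J ?U I s v = zz"
    proof (intro ext)
      fix a i
      show "comb J ?U I s v a i = zz a i"
      proof (cases "i \<in> I")
        case i: True
        have zc: "z (Some j) i \<in> carrier K" if "j \<in> J" for j using tuple_mem[OF z(1) _ i] that by simp
        have z0: "z None i \<in> carrier K" using tuple_mem[OF z(1) _ i] by simp
        have c1: "(\<Oplus>j\<in>J. t j \<otimes> z (Some j) i) \<in> carrier K" "(\<Oplus>j\<in>J. t' j \<otimes> z (Some j) i) \<in> carrier K"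
          using tc zc by (auto intro!: finsum_closed)
        have "z None i \<oplus> (\<Oplus>j\<in>J. t j \<otimes> z (Some j) i) = z None i \<oplus> (\<Oplus>j\<in>J. t' j \<otimes> z (Some j) i)"
          using fun_cong[OF t(3), of i] i by (simp add: frame_map_def)
        hence e: "(\<Oplus>j\<in>J. t j \<otimes> z (Some j) i) = (\<Oplus>j\<in>J. t' j \<otimes> z (Some j) i)" using z0 c1 by simp
        have "(\<Oplus>j\<in>J. s j \<otimes> v (j, ()) i) \<oplus> (\<Oplus>j\<in>J. t' j \<otimes> z (Some j) i) = (\<Oplus>j\<in>J. s j \<otimes> v (j, ()) i \<oplus> t' j \<otimes> z (Some j) i)"
          by (rule finsum_addf[symmetric]) (use tc zc pts_mem[OF s] in \<open>auto simp: z(3) y_def\<close>)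
        also have "\<dots> = (\<Oplus>j\<in>J. t j \<otimes> z (Some j) i)"
        proof (rule finsum_cong')
          fix j assume j: "j \<in> J"
          have "(a1 \<ominus> b1) \<otimes> c1 \<oplus> b1 \<otimes> c1 = a1 \<otimes> c1" if "a1 \<in> carrier K" "b1 \<in> carrier K" "c1 \<in> carrier K" for a1 b1 c1
            using that by (simp add: l_distr[symmetric] minus_eq a_assoc l_neg)
          from this[OF tc[OF j] zc[OF j]] show "s j \<otimes> v (j, ()) i \<oplus> t' j \<otimes> z (Some j) i = t j \<otimes> z (Some j) i"
            using j by (simp add: s_def z(3) y_def)
        qed (use tc zc in auto)
        finally have "(\<Oplus>j\<in>J. s j \<otimes> v (j, ()) i) \<oplus> (\<Oplus>j\<in>J. t' j \<otimes> z (Some j) i) = (\<Oplus>j\<in>J. t' j \<otimes> z (Some j) i)"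
          unfolding e .
        moreover have "(\<Oplus>j\<in>J. s j \<otimes> v (j, ()) i) \<in> carrier K"
          by (rule finsum_closed) (use zc pts_mem[OF s] in \<open>auto simp: z(3) y_def\<close>)
        ultimately have "(\<Oplus>j\<in>J. s j \<otimes> v (j, ()) i) = \<zero>" using c1(2) by simp
        thus ?thesis using i by (simp add: comb_def zz_def)
      qed (simp add: comb_def zz_def)
    qed
    ultimately show ?thesis using s by (intro bexI[of _ s] conjI) simp_all
  qed
  have Gt: "G \<subseteq> tuples (J \<times> ?U) I" unfolding G_def by (rule image_subsetI) (simp only: mem_Collect_eq yt)
  have zt: "{zz} \<subseteq> tuples ?U I" by (simp add: zz_def restrict_PiE_iff)
  have "card G \<le> q ^ card J * (card {zz} * q ^ (card I * ((card J - 1) * card ?U)))"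
    by (rule count_by_combinations[OF J(1) _ I Gt zt ex]) simp_all
  hence cG: "card G \<le> q ^ card J * q ^ (card I * (card J - 1))" by simp
  let ?f = "\<lambda>z. (z None, y z)"
  have "inj_on ?f ?N"
  proof (rule inj_onI)
    fix z z' assume zz: "z \<in> ?N" "z' \<in> ?N" and e: "?f z = ?f z'"
    have zt: "z \<in> tuples (frame_idx J) I" "z' \<in> tuples (frame_idx J) I" using zz by auto
    have e1: "z None = z' None" and e2: "y z = y z'" using e by auto
    show "z = z'"
    proof (rule PiE_ext[OF zt])
      fix u assume u: "u \<in> frame_idx J"
      show "z u = z' u"
      proof (cases u)
        case None thus ?thesis using e1 by simp
      next
        case (Some j)
        hence "j \<in> J" using u by simp
        thus ?thesis using fun_cong[OF e2, of "(j, ())"] Some by (simp add: y_def)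
      qed
    qed
  qed
  moreover have "?f ` ?N \<subseteq> pts I \<times> G"
  proof
    fix w assume "w \<in> ?f ` ?N"
    then obtain z where z: "z \<in> ?N" "w = ?f z" by blast
    have "z None \<in> pts I" using PiE_mem[of z "frame_idx J" "\<lambda>_. pts I" None] z(1) by simp
    thus "w \<in> pts I \<times> G" using z unfolding G_def by blast
  qed
  moreover have fG: "finite G" unfolding G_def using finite_tuples[of "frame_idx J" I] J I by auto
  ultimately have "card ?N \<le> card (pts I \<times> G)" by (intro card_inj_on_le) (use finite_pts[OF I] in auto)
  also have "\<dots> = q ^ card I * card G" by (simp add: card_cartesian_product card_pts[OF I])
  also have "\<dots> \<le> q ^ card I * (q ^ card J * q ^ (card I * (card J - 1)))" using cG by (rule mult_left_mono) simp
  also have "\<dots> = q ^ (card I + (card J + card I * (card J - 1)))" by (simp only: power_add)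
  also have "card I + (card J + card I * (card J - 1)) = card J + card I * card J"
  proof -
    have "card J \<noteq> 0" using J by simp
    then obtain k where "card J = Suc k" by (cases "card J") auto
    thus ?thesis by simp
  qed
  finally show ?thesis .
qed

end

section \<open>The proportion of bad subspaces\<close>

text \<open>
  The degenerate extensions and the frames that are not injective make up at most a \<open>q\<close>-th part of what they
  are subtracted from. Therefore each of them costs a factor \<open>q\<close> only, by the following absorption
  step: \<open>x \<le> y + z\<close> and \<open>q z \<le> x\<close> imply \<open>x \<le> q y\<close>, because \<open>q \<ge> 2\<close>. In the exponent, \<open>N\<close> comes from the proportion of good
  extensions, \<open>m + 1\<close> from the choice of the perturbation \<open>\<sigma>\<close>, \<open>2\<close> from the two absorptions, and \<open>l (l + 1)\<close> from
  the frames of a given subspace.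
\<close>

lemma counting_arithmetic:
  fixes q nb M N l m :: nat
  assumes q: "2 \<le> q" and M: "M = Suc m * Suc l" and nb: "N + l + m + 3 \<le> nb"
    and a1: "q ^ (nb * M) \<le> q ^ N * good" and a2: "dg \<le> q ^ (l * M)" and a3: "good \<le> good' + dg"
    and a4: "good' \<le> q ^ Suc m * (bad * q ^ (nb * (m * Suc l)))"
    and a5: "bad \<le> binj + q ^ (l + nb * l)" and a6: "binj \<le> bd * q ^ (l * Suc l)"
  shows "q ^ (nb * Suc l) \<le> q ^ ((N + l + m + 3) * Suc l) * bd"
proof -
  have absorb: "x \<le> q * y" if "x \<le> y + z" "q * z \<le> x" for x y z :: nat
  proof -
    have "2 * z \<le> x" using that(2) q mult_right_mono[of 2 q z] by linarith
    hence "x \<le> 2 * y" using that(1) by linarith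
    also have "\<dots> \<le> q * y" using q by (rule mult_right_mono) simp
    finally show ?thesis .
  qed
  have pw: "q ^ a \<le> q ^ b" if "a \<le> b" for a b using that q by (intro power_increasing) auto
  have "q ^ (nb * M) \<le> q ^ N * good' + q ^ N * q ^ (l * M)"
  proof -
    have "q ^ N * good \<le> q ^ N * (good' + q ^ (l * M))" using a2 a3 by (intro mult_left_mono) auto
    thus ?thesis using a1 by (simp add: add_mult_distrib2)
  qed
  moreover have "q * (q ^ N * q ^ (l * M)) \<le> q ^ (nb * M)"
  proof -
    have "1 \<le> M" by (simp add: M)
    have "Suc (N + l * M) \<le> (N + l + m + 3) * M"
    proof -
      have "N * 1 \<le> N * M" using \<open>1 \<le> M\<close> by (rule mult_left_mono) simp
      moreover have "(N + l + m + 3) * M = N * M + l * M + m * M + 3 * M" by (simp add: algebra_simps)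
      ultimately show ?thesis using \<open>1 \<le> M\<close> by linarith
    qed
    also have "\<dots> \<le> nb * M" using nb by (rule mult_right_mono) simp
    finally show ?thesis using pw by (simp only: power_Suc[symmetric] power_add[symmetric] add_Suc)
  qed
  ultimately have "q ^ (nb * M) \<le> q * (q ^ N * good')" by (rule absorb)
  also have "\<dots> \<le> q * (q ^ N * (q ^ Suc m * (bad * q ^ (nb * (m * Suc l)))))"
    using a4 by (intro mult_left_mono) auto
  also have "\<dots> = (q ^ (N + m + 2) * bad) * q ^ (nb * (m * Suc l))"
    by (simp add: power_add power2_eq_square ac_simps)
  finally have "q ^ (nb * Suc l) * q ^ (nb * (m * Suc l)) \<le> (q ^ (N + m + 2) * bad) * q ^ (nb * (m * Suc l))"
    unfolding M by (simp only: power_add[symmetric] mult_Suc add_mult_distrib2)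
  moreover have "0 < q ^ (nb * (m * Suc l))" using q by simp
  ultimately have s2: "q ^ (nb * Suc l) \<le> q ^ (N + m + 2) * bad" by (simp only: mult_le_cancel2)
  have "q ^ (nb * Suc l) \<le> q ^ (N + m + 2) * binj + q ^ (N + m + 2) * q ^ (l + nb * l)"
  proof -
    have "q ^ (N + m + 2) * bad \<le> q ^ (N + m + 2) * (binj + q ^ (l + nb * l))" using a5 by (rule mult_left_mono) simp
    thus ?thesis using s2 by (simp only: add_mult_distrib2) 
  qed
  moreover have "q * (q ^ (N + m + 2) * q ^ (l + nb * l)) \<le> q ^ (nb * Suc l)"
  proof -
    have "Suc ((N + m + 2) + (l + nb * l)) \<le> nb * Suc l" using nb by simp
    thus ?thesis using pw by (simp only: power_Suc[symmetric] power_add[symmetric])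
  qed
  ultimately have "q ^ (nb * Suc l) \<le> q * (q ^ (N + m + 2) * binj)" by (rule absorb)
  also have "\<dots> \<le> q * (q ^ (N + m + 2) * (bd * q ^ (l * Suc l)))" using a6 by (intro mult_left_mono) auto
  also have "\<dots> = q ^ (Suc ((N + m + 2) + l * Suc l)) * bd" by (simp only: power_Suc power_add ac_simps)
  also have "\<dots> \<le> q ^ ((N + l + m + 3) * Suc l) * bd"
    by (intro mult_right_mono pw) (simp_all add: algebra_simps)
  finally show ?thesis .
qed

context galois_field begin

lemma frame_map_origin:
  assumes "finite J" "z \<in> tuples (frame_idx J) I" "i \<in> I"
  shows "frame_map J I z (origin J) i = z None i"
proof -
  have "(\<Oplus>j\<in>J. origin J j \<otimes> z (Some j) i) = (\<Oplus>j\<in>J. \<zero>)"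
    by (rule finsum_cong') (use tuple_mem[OF assms(2) _ assms(3)] in \<open>auto simp: origin_def\<close>)
  thus ?thesis using tuple_mem[OF assms(2) _ assms(3)] assms(3) by (simp add: frame_map_def)
qed

lemma sum_unitpt:
  assumes "finite J" "k \<in> J" "\<And>j. j \<in> J \<Longrightarrow> u j \<in> carrier K"
  shows "(\<Oplus>j\<in>J. unitpt J k j \<otimes> u j) = u k"
proof -
  have "(\<Oplus>j\<in>J. unitpt J k j \<otimes> u j) = (\<Oplus>j\<in>J. if k = j then u j else \<zero>)"
    by (rule finsum_cong') (use assms(3) in \<open>auto simp: unitpt_def\<close>)
  also have "\<dots> = u k" by (rule finsum_singleton) (use assms in auto)
  finally show ?thesis .
qed

lemma frame_map_unitpt:
  assumes "finite J" "z \<in> tuples (frame_idx J) I" "i \<in> I" "j \<in> J"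
  shows "frame_map J I z (unitpt J j) i = z None i \<oplus> z (Some j) i"
  using sum_unitpt[OF assms(1,4), of "\<lambda>j. z (Some j) i"] tuple_mem[OF assms(2) _ assms(3)] assms(3)
  by (simp add: frame_map_def)

lemma frame_map_determines:
  assumes J: "finite J" and z: "z \<in> tuples (frame_idx J) I" "z' \<in> tuples (frame_idx J) I"
    and e0: "frame_map J I z (origin J) = frame_map J I z' (origin J)"
    and e: "\<And>j. j \<in> J \<Longrightarrow> frame_map J I z (unitpt J j) = frame_map J I z' (unitpt J j)"
  shows "z = z'"
proof (rule PiE_ext[OF z])
  fix u assume u: "u \<in> frame_idx J"
  have n: "z None i = z' None i" if "i \<in> I" for i
    using fun_cong[OF e0, of i] frame_map_origin[OF J z(1) that] frame_map_origin[OF J z(2) that] by simp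
  show "z u = z' u"
  proof (rule PiE_ext[OF PiE_mem[OF z(1) u] PiE_mem[OF z(2) u]])
    fix i assume i: "i \<in> I"
    show "z u i = z' u i"
    proof (cases u)
      case None thus ?thesis using n[OF i] by simp
    next
      case (Some j)
      hence j: "j \<in> J" using u by simp
      have "z None i \<oplus> z (Some j) i = z None i \<oplus> z' (Some j) i"
        using fun_cong[OF e[OF j], of i] frame_map_unitpt[OF J z(1) i j] frame_map_unitpt[OF J z(2) i j] n[OF i] by simp
      thus ?thesis using Some tuple_mem[OF z(1) _ i] tuple_mem[OF z(2) _ i] j by simp
    qed
  qed
qed

lemma amap_as_frame_map:
  assumes J: "finite J" and am: "amap J I \<chi>"
  shows "\<exists>z\<in>tuples (frame_idx J) I. \<forall>t\<in>pts J. frame_map J I z t = \<chi> t"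
proof -
  define z where "z = (\<lambda>u\<in>frame_idx J. \<lambda>i\<in>I. case u of None \<Rightarrow> \<chi> (origin J) i | Some j \<Rightarrow> \<chi> (unitpt J j) i \<ominus> \<chi> (origin J) i)"
  have c: "\<chi> t i \<in> carrier K" if "t \<in> pts J" "i \<in> I" for t i using pts_mem[OF amap_pts[OF am that(1)] that(2)] .
  have z: "z \<in> tuples (frame_idx J) I" unfolding z_def
    by (intro restrict_PiE_iff[THEN iffD2] ballI) (use c in \<open>auto split: option.split\<close>)
  have "frame_map J I z t = \<chi> t" if t: "t \<in> pts J" for t
  proof (rule PiE_ext[OF amap_pts[OF amap_frame_map[OF J z] t] amap_pts[OF am t]])
    fix i assume i: "i \<in> I"
    have "plt J 2 (\<lambda>t. \<chi> t i)" using am i by (simp add: amap_def)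
    from plt_2_expand[OF J this t]
    have "\<chi> t i = \<chi> (origin J) i \<oplus> (\<Oplus>j\<in>J. t j \<otimes> (\<chi> (unitpt J j) i \<ominus> \<chi> (origin J) i))" .
    also have "(\<Oplus>j\<in>J. t j \<otimes> (\<chi> (unitpt J j) i \<ominus> \<chi> (origin J) i)) = (\<Oplus>j\<in>J. t j \<otimes> z (Some j) i)"
      by (rule finsum_cong') (use i c pts_mem[OF t] tuple_mem[OF z _ i] in \<open>auto simp: z_def\<close>)
    finally show "frame_map J I z t i = \<chi> t i" using i by (simp add: frame_map_def z_def)
  qed
  thus ?thesis using z by blast
qed

lemma ext_map_Inl:
  assumes J: "finite J" "finite A" and z: "z \<in> tuples (frame_idx J) I" and x: "x \<in> tuples A I" and t: "t \<in> pts J"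
  shows "ext_map J A I z x (\<lambda>k\<in>Sum_Type.Plus J A. case k of Inl j \<Rightarrow> t j | Inr _ \<Rightarrow> \<zero>) = frame_map J I z t"
proof
  fix i
  let ?c = "\<lambda>k\<in>Sum_Type.Plus J A. case k of Inl j \<Rightarrow> t j | Inr _ \<Rightarrow> \<zero>"
  show "ext_map J A I z x ?c i = frame_map J I z t i"
  proof (cases "i \<in> I")
    case i: True
    have zc: "z u i \<in> carrier K" if "u \<in> frame_idx J" for u using tuple_mem[OF z that i] .
    have tc: "t j \<in> carrier K" if "j \<in> J" for j using pts_mem[OF t that] .
    have "(\<Oplus>a\<in>A. ?c (Inr a) \<otimes> x a i) = (\<Oplus>a\<in>A. \<zero>)"
      by (rule finsum_cong') (use tuple_mem[OF x _ i] in auto)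
    moreover have "(\<Oplus>j\<in>J. ?c (Inl j) \<otimes> z (Some j) i) = (\<Oplus>j\<in>J. t j \<otimes> z (Some j) i)"
      by (rule finsum_cong') (use zc tc in auto)
    moreover have "(\<Oplus>j\<in>J. t j \<otimes> z (Some j) i) \<in> carrier K" by (rule finsum_closed) (use zc tc in auto)
    ultimately show ?thesis using i zc[of None] unfolding ext_map_def frame_map_def by simp
  qed (simp add: ext_map_def frame_map_def)
qed

lemma ext_map_Inr:
  assumes J: "finite J" "finite A" and z: "z \<in> tuples (frame_idx J) I" and x: "x \<in> tuples A I" and a: "a \<in> A"
  shows "ext_map J A I z x (unitpt (Sum_Type.Plus J A) (Inr a)) = (\<lambda>i\<in>I. z None i \<oplus> x a i)"
proof
  fix i
  let ?c = "unitpt (Sum_Type.Plus J A) (Inr a)"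
  show "ext_map J A I z x ?c i = (\<lambda>i\<in>I. z None i \<oplus> x a i) i"
  proof (cases "i \<in> I")
    case i: True
    have zc: "z u i \<in> carrier K" if "u \<in> frame_idx J" for u using tuple_mem[OF z that i] .
    have "(\<Oplus>b\<in>A. ?c (Inr b) \<otimes> x b i) = (\<Oplus>b\<in>A. unitpt A a b \<otimes> x b i)"
      by (rule finsum_cong') (use tuple_mem[OF x _ i] in \<open>auto simp: unitpt_def\<close>)
    also have "\<dots> = x a i" by (rule sum_unitpt[OF J(2) a]) (use tuple_mem[OF x _ i] in auto)
    finally have "(\<Oplus>b\<in>A. ?c (Inr b) \<otimes> x b i) = x a i" .
    moreover have "(\<Oplus>j\<in>J. ?c (Inl j) \<otimes> z (Some j) i) = (\<Oplus>j\<in>J. \<zero>)"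
      by (rule finsum_cong') (use zc in \<open>auto simp: unitpt_def\<close>)
    ultimately show ?thesis using i zc[of None] by (simp add: ext_map_def)
  qed (simp add: ext_map_def)
qed

end

context coord_space begin

lemma polynomial_on_of_subspaces:
  assumes f: "f \<in> X' \<rightarrow> carrier K" and T0: "1 \<le> T0" "Suc n \<le> T0 * (q - Q)"
    and H: "\<And>W. affine_subspace K V T0 W \<Longrightarrow> W \<subseteq> X' \<Longrightarrow> polynomial_on K V n W f"
    and W: "affine_subspace K V j W" "W \<subseteq> X'" "T0 \<le> j"
  shows "polynomial_on K V n W f"
proof -
  obtain J :: "'v set" and \<psi> where J: "finite J" "card J = j" "amap J B \<psi>" "inj_on \<psi> (pts J)" "(\<lambda>c. \<Phi> (\<psi> c)) ` pts J = W"
    using affine_subspace_param[OF W(1)] by (elim exE conjE) (rule that; assumption)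
  have WX: "\<Phi> (\<psi> c) \<in> X'" if "c \<in> pts J" for c using W(2) imageI[OF that, of "\<lambda>c. \<Phi> (\<psi> c)"] unfolding J(5) by (rule subsetD)
  have "plt J (Suc n) (\<lambda>c. f (\<Phi> (\<psi> c)))"
  proof (rule plt_of_subspace_restrictions[OF J(1) _ _ T0])
    show "f (\<Phi> (\<psi> c)) \<in> carrier K" if "c \<in> pts J" for c using f WX[OF that] by (rule funcset_mem)
    show "T0 \<le> card J" using W(3) J(2) by simp
    fix J' \<phi> assume J': "J' \<subseteq> J" "card J' = T0" "amap J' J \<phi>" "inj_on \<phi> (pts J')"
    have fJ': "finite J'" using J'(1) J(1) by (rule finite_subset)
    have am: "amap J' B (\<lambda>x. \<psi> (\<phi> x))" by (rule amap_comp[OF J'(3) J(3)])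
    have inj: "inj_on (\<lambda>x. \<psi> (\<phi> x)) (pts J')"
    proof (rule inj_onI)
      fix x y assume xy: "x \<in> pts J'" "y \<in> pts J'" and e: "\<psi> (\<phi> x) = \<psi> (\<phi> y)"
      have "\<phi> x = \<phi> y" by (rule inj_onD[OF J(4) e amap_pts[OF J'(3) xy(1)] amap_pts[OF J'(3) xy(2)]])
      thus "x = y" by (rule inj_onD[OF J'(4) _ xy])
    qed
    have "affine_subspace K V T0 ((\<lambda>c. \<Phi> (\<psi> (\<phi> c))) ` pts J')"
      using inj_amap_image_affine_subspace[OF fJ' am inj] unfolding J'(2) .
    moreover have "(\<lambda>c. \<Phi> (\<psi> (\<phi> c))) ` pts J' \<subseteq> X'" using WX amap_pts[OF J'(3)] by (intro image_subsetI) simp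
    ultimately have "polynomial_on K V n ((\<lambda>c. \<Phi> (\<psi> (\<phi> c))) ` pts J') f" by (rule H)
    thus "plt J' (Suc n) (\<lambda>x. f (\<Phi> (\<psi> (\<phi> x))))" by (rule polynomial_on_plt[OF _ fJ' am order_refl])
  qed
  from plt_polynomial_on[OF J(1,3,4) this] show ?thesis unfolding J(5) .
qed

lemma affine_subspace_tuple:
  assumes "affine_subspace K V j W"
  shows "\<exists>z\<in>tuples (frame_idx {..<j}) B. inj_on (frame_map {..<j} B z) (pts {..<j}) \<and> (\<lambda>c. \<Phi> (frame_map {..<j} B z c)) ` pts {..<j} = W"
proof -
  let ?N = "{..<j}"
  obtain J :: "'v set" and \<psi> where J: "finite J" "card J = j" "amap J B \<psi>" "inj_on \<psi> (pts J)" "(\<lambda>c. \<Phi> (\<psi> c)) ` pts J = W"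
    using affine_subspace_param[OF assms] by (elim exE conjE) (rule that; assumption)
  obtain h where h: "bij_betw h J ?N" using ex_bij_betw_finite_nat[OF J(1)] J(2) atLeast0LessThan by metis
  define g where "g = inv_into J h"
  have hJ: "h k \<in> ?N" if "k \<in> J" for k using bij_betw_apply[OF h that] .
  have gN: "g i \<in> J" "h (g i) = i" if "i \<in> ?N" for i
    using bij_betw_apply[OF bij_betw_inv_into[OF h] that] bij_betw_inv_into_right[OF h that] by (simp_all add: g_def)
  have gh: "g (h k) = k" if "k \<in> J" for k using bij_betw_inv_into_left[OF h that] by (simp add: g_def)
  define \<eta> where "\<eta> c = (\<lambda>k\<in>J. c (h k))" for c :: "nat \<Rightarrow> 'a"
  have am\<eta>: "amap ?N J \<eta>" unfolding amap_def
  proof (intro conjI ballI)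
    fix c assume c: "c \<in> pts ?N" show "\<eta> c \<in> pts J" unfolding \<eta>_def using pts_mem[OF c hJ] by auto
  next
    fix k assume k: "k \<in> J" show "plt ?N 2 (\<lambda>c. \<eta> c k)" using plt_var[OF hJ[OF k]] k by (simp add: \<eta>_def)
  qed
  have surj: "\<eta> ` pts ?N = pts J"
  proof
    show "\<eta> ` pts ?N \<subseteq> pts J" using amap_pts[OF am\<eta>] by (rule image_subsetI)
    show "pts J \<subseteq> \<eta> ` pts ?N"
    proof
      fix k assume k: "k \<in> pts J"
      define c where "c = (\<lambda>i\<in>?N. k (g i))"
      have c: "c \<in> pts ?N" unfolding c_def using pts_mem[OF k gN(1)] by auto
      have "\<eta> c = k"
      proof (rule PiE_ext[OF amap_pts[OF am\<eta> c] k])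
        fix b assume b: "b \<in> J" show "\<eta> c b = k b" using hJ[OF b] gh[OF b] b by (simp add: \<eta>_def c_def)
      qed
      thus "k \<in> \<eta> ` pts ?N" using c by (intro image_eqI) simp_all
    qed
  qed
  have inj\<eta>: "inj_on \<eta> (pts ?N)"
  proof (rule inj_onI)
    fix x y assume xy: "x \<in> pts ?N" "y \<in> pts ?N" and e: "\<eta> x = \<eta> y"
    show "x = y"
    proof (rule PiE_ext[OF xy])
      fix i assume i: "i \<in> ?N" show "x i = y i" using fun_cong[OF e, of "g i"] gN[OF i] by (simp add: \<eta>_def)
    qed
  qed
  obtain z where z: "z \<in> tuples (frame_idx ?N) B" "\<And>t. t \<in> pts ?N \<Longrightarrow> frame_map ?N B z t = \<psi> (\<eta> t)"
    using amap_as_frame_map[OF _ amap_comp[OF am\<eta> J(3)]] by auto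
  have "inj_on (frame_map ?N B z) (pts ?N)"
  proof (rule inj_onI)
    fix x y assume xy: "x \<in> pts ?N" "y \<in> pts ?N" and e: "frame_map ?N B z x = frame_map ?N B z y"
    have "\<psi> (\<eta> x) = \<psi> (\<eta> y)" using e z(2)[OF xy(1)] z(2)[OF xy(2)] by (simp only:)
    hence "\<eta> x = \<eta> y" by (rule inj_onD[OF J(4) _ amap_pts[OF am\<eta> xy(1)] amap_pts[OF am\<eta> xy(2)]])
    thus "x = y" by (rule inj_onD[OF inj\<eta> _ xy])
  qed
  moreover have "(\<lambda>c. \<Phi> (frame_map ?N B z c)) ` pts ?N = (\<lambda>c. \<Phi> (\<psi> c)) ` \<eta> ` pts ?N"
    unfolding image_image by (rule image_cong) (simp_all only: z(2))
  ultimately show ?thesis using z(1) unfolding surj J(5) by (intro bexI[of _ z] conjI)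
qed

text \<open>
  \<open>W0\<close> is a bad subspace, \<open>Good\<close> the set of extensions of its frame that stay in the variety, \<open>Deg\<close> those among
  all extensions that do not leave \<open>W0\<close>, \<open>Bad\<close> the set of bad frames, and \<open>Binj\<close> the set of
  those that are injective. The inequalities \<open>a1\<close> to \<open>a6\<close> are the steps from the number of all extensions to
  the number of bad subspaces.
\<close>

lemma bad_fraction:
  assumes P: "\<And>i. i < L \<Longrightarrow> plt B (Suc d) (P i)" and Xs: "Xs = {x \<in> pts B. \<forall>i<L. P i x = \<zero>}"
    and X': "X' = \<Phi> ` Xs" and f: "f \<in> X' \<rightarrow> carrier K" and m: "1 \<le> m" and l: "1 \<le> l"
    and l': "l' \<le> Suc l" "1 \<le> l'" "Suc m \<le> l' * (q - Q)"
    and H: "\<And>W. affine_subspace K V l' W \<Longrightarrow> W \<subseteq> X' \<Longrightarrow> polynomial_on K V m W f"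
    and W0: "affine_subspace K V l W0" "W0 \<subseteq> X'" "\<not> polynomial_on K V (m - 1) W0 f"
    and N: "N = Suc (L * Suc (l + Suc m * Suc l) ^ Suc d * d)"
  shows "card {W. affine_subspace K V l W \<and> W \<subseteq> X'} \<le>
    q ^ ((N + l + m + 3) * Suc l) * card {W. affine_subspace K V l W \<and> W \<subseteq> X' \<and> \<not> polynomial_on K V (m - 1) W f}"
proof -
  define J where "J = {..<l}"
  have J: "finite J" "card J = l" "J \<noteq> {}" using l by (auto simp: J_def lessThan_empty_iff)
  let ?S = "{W. affine_subspace K V l W \<and> W \<subseteq> X'}"
  let ?Bd = "{W. affine_subspace K V l W \<and> W \<subseteq> X' \<and> \<not> polynomial_on K V (m - 1) W f}"
  define wm where "wm z = (\<lambda>c. \<Phi> (frame_map J B z c)) ` pts J" for z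
  let ?T = "tuples (frame_idx J) B"
  define nb where "nb = card B"
  have fT: "finite ?T" using finite_tuples[of "frame_idx J" B] J finite_B by simp
  have cT: "card ?T = q ^ (nb * Suc l)" using card_tuples[of "frame_idx J" B] J finite_B by (simp add: card_frame_idx nb_def)
  have sub: "?S \<subseteq> wm ` ?T"
  proof
    fix W assume "W \<in> ?S"
    then obtain z where "z \<in> ?T" "wm z = W" using affine_subspace_tuple[of l W] unfolding J_def wm_def by blast
    thus "W \<in> wm ` ?T" by blast
  qed
  have fS: "finite ?S" using finite_subset[OF sub] fT by simp
  have cS: "card ?S \<le> q ^ (nb * Suc l)"
    using card_mono[OF finite_imageI[OF fT] sub] card_image_le[OF fT, of wm] unfolding cT by (rule le_trans)
  have Bd_sub: "?Bd \<subseteq> ?S" by auto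
  have fBd: "finite ?Bd" by (rule finite_subset[OF Bd_sub fS])
  have "W0 \<in> ?Bd" using W0 by simp
  hence "card ?Bd \<noteq> 0" using fBd by (metis card_0_eq empty_iff)
  hence Bd1: "1 \<le> card ?Bd" by simp
  show ?thesis
  proof (cases "N + l + m + 3 \<le> nb")
    case False
    \<comment> \<open>If the space is small, there are so few subspaces that \<open>W0\<close> alone is a sufficient proportion.\<close>
    have "q ^ (nb * Suc l) \<le> q ^ ((N + l + m + 3) * Suc l)"
      using False q_ge_2 by (intro power_increasing mult_right_mono) auto
    moreover have "q ^ ((N + l + m + 3) * Suc l) * 1 \<le> q ^ ((N + l + m + 3) * Suc l) * card ?Bd"
      using Bd1 by (rule mult_left_mono) simp
    ultimately show ?thesis using cS by linarith
  next
    case nb: True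
    define F where "F = (\<lambda>c. f (\<Phi> c))"
    obtain z0 where z0: "z0 \<in> ?T" "inj_on (frame_map J B z0) (pts J)" "wm z0 = W0"
      using affine_subspace_tuple[OF W0(1)] unfolding J_def wm_def by blast
    have \<Phi>X: "v \<in> Xs" if vX: "v \<in> pts B" "\<Phi> v \<in> X'" for v
    proof -
      obtain w where w: "w \<in> Xs" "\<Phi> v = \<Phi> w" using vX(2) unfolding X' by (elim imageE) (rule that; assumption)
      have "w \<in> pts B" using w(1) Xs by simp
      from \<Phi>_inj[OF vX(1) this w(2)] show ?thesis using w(1) by simp
    qed
    have XF: "F v \<in> carrier K" if "v \<in> Xs" for v unfolding F_def using f that X' by auto
    have am0: "amap J B (frame_map J B z)" if "z \<in> ?T" for z by (rule amap_frame_map[OF J(1) that])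
    have z0X: "frame_map J B z0 t \<in> Xs" if t: "t \<in> pts J" for t
    proof (rule \<Phi>X[OF amap_pts[OF am0[OF z0(1)] t]])
      have "\<Phi> (frame_map J B z0 t) \<in> W0" unfolding z0(3)[symmetric] wm_def using t by (rule imageI)
      thus "\<Phi> (frame_map J B z0 t) \<in> X'" using W0(2) by blast
    qed
    have sm: "Suc (m - 1) = m" using m by simp
    have z0bad: "\<not> plt J m (\<lambda>t. F (frame_map J B z0 t))"
    proof
      assume "plt J m (\<lambda>t. F (frame_map J B z0 t))"
      hence "plt J (Suc (m - 1)) (\<lambda>t. f (\<Phi> (frame_map J B z0 t)))" unfolding sm F_def .
      from plt_polynomial_on[OF J(1) am0[OF z0(1)] z0(2) this] show False using W0(3) z0(3) unfolding wm_def by simp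
    qed
    define A where "A = {..m} \<times> frame_idx J"
    have A: "finite A" "card A = Suc m * Suc l" using J by (simp_all add: A_def card_frame_idx)
    define Good where "Good = {x \<in> tuples A B. \<forall>c\<in>pts (Sum_Type.Plus J A). ext_map J A B z0 x c \<in> Xs}"
    have fGood: "finite Good" unfolding Good_def using finite_tuples[OF A(1) finite_B] by simp
    have a1: "q ^ (nb * (Suc m * Suc l)) \<le> q ^ N * card Good"
      unfolding nb_def A(2)[symmetric] Good_def
      by (rule many_extensions[OF J(1) A(1) finite_B z0(1) P Xs z0X]) (simp_all only: N J(2) A(2))
    define E0 where "E0 = frame_map J B z0 ` pts J"
    have fE0: "finite E0" "card E0 \<le> q ^ l"
      unfolding E0_def using card_image_le[OF finite_pts[OF J(1)], of "frame_map J B z0"] card_pts[OF J(1)] finite_pts[OF J(1)] J(2) by simp_all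
    \<comment> \<open>An extension within \<open>W0\<close> does not increase the dimension, so that nothing is known about \<open>f\<close> on it.\<close>
    define Deg where "Deg = {x \<in> tuples A B. \<forall>a\<in>A. (\<lambda>b\<in>B. z0 None b \<oplus> x a b) \<in> E0}"
    have a2: "card Deg \<le> q ^ (l * (Suc m * Suc l))"
    proof -
      let ?g = "\<lambda>x. \<lambda>a\<in>A. \<lambda>b\<in>B. z0 None b \<oplus> x a b"
      have "inj_on ?g Deg"
      proof (rule inj_onI)
        fix x y assume "x \<in> Deg" "y \<in> Deg" and e: "?g x = ?g y"
        hence x: "x \<in> tuples A B" and y: "y \<in> tuples A B" by (simp_all add: Deg_def)
        show "x = y"
        proof (rule PiE_ext[OF x y])
          fix a assume a: "a \<in> A"
          show "x a = y a"
          proof (rule PiE_ext[OF PiE_mem[OF x a] PiE_mem[OF y a]])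
            fix b assume b: "b \<in> B"
            have "z0 None b \<oplus> x a b = z0 None b \<oplus> y a b" using fun_cong[OF fun_cong[OF e, of a], of b] a b by simp
            thus "x a b = y a b"
              using tuple_mem[OF z0(1) frame_idx_simps(1) b] tuple_mem[OF x a b] tuple_mem[OF y a b] by simp
          qed
        qed
      qed
      moreover have "?g ` Deg \<subseteq> A \<rightarrow>\<^sub>E E0" by (rule image_subsetI) (simp add: Deg_def)
      ultimately have "card Deg \<le> card (A \<rightarrow>\<^sub>E E0)" by (rule card_inj_on_le) (simp add: finite_PiE A(1) fE0(1))
      also have "\<dots> = card E0 ^ card A" using card_PiE[OF A(1), of "\<lambda>_. E0"] by simp
      also have "\<dots> \<le> (q ^ l) ^ card A" by (rule power_mono[OF fE0(2)]) simp
      finally show ?thesis by (simp only: power_mult[symmetric] A(2))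
    qed
    have a3: "card Good \<le> card (Good - Deg) + card Deg"
    proof -
      have "Good \<subseteq> (Good - Deg) \<union> Deg" by blast
      moreover have fD: "finite Deg" unfolding Deg_def using finite_tuples[OF A(1) finite_B] by simp
      ultimately have "card Good \<le> card ((Good - Deg) \<union> Deg)" using fGood by (intro card_mono) auto
      also have "\<dots> \<le> card (Good - Deg) + card Deg" by (rule card_Un_le)
      finally show ?thesis .
    qed
    define Bad where "Bad = {z \<in> ?T. (\<forall>t\<in>pts J. frame_map J B z t \<in> Xs) \<and> \<not> plt J m (\<lambda>t. F (frame_map J B z t))}"
    have fBad: "finite Bad" unfolding Bad_def using fT by simp
    define Z where "Z = {y \<in> ?T. tuple_add (frame_idx J) B z0 y \<in> Bad}"
    \<comment> \<open>Any other good extension spans a subspace of dimension at least \<open>l + 1 \<ge> l'\<close>.\<close>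
    have poly: "plt (Sum_Type.Plus J A) (Suc m) (\<lambda>c. F (ext_map J A B z0 x c))" if x: "x \<in> Good - Deg" for x
    proof -
      have xt: "x \<in> tuples A B" and xX: "\<And>c. c \<in> pts (Sum_Type.Plus J A) \<Longrightarrow> ext_map J A B z0 x c \<in> Xs"
        using x by (auto simp: Good_def)
      have am: "amap (Sum_Type.Plus J A) B (ext_map J A B z0 x)" by (rule amap_ext_map[OF J(1) A(1) z0(1) xt])
      have fP: "finite (Sum_Type.Plus J A)" using J(1) A(1) by simp
      let ?W = "(\<lambda>c. \<Phi> (ext_map J A B z0 x c)) ` pts (Sum_Type.Plus J A)"
      obtain a where a: "a \<in> A" "(\<lambda>b\<in>B. z0 None b \<oplus> x a b) \<notin> E0" using x xt by (auto simp: Deg_def)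
      obtain j where j: "affine_subspace K V j ?W"
        using amap_image_affine_subspace[OF fP am] by (elim exE) (rule that; assumption)
      have WX: "?W \<subseteq> X'" unfolding X' by (rule image_subsetI) (rule imageI[OF xX])
      have sub0: "W0 \<subseteq> ?W" unfolding z0(3)[symmetric] wm_def
      proof (rule image_subsetI)
        fix t assume t: "t \<in> pts J"
        let ?c = "\<lambda>k\<in>Sum_Type.Plus J A. case k of Inl j \<Rightarrow> t j | Inr _ \<Rightarrow> \<zero>"
        have "?c \<in> pts (Sum_Type.Plus J A)" using pts_mem[OF t] by (auto split: sum.split)
        from imageI[OF this, of "\<lambda>c. \<Phi> (ext_map J A B z0 x c)"] show "\<Phi> (frame_map J B z0 t) \<in> ?W"
          unfolding ext_map_Inl[OF J(1) A(1) z0(1) xt t] .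
      qed
      let ?v = "ext_map J A B z0 x (unitpt (Sum_Type.Plus J A) (Inr a))"
      have v: "\<Phi> ?v \<in> ?W" by (rule imageI[OF unitpt_pts])
      have "\<Phi> ?v \<notin> W0"
      proof
        assume "\<Phi> ?v \<in> W0"
        then obtain t where t: "t \<in> pts J" "\<Phi> ?v = \<Phi> (frame_map J B z0 t)" unfolding z0(3)[symmetric] wm_def by (elim imageE) (rule that; assumption)
        have "?v = frame_map J B z0 t" by (rule \<Phi>_inj[OF amap_pts[OF am unitpt_pts] amap_pts[OF am0[OF z0(1)] t(1)] t(2)])
        thus False using a(2) t(1) unfolding ext_map_Inr[OF J(1) A(1) z0(1) xt a(1)] E0_def by simp
      qed
      hence "W0 \<subset> ?W" using sub0 v by blast
      hence "card W0 < card ?W" by (rule psubset_card_mono[rotated]) (rule finite_imageI[OF finite_pts[OF fP]])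
      hence "q ^ l < q ^ j" using card_affine_subspace[OF W0(1)] card_affine_subspace[OF j] by simp
      hence "l < j" using q_ge_2 by (simp add: power_strict_increasing_iff)
      hence "l' \<le> j" using l'(1) by simp
      from polynomial_on_of_subspaces[OF f l'(2,3) H j WX this] have "polynomial_on K V m ?W f" .
      from polynomial_on_plt[OF this fP am order_refl] show ?thesis unfolding F_def .
    qed
    have ex: "\<exists>\<sigma>\<in>pts {..m}. \<sigma> \<noteq> origin {..m} \<and> comb {..m} (frame_idx J) B \<sigma> x \<in> Z" if x: "x \<in> Good - Deg" for x
    proof -
      have xt: "x \<in> tuples ({..m} \<times> frame_idx J) B" using x by (auto simp: Good_def A_def)
      obtain \<sigma> where s: "\<sigma> \<in> pts {..m}" "\<sigma> \<noteq> origin {..m}"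
        "\<not> plt J m (\<lambda>t. F (frame_map J B (tuple_add (frame_idx J) B z0 (comb {..m} (frame_idx J) B \<sigma> x)) t))"
        using bad_perturbation[OF J(1) z0(1) xt poly[OF x, unfolded A_def] z0bad XF[OF z0X]] by blast
      have ct: "comb {..m} (frame_idx J) B \<sigma> x \<in> ?T" by (rule comb_tuple[OF s(1) xt])
      have "frame_map J B (tuple_add (frame_idx J) B z0 (comb {..m} (frame_idx J) B \<sigma> x)) t \<in> Xs" if t: "t \<in> pts J" for t
        unfolding frame_map_perturb[OF J(1) z0(1) xt s(1) t]
        using x amap_pts[OF amap_scaled[OF t] s(1)] by (simp add: Good_def A_def)
      hence "comb {..m} (frame_idx J) B \<sigma> x \<in> Z"
        unfolding Z_def Bad_def using ct tuple_add_tuple[OF z0(1) ct] s(3) by simp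
      thus ?thesis using s(1,2) by blast
    qed
    have a4: "card (Good - Deg) \<le> q ^ Suc m * (card Bad * q ^ (nb * (m * Suc l)))"
    proof -
      have "card (Good - Deg) \<le> q ^ card {..m} * (card Z * q ^ (card B * ((card {..m} - 1) * card (frame_idx J))))"
        by (rule count_by_combinations[OF finite_atMost _ finite_B _ _ ex]) (use J in \<open>auto simp: Good_def A_def Z_def\<close>)
      also have "\<dots> = q ^ Suc m * (card Z * q ^ (nb * (m * Suc l)))" using J by (simp add: card_frame_idx nb_def)
      also have "\<dots> \<le> q ^ Suc m * (card Bad * q ^ (nb * (m * Suc l)))"
      proof -
        have "card Z \<le> card Bad"
          by (rule card_inj_on_le[OF inj_on_subset[OF inj_tuple_add[OF z0(1)]] _ fBad]) (auto simp: Z_def)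
        thus ?thesis by (intro mult_left_mono mult_right_mono) simp_all
      qed
      finally show ?thesis .
    qed
    define Binj where "Binj = {z \<in> Bad. inj_on (frame_map J B z) (pts J)}"
    have a5: "card Bad \<le> card Binj + q ^ (l + nb * l)"
    proof -
      let ?D = "{z \<in> ?T. \<not> inj_on (frame_map J B z) (pts J)}"
      have "Bad \<subseteq> Binj \<union> ?D" unfolding Binj_def by (auto simp: Bad_def)
      hence "card Bad \<le> card (Binj \<union> ?D)" using fBad fT unfolding Binj_def by (intro card_mono) simp_all
      also have "\<dots> \<le> card Binj + card ?D" by (rule card_Un_le)
      also have "card ?D \<le> q ^ (l + nb * l)" using count_dependent[OF J(1,3) finite_B] unfolding J(2) nb_def .
      finally show ?thesis by simp
    qed
    have a6: "card Binj \<le> card ?Bd * q ^ (l * Suc l)"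
    proof -
      \<comment> \<open>A frame is determined by the images of the origin and the unit points, which lie in its image.\<close>
      define fib where "fib W = {z \<in> Binj. wm z = W}" for W
      have inBd: "wm z \<in> ?Bd" if z: "z \<in> Binj" for z
      proof -
        have zT: "z \<in> ?T" and zX: "\<And>t. t \<in> pts J \<Longrightarrow> frame_map J B z t \<in> Xs"
          and zb: "\<not> plt J m (\<lambda>t. F (frame_map J B z t))" and zi: "inj_on (frame_map J B z) (pts J)"
          using z by (auto simp: Binj_def Bad_def)
        have "affine_subspace K V l (wm z)"
          using inj_amap_image_affine_subspace[OF J(1) am0[OF zT] zi] unfolding wm_def J(2) .
        moreover have "wm z \<subseteq> X'" unfolding wm_def X' by (rule image_subsetI) (rule imageI[OF zX])
        moreover have "\<not> polynomial_on K V (m - 1) (wm z) f"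
        proof
          assume "polynomial_on K V (m - 1) (wm z) f"
          from polynomial_on_plt[OF this J(1) am0[OF zT]] have "plt J (Suc (m - 1)) (\<lambda>c. f (\<Phi> (frame_map J B z c)))"
            unfolding wm_def by simp
          thus False using zb unfolding sm F_def by simp
        qed
        ultimately show ?thesis by simp
      qed
      have cf: "card (fib W) \<le> q ^ (l * Suc l)" if W: "W \<in> ?Bd" for W
      proof -
        have fW: "card W = q ^ l" using card_affine_subspace W by blast
        have "finite W" using fW q_ge_2 by (metis card.infinite not_numeral_le_zero power_eq_0_iff)
        let ?p = "\<lambda>u. case u of None \<Rightarrow> origin J | Some j \<Rightarrow> unitpt J j"
        have pp: "?p u \<in> pts J" for u by (cases u) simp_all
        let ?g = "\<lambda>z. \<lambda>u\<in>frame_idx J. \<Phi> (frame_map J B z (?p u))"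
        have "inj_on ?g (fib W)"
        proof (rule inj_onI)
          fix x y assume "x \<in> fib W" "y \<in> fib W" and e: "?g x = ?g y"
          hence x: "x \<in> ?T" and y: "y \<in> ?T" by (simp_all add: fib_def Binj_def Bad_def)
          have eq: "frame_map J B x (?p u) = frame_map J B y (?p u)" if "u \<in> frame_idx J" for u
          proof (rule \<Phi>_inj[OF amap_pts[OF am0[OF x] pp] amap_pts[OF am0[OF y] pp]])
            show "\<Phi> (frame_map J B x (?p u)) = \<Phi> (frame_map J B y (?p u))" using fun_cong[OF e, of u] that by simp
          qed
          show "x = y"
            by (rule frame_map_determines[OF J(1) x y]) (use eq[of None] eq[of "Some j" for j] in simp_all)
        qed
        moreover have "?g ` fib W \<subseteq> frame_idx J \<rightarrow>\<^sub>E W"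
        proof (rule image_subsetI)
          fix z assume "z \<in> fib W"
          hence "wm z = W" by (simp add: fib_def)
          hence "\<Phi> (frame_map J B z (?p u)) \<in> W" for u unfolding wm_def using imageI[OF pp, of "\<lambda>c. \<Phi> (frame_map J B z c)" u] by blast
          thus "?g z \<in> frame_idx J \<rightarrow>\<^sub>E W" by (simp add: restrict_PiE_iff)
        qed
        ultimately have "card (fib W) \<le> card (frame_idx J \<rightarrow>\<^sub>E W)"
          by (rule card_inj_on_le) (use J \<open>finite W\<close> in \<open>simp add: finite_PiE\<close>)
        also have "\<dots> = (q ^ l) ^ Suc l" using card_PiE[of "frame_idx J" "\<lambda>_. W"] J fW by (simp add: card_frame_idx)
        finally show ?thesis by (simp only: power_mult[symmetric])
      qed
      have "Binj \<subseteq> (\<Union>W\<in>?Bd. fib W)"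
      proof
        fix z assume z: "z \<in> Binj"
        have "z \<in> fib (wm z)" using z by (simp add: fib_def)
        thus "z \<in> (\<Union>W\<in>?Bd. fib W)" by (rule UN_I[OF inBd[OF z]])
      qed
      moreover have "finite (\<Union>W\<in>?Bd. fib W)"
        using fBd fBad by (intro finite_UN_I) (simp_all add: fib_def Binj_def)
      ultimately have "card Binj \<le> card (\<Union>W\<in>?Bd. fib W)" by (rule card_mono[rotated])
      also have "\<dots> \<le> (\<Sum>W\<in>?Bd. card (fib W))" by (rule card_UN_le[OF fBd])
      also have "\<dots> \<le> (\<Sum>W\<in>?Bd. q ^ (l * Suc l))" by (rule sum_mono) (rule cf)
      finally show ?thesis by simp
    qed
    have "q ^ (nb * Suc l) \<le> q ^ ((N + l + m + 3) * Suc l) * card ?Bd"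
      by (rule counting_arithmetic[OF q_ge_2 refl nb a1 a2 a3 a4 a5 a6])
    thus ?thesis using cS by linarith
  qed
qed

end

context galois_field begin

section \<open>Testing dimensions\<close>

lemma q_minus_Q_pos: "1 \<le> q - Q"
proof -
  have "2 * Q \<le> p * Q" using prime_ge_2_nat[OF prime_p] by (rule mult_right_mono) simp
  thus ?thesis using q_eq Q_pos by linarith
qed

text \<open>
  As \<open>q - q / p = q - Q\<close> is a natural number, rounding up can be expressed by multiplication.
\<close>

lemma testing_dim_le_iff: "testing_dim p q n \<le> k \<longleftrightarrow> n \<le> k * (q - Q)"
proof -
  have p0: "real p \<noteq> 0" using prime_gt_0_nat[OF prime_p] by simp
  have "real q = real p * real Q" using arg_cong[OF q_eq, of real] by (simp only: of_nat_mult)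
  hence "real q / real p = real Q" using p0 by simp
  moreover have "Q \<le> q" by simp
  ultimately have e: "real q - real q / real p = real (q - Q)" by (simp add: of_nat_diff)
  have "0 < real (q - Q)" using q_minus_Q_pos by linarith
  hence "real n / real (q - Q) \<le> real k \<longleftrightarrow> real n \<le> real (k * (q - Q))" by (simp only: pos_divide_le_eq of_nat_mult)
  thus ?thesis unfolding testing_dim_def e by (simp only: nat_le_iff ceiling_le_iff of_int_of_nat_eq of_nat_le_iff)
qed

lemma testing_dim_ge: "n \<le> testing_dim p q n * (q - Q)"
  using testing_dim_le_iff[of n "testing_dim p q n"] by simp

lemma testing_dim_le: "testing_dim p q n \<le> n"
  using mult_left_mono[OF q_minus_Q_pos, of n] by (simp add: testing_dim_le_iff)

lemma testing_dim_Suc: "testing_dim p q (Suc n) \<le> Suc (testing_dim p q n)"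
  using testing_dim_ge[of n] q_minus_Q_pos unfolding testing_dim_le_iff by simp

lemma testing_dim_pos: "0 < n \<Longrightarrow> 1 \<le> testing_dim p q n"
  using testing_dim_ge[of n] by (cases "testing_dim p q n") simp_all

end

context coord_space begin

text \<open>
  By \<open>bad_fraction\<close>, a bad subspace of dimension \<open>l\<close> would make the number of bad subspaces at least
  \<open>q\<^bsup>1 - A\<^esup>\<close> times the number of all, while it is at most \<open>q\<^bsup>- A\<^esup>\<close> times the number of all. The
  constant \<open>A\<close> comes from \<open>bad_fraction\<close> by replacing \<open>l\<close> with its upper bound \<open>m\<close>.
\<close>

lemma polynomial_on_of_ae:
  assumes m: "0 < m" and P: "\<And>i. i < L \<Longrightarrow> P i \<in> mpolys K B" "\<And>i. i < L \<Longrightarrow> mpoly_degree_le K (P i) d"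
    and X': "X' = {lincomb c B | c. c \<in> B \<rightarrow> carrier K \<and> (\<forall>i<L. mpoly_eval K (P i) c = \<zero>)}"
    and f: "f \<in> X' \<rightarrow> carrier K"
    and H1: "\<And>W. affine_subspace K V (testing_dim p q (m + 1)) W \<Longrightarrow> W \<subseteq> X' \<Longrightarrow> polynomial_on K V m W f"
    and H2: "for_ae (real q powr (- A)) {W. affine_subspace K V (testing_dim p q m) W \<and> W \<subseteq> X'}
      (\<lambda>W. polynomial_on K V (m - 1) W f)"
    and A: "A = real ((Suc (L * Suc (m + Suc m * Suc m) ^ Suc d * d) + m + m + 3) * Suc m) + 1"
    and W: "affine_subspace K V j W" "W \<subseteq> X'" "testing_dim p q m \<le> j \<or> j * (q - 1) < m"
  shows "polynomial_on K V (m - 1) W f"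
proof -
  define l where "l = testing_dim p q m"
  define Xs where "Xs = {x \<in> pts B. \<forall>i<L. mpoly_eval K (P i) x = \<zero>}"
  have sm: "Suc (m - 1) = m" using m by simp
  have XX: "X' = \<Phi> ` Xs"
  proof
    show "X' \<subseteq> \<Phi> ` Xs"
    proof
      fix v assume "v \<in> X'"
      then obtain c where c: "v = \<Phi> c" "c \<in> B \<rightarrow> carrier K" "\<forall>i<L. mpoly_eval K (P i) c = \<zero>"
        unfolding X' by (elim CollectE exE conjE) (rule that; assumption)
      have "restrict c B \<in> Xs"
        using c(2,3) mpoly_eval_restrict[OF P(1) c(2)] by (simp add: Xs_def restrict_PiE_iff Pi_def)
      moreover have "v = \<Phi> (restrict c B)" using c(1) \<Phi>_restrict[OF c(2)] by simp
      ultimately show "v \<in> \<Phi> ` Xs" by (intro image_eqI[of v \<Phi> "restrict c B"])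
    qed
    show "\<Phi> ` Xs \<subseteq> X'"
    proof (rule image_subsetI)
      fix x assume "x \<in> Xs"
      thus "\<Phi> x \<in> X'" unfolding X' Xs_def using pts_Pi[of x B] by (intro CollectI exI[of _ x]) simp
    qed
  qed
  have pP: "plt B (Suc d) (mpoly_eval K (P i))" if "i < L" for i
    by (rule plt_mpoly_eval[OF finite_B P(1)[OF that]]) (use P(2)[OF that] in \<open>simp add: mpoly_degree_le_def less_Suc_eq_le\<close>)
  show ?thesis
  proof (cases "l \<le> j")
    case False
    \<comment> \<open>No moments have to be checked: every function on a space of dimension \<open>j\<close> has degree less than \<open>m\<close>.\<close>
    hence j: "j * (q - 1) < m" using W(3) by (simp add: l_def)
    obtain J :: "'v set" and \<psi> where J: "finite J" "card J = j" "amap J B \<psi>" "inj_on \<psi> (pts J)" "(\<lambda>c. \<Phi> (\<psi> c)) ` pts J = W"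
      using affine_subspace_param[OF W(1)] by (elim exE conjE) (rule that; assumption)
    have "plt J (Suc (m - 1)) (\<lambda>c. f (\<Phi> (\<psi> c)))" unfolding sm
    proof (rule plt_of_moments[OF J(1)])
      fix c assume "c \<in> pts J"
      hence "\<Phi> (\<psi> c) \<in> W" unfolding J(5)[symmetric] by (rule imageI)
      hence "\<Phi> (\<psi> c) \<in> X'" by (rule subsetD[OF W(2)])
      with f show "f (\<Phi> (\<psi> c)) \<in> carrier K" by (rule funcset_mem)
    qed (use j J(2) in simp)
    from plt_polynomial_on[OF J(1,3,4) this] show ?thesis unfolding J(5) by simp
  next
    case True
    let ?S = "{W. affine_subspace K V l W \<and> W \<subseteq> X'}"
    let ?G = "{W \<in> ?S. polynomial_on K V (m - 1) W f}"
    let ?Bd = "{W. affine_subspace K V l W \<and> W \<subseteq> X' \<and> \<not> polynomial_on K V (m - 1) W f}"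
    have l: "1 \<le> l" "l \<le> m" unfolding l_def using testing_dim_pos[OF m] testing_dim_le by simp_all
    have l': "testing_dim p q (m + 1) \<le> Suc l" "1 \<le> testing_dim p q (m + 1)" "Suc m \<le> testing_dim p q (m + 1) * (q - Q)"
      unfolding l_def using testing_dim_Suc[of m] testing_dim_pos[of "m + 1"] testing_dim_ge[of "m + 1"] by simp_all
    have key: "polynomial_on K V (m - 1) W f" if "affine_subspace K V l W" "W \<subseteq> X'" for W
    proof (rule ccontr)
      assume nW: "\<not> polynomial_on K V (m - 1) W f"
      define E where "E = (Suc (L * Suc (m + Suc m * Suc m) ^ Suc d * d) + m + m + 3) * Suc m"
      have "Xs \<subseteq> pts B" by (auto simp: Xs_def)
      hence "finite Xs" by (rule finite_subset[OF _ finite_pts[OF finite_B]])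
      hence "finite X'" unfolding XX by (rule finite_imageI)
      hence fS: "finite ?S" by (intro finite_subset[of ?S "Pow X'"]) auto
      have fBd: "finite ?Bd" by (rule finite_subset[OF _ fS]) auto
      have "W \<in> ?Bd" using that nW by simp
      hence "?Bd \<noteq> {}" by blast
      hence Bd1: "0 < card ?Bd" using fBd by (simp only: card_gt_0_iff not_False_eq_True simp_thms)
      have c1: "card ?S \<le> q ^ E * card ?Bd"
      proof -
        let ?N = "Suc (L * Suc (l + Suc m * Suc l) ^ Suc d * d)"
        have "card ?S \<le> q ^ ((?N + l + m + 3) * Suc l) * card ?Bd"
          by (rule bad_fraction[OF pP Xs_def XX f _ l(1) l' H1 that nW refl]) (use m in simp_all)
        also have "\<dots> \<le> q ^ E * card ?Bd"
        proof (intro mult_right_mono power_increasing)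
          have "Suc (l + Suc m * Suc l) \<le> Suc (m + Suc m * Suc m)" using l(2) by (intro Suc_leI le_imp_less_Suc add_mono mult_left_mono) simp_all
          hence "Suc (l + Suc m * Suc l) ^ Suc d \<le> Suc (m + Suc m * Suc m) ^ Suc d" by (rule power_mono) simp
          hence "L * Suc (l + Suc m * Suc l) ^ Suc d * d \<le> L * Suc (m + Suc m * Suc m) ^ Suc d * d"
            by (intro mult_right_mono mult_left_mono) simp_all
          hence "?N + l + m + 3 \<le> Suc (L * Suc (m + Suc m * Suc m) ^ Suc d * d) + m + m + 3" using l(2) by linarith
          thus "(?N + l + m + 3) * Suc l \<le> E" unfolding E_def using l(2) by (intro mult_mono) simp_all
        qed (use q_ge_2 in simp_all)
        finally show ?thesis .
      qed
      have "?S = ?G \<union> ?Bd" "?G \<inter> ?Bd = {}" by blast+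
      hence "card ?S = card ?G + card ?Bd"
        using card_Un_disjoint[of ?G ?Bd] fS fBd by (metis (no_types, lifting) finite_Un)
      moreover have "real (card ?G) \<ge> (1 - real q powr (- A)) * real (card ?S)" using H2 unfolding for_ae_def l_def .
      ultimately have "real (card ?Bd) \<le> real q powr (- A) * real (card ?S)" by (simp add: algebra_simps)
      also have "\<dots> \<le> real q powr (- A) * real (q ^ E * card ?Bd)"
        using c1 by (intro mult_left_mono of_nat_mono) simp_all
      also have "\<dots> = (real q powr (- A) * real q powr real E) * real (card ?Bd)"
        using q_ge_2 by (simp add: powr_realpow)
      also have "real q powr (- A) * real q powr real E = real q powr (- 1)"
      proof -
        have "A = real E + 1" by (simp only: A E_def)
        thus ?thesis by (simp add: powr_add[symmetric])
      qed
      also have "\<dots> = 1 / real q" using q_ge_2 by (simp add: powr_minus_divide)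
      finally have "real q * real (card ?Bd) \<le> real (card ?Bd)" using q_ge_2 by (simp add: field_simps)
      moreover have "2 * real (card ?Bd) \<le> real q * real (card ?Bd)" using q_ge_2 by (intro mult_right_mono) simp_all
      ultimately show False using Bd1 by linarith
    qed
    have "Suc (m - 1) \<le> l * (q - Q)" unfolding sm l_def by (rule testing_dim_ge)
    from polynomial_on_of_subspaces[OF f l(1) this key W(1,2) True] show ?thesis .
  qed
qed

end

theorem corollary1p13:
  fixes m d L :: nat
  assumes "m > 0" and "d > 0" and "L > 0"
  shows "\<exists>A::real. A > 0 \<and>
    (\<forall>(K :: 'a ring) (V :: ('a, 'v) module) (Xk :: 'v set) (f :: 'v \<Rightarrow> 'a) (p :: nat) (q :: nat).
      field K \<longrightarrow> finite (carrier K) \<longrightarrow> q = order K \<longrightarrow> p = ring_characteristic K \<longrightarrow>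
      vectorspace K V \<longrightarrow> vectorspace.fin_dim K V \<longrightarrow>
      complete_intersection K V d L Xk \<longrightarrow>
      f \<in> Xk \<rightarrow> carrier K \<longrightarrow>
      (\<forall>W. affine_subspace K V (testing_dim p q (m + 1)) W \<and> W \<subseteq> Xk \<longrightarrow> polynomial_on K V m W f) \<longrightarrow>
      for_ae (real q powr (- A))
        {W. affine_subspace K V (testing_dim p q m) W \<and> W \<subseteq> Xk}
        (\<lambda>W. polynomial_on K V (m - 1) W f) \<longrightarrow>
      (\<forall>j W. affine_subspace K V j W \<and> W \<subseteq> Xk \<and>
             (testing_dim p q m \<le> j \<or> j * (q - 1) < m) \<longrightarrow>
             polynomial_on K V (m - 1) W f))"
proof -
  define A where "A = real ((Suc (L * Suc (m + Suc m * Suc m) ^ Suc d * d) + m + m + 3) * Suc m) + 1"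
  show ?thesis
  proof (intro exI[of _ A] conjI allI impI)
    show "A > 0" by (simp add: A_def add_nonneg_pos del: of_nat_mult of_nat_add)
  next
    fix K :: "'a ring" and V :: "('a, 'v) module" and Xk :: "'v set" and f :: "'v \<Rightarrow> 'a" and p q j :: nat and W
    assume K: "field K" "finite (carrier K)" and q: "q = order K" and p: "p = ring_characteristic K"
      and V: "vectorspace K V" "vectorspace.fin_dim K V" and X: "complete_intersection K V d L Xk" and f: "f \<in> Xk \<rightarrow> carrier K"
      and H1: "\<forall>W. affine_subspace K V (testing_dim p q (m + 1)) W \<and> W \<subseteq> Xk \<longrightarrow> polynomial_on K V m W f"
      and H2: "for_ae (real q powr (- A)) {W. affine_subspace K V (testing_dim p q m) W \<and> W \<subseteq> Xk}
        (\<lambda>W. polynomial_on K V (m - 1) W f)"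
      and W: "affine_subspace K V j W \<and> W \<subseteq> Xk \<and> (testing_dim p q m \<le> j \<or> j * (q - 1) < m)"
    obtain B and P :: "nat \<Rightarrow> 'v multiset \<Rightarrow> 'a" where B: "vectorspace.basis K V B"
      and P: "\<forall>i<L. P i \<in> mpolys K B \<and> mpoly_degree_le K (P i) d"
      and Xk: "Xk = {module.lincomb V c B | c. c \<in> B \<rightarrow> carrier K \<and> (\<forall>i<L. mpoly_eval K (P i) c = \<zero>\<^bsub>K\<^esub>)}"
      using X unfolding complete_intersection_def by (elim exE conjE) (rule that; assumption)
    have "finite B" using vectorspace.fin_dim_li_fin[OF V] B unfolding vectorspace.basis_def[OF V(1)] by blast
    then interpret coord_space K V B
      by (intro coord_space.intro galois_field.intro coord_space_axioms.intro galois_field_axioms.intro K V(1) B)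
    have pq: "q = card (carrier K)" using q by (simp add: order_def)
    show "polynomial_on K V (m - 1) W f"
      by (rule polynomial_on_of_ae[OF assms(1) _ _ Xk f _ H2[unfolded pq p] A_def, of j])
        (use P H1 W in \<open>simp_all add: pq p\<close>)
  qed
qed

end
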